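(* There is an absolute constant $c>0$ such that the following holds. Let $A\in\mathbb{R}^{n\times n}$ be symmetric positive definite, $b\in\mathbb{R}^n$, $M\in\mathbb{R}^{n\times n}$ symmetric positive definite, and let $\kappa_M$ be the condition number of $M^{-1/2}AM^{-1/2}$. Let $\epsilon\in(0,1)$, and suppose $\mathsf{SolveM}$ is a procedure such that for every input $r\in\mathbb{R}^n$, $\|\mathsf{SolveM}(r)-M^{-1}r\|_M\le\epsilon_0\|M^{-1}r\|_M$, where $\epsilon_0\le(\epsilon/(\kappa_Mn))^c$. Then the Inexact Preconditioned Lanczos procedure (described in the context), run in exact arithmetic with this $\mathsf{SolveM}$ for $t=O(\sqrt{\kappa_M}\log(\kappa_M/\epsilon))$ iterations, outputs $x_t$ with $$\|x_t-A^{-1}b\|_A\le\epsilon\,\|A^{-1}b\|_A.$$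
   Context: Inexact Preconditioned Lanczos (input $A$, $b$, $\mathsf{SolveM}$, $t$): set $\bar w_0=\mathsf{SolveM}(b)$, $z'=\sqrt{\langle b,\bar w_0\rangle}$, $\underline{q}_0=0$, $\bar q_1=\bar w_0/z'$, $\underline{q}_1=b/z'$, $\beta'_1=0$. For $i=1,\dots,t$: $\underline{u}_i=A\bar q_i-\beta'_i\underline{q}_{i-1}$; $\alpha'_i=\langle\underline{u}_i,\bar q_i\rangle$; $\underline{w}_i=\underline{u}_i-\alpha'_i\underline{q}_i$; $\bar w_i=\mathsf{SolveM}(\underline{w}_i)$; $\beta'_{i+1}=\langle\underline{w}_i,\bar w_i\rangle^{1/2}$; if $\beta'_{i+1}=0$ stop the loop; otherwise $\underline{q}_{i+1}=\underline{w}_i/\beta'_{i+1}$, $\bar q_{i+1}=\bar w_i/\beta'_{i+1}$. Let $T'$ be the symmetric tridiagonal matrix with diagonal $\alpha'_1,\dots,\alpha'_t$ and off-diagonal entries $\beta'_2,\dots,\beta'_t$ (with $t$ replaced by the number of completed iterations if the loop stopped early), and $\bar Q=[\bar q_1,\dots,\bar q_t]$. Output $x_t=z'\,\bar QT'^{-1}e_1$, where $e_1$ is the first standard basis vector. Here $\|x\|_B=\sqrt{x^\top Bx}$. *)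

theory Defs
  imports "HOL-Analysis.Analysis" "Jordan_Normal_Form.Gauss_Jordan_Elimination"
    "Jordan_Normal_Form.Spectral_Radius"
begin

definition minv :: "real mat \<Rightarrow> real mat" where
  "minv B = (case mat_inverse B of Some C \<Rightarrow> C | None \<Rightarrow> 0\<^sub>m (dim_row B) (dim_row B))"

definition spd :: "nat \<Rightarrow> real mat \<Rightarrow> bool" where
  "spd n B \<longleftrightarrow> B \<in> carrier_mat n n \<and> transpose_mat B = B \<and>
     (\<forall>x\<in>carrier_vec n. x \<noteq> 0\<^sub>v n \<longrightarrow> x \<bullet> (B *\<^sub>v x) > 0)"

definition mnorm :: "real mat \<Rightarrow> real vec \<Rightarrow> real" where
  "mnorm B x = sqrt (x \<bullet> (B *\<^sub>v x))"

definition inv_sqrt_mat :: "nat \<Rightarrow> real mat \<Rightarrow> real mat" where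
  "inv_sqrt_mat n M = (THE S. spd n S \<and> S * S = minv M)"

definition cond_number :: "real mat \<Rightarrow> real" where
  "cond_number B = Max (spectrum B) / Min (spectrum B)"

(* Inexact preconditioned Lanczos.
   lz_state A b solve k = (q_{i-1}, q_i, qbar_i, beta'_i) for iteration i = k+1
   (underlined q's are q_{...}; barred q's are qbar). *)
fun lz_state :: "real mat \<Rightarrow> real vec \<Rightarrow> (real vec \<Rightarrow> real vec) \<Rightarrow> nat
    \<Rightarrow> real vec \<times> real vec \<times> real vec \<times> real" where
  "lz_state A b solve 0 =
     (let wb0 = solve b; z = sqrt (b \<bullet> wb0)
      in (0\<^sub>v (dim_vec b), (1 / z) \<cdot>\<^sub>v b, (1 / z) \<cdot>\<^sub>v wb0, 0))"
| "lz_state A b solve (Suc k) =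
     (case lz_state A b solve k of (qp, ql, qb, \<beta>) \<Rightarrow>
        let u = A *\<^sub>v qb - \<beta> \<cdot>\<^sub>v qp;
            \<alpha> = u \<bullet> qb;
            w = u - \<alpha> \<cdot>\<^sub>v ql;
            wb = solve w;
            \<beta>' = sqrt (w \<bullet> wb)
        in (ql, (1 / \<beta>') \<cdot>\<^sub>v w, (1 / \<beta>') \<cdot>\<^sub>v wb, \<beta>'))"

definition lz_z :: "real vec \<Rightarrow> (real vec \<Rightarrow> real vec) \<Rightarrow> real" where
  "lz_z b solve = sqrt (b \<bullet> solve b)"

definition lz_alpha :: "real mat \<Rightarrow> real vec \<Rightarrow> (real vec \<Rightarrow> real vec) \<Rightarrow> nat \<Rightarrow> real" where
  "lz_alpha A b solve i = (case lz_state A b solve (i - 1) of (qp, ql, qb, \<beta>) \<Rightarrow>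
      (A *\<^sub>v qb - \<beta> \<cdot>\<^sub>v qp) \<bullet> qb)"

definition lz_beta :: "real mat \<Rightarrow> real vec \<Rightarrow> (real vec \<Rightarrow> real vec) \<Rightarrow> nat \<Rightarrow> real" where
  "lz_beta A b solve i = (case lz_state A b solve (i - 1) of (qp, ql, qb, \<beta>) \<Rightarrow> \<beta>)"

definition lz_qbar :: "real mat \<Rightarrow> real vec \<Rightarrow> (real vec \<Rightarrow> real vec) \<Rightarrow> nat \<Rightarrow> real vec" where
  "lz_qbar A b solve i = (case lz_state A b solve (i - 1) of (qp, ql, qb, \<beta>) \<Rightarrow> qb)"

(* number of completed iterations when asked for t iterations:
   the loop stops after iteration i if beta'_{i+1} = 0 *)
definition lz_iters :: "real mat \<Rightarrow> real vec \<Rightarrow> (real vec \<Rightarrow> real vec) \<Rightarrow> nat \<Rightarrow> nat" where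
  "lz_iters A b solve t =
     (if \<exists>i. 1 \<le> i \<and> i \<le> t \<and> lz_beta A b solve (i + 1) = 0
      then (LEAST i. 1 \<le> i \<and> lz_beta A b solve (i + 1) = 0) else t)"

definition lz_T :: "real mat \<Rightarrow> real vec \<Rightarrow> (real vec \<Rightarrow> real vec) \<Rightarrow> nat \<Rightarrow> real mat" where
  "lz_T A b solve t = (let m = lz_iters A b solve t in
     mat m m (\<lambda>(i, j). if i = j then lz_alpha A b solve (i + 1)
                       else if j = i + 1 then lz_beta A b solve (i + 2)
                       else if i = j + 1 then lz_beta A b solve (j + 2)
                       else 0))"

definition lz_Q :: "real mat \<Rightarrow> real vec \<Rightarrow> (real vec \<Rightarrow> real vec) \<Rightarrow> nat \<Rightarrow> real mat" where
  "lz_Q A b solve t = (let m = lz_iters A b solve t in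
     mat (dim_vec b) m (\<lambda>(r, j). lz_qbar A b solve (j + 1) $ r))"

definition lanczos_out :: "real mat \<Rightarrow> real vec \<Rightarrow> (real vec \<Rightarrow> real vec) \<Rightarrow> nat \<Rightarrow> real vec" where
  "lanczos_out A b solve t =
     lz_z b solve \<cdot>\<^sub>v (lz_Q A b solve t *\<^sub>v
        (minv (lz_T A b solve t) *\<^sub>v unit_vec (lz_iters A b solve t) 0))"

end

(* Write y_i and q_i for the barred and underlined Lanczos vectors. Inexactness destroys their global
   orthogonality, and N_ij = <y_i, q_j> need not be small for i <> j. What survives is local:
   <y_i, q_i> = 1, <y_i, q_{i+1}> = 0, |N_ij - N_ji| = O(eps0), and the three-term recurrence,
   by which N T is the (symmetric) matrix of the form <y_i, A y_j>, up to truncation. As in Paige's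
   analysis of finite precision Lanczos, the commutator of T with the strictly upper part R of N is
   therefore O(eps0), and tr(G [T, R]) for a Green function G of a leading block of T is a boundary
   term that controls s^T R s for the Schur complement vectors s of T. Hence s^T N s is about |s|^2, and
   l M <= A forces the pivots of T - sigma to be positive for sigma somewhat below l: all leading
   blocks satisfy T >= l/2.

   The residual of the output is a multiple of q_{t+1} by beta_{t+1} times the last entry of
   T^{-1} e_1. As T is tridiagonal with spectrum in an interval of bounded ratio O(kappa),
   that entry decays like (1 + 1/(4 sqrt kappa))^(-t), so no comparison with the exact method and no
   Chebyshev polynomials are needed. *)
theory Submission
  imports Defs
begin

unbundle no inner_syntax and no vec_syntax

section \<open>Tridiagonal matrices\<close>

text \<open>A Green function of T - \<sigma> is only as good as the distance from \<sigma> to a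
  lower bound already known, so every new row costs part of the bound: \<sigma> falls from 3l/4 to
  l/2 in m steps of l/(4m). This gap and the m^2 terms of the trace are why the admissible
  perturbation is of order 1/(m^3 \<kappa>). Upper bounds on the coefficients cannot come from
  global orthogonality either. They follow from symmetry of the form at neighbouring index pairs,
  and are needed before the commutator can be called small. The bound on the off-diagonal
  coefficients is proportional to \<kappa> - 1, up to a small multiple of l, and not merely to
  \<kappa>. When \<kappa>/\<epsilon> is close to 1 the prescribed number of iterations can be 1;
  nothing has decayed yet, and the prefactor alone must lie below \<epsilon>. The dimension enters
  only through a factor 2^(-100) that absorbs numerical constants. In dimension one this factor is
  missing, and exactness of a single iteration replaces it.\<close>

lemma sqrt_le_inverse:
  fixes \<tau> :: real
  assumes "\<tau> > 0" "S \<ge> 0" "\<tau> * S \<le> sqrt S"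
  shows "sqrt S \<le> 1 / \<tau>"
proof (cases "S = 0")
  case False
  have "\<tau> * (sqrt S * sqrt S) \<le> sqrt S" using assms by simp
  then have "(\<tau> * sqrt S) * sqrt S \<le> 1 * sqrt S" by (simp only: mult.assoc mult_1_left)
  then have "\<tau> * sqrt S \<le> 1"
    by (rule mult_right_le_imp_le) (use False assms(2) in simp)
  then show ?thesis using assms(1) by (simp add: field_simps)
qed (use assms in simp)

lemma sum_delta_mult:
  fixes f :: "nat \<Rightarrow> real"
  shows "j < k \<Longrightarrow> (\<Sum>i<k. f i * (if i = j then 1 else 0)) = f j"
  by (simp add: if_distrib cong: if_cong)

section \<open>Tridiagonal forms, their Schur complements and Green functions\<close>

locale tridiagonal =
  fixes al b :: "nat \<Rightarrow> real"
  assumes b_0 [simp]: "b 0 = 0"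
begin

text \<open>\<open>b i\<close> couples the indices \<open>i - 1\<close> and \<open>i\<close>. At
  \<open>i = 0\<close> truncated subtraction yields \<open>x 0\<close> in place of a left neighbour,
  and \<open>b 0 = 0\<close> removes it. No size is built in, so that all leading blocks share one
  definition.\<close>

definition tri :: "(nat \<Rightarrow> real) \<Rightarrow> nat \<Rightarrow> real" where
  "tri x i = b i * x (i - 1) + al i * x i + b (Suc i) * x (Suc i)"

text \<open>The tail condition on \<open>x\<close> makes the form see only the leading
  \<open>k\<close> by \<open>k\<close> block: in row \<open>k - 1\<close> the outgoing term
  \<open>b k * x k\<close> vanishes.\<close>

definition tri_ge :: "real \<Rightarrow> nat \<Rightarrow> bool" where
  "tri_ge \<sigma> k \<longleftrightarrow> (\<forall>x. (\<forall>i\<ge>k. x i = 0) \<longrightarrow> \<sigma> * (\<Sum>i<k. (x i)\<^sup>2) \<le> (\<Sum>i<k. x i * tri x i))"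

lemma tri_geD:
  "tri_ge \<sigma> k \<Longrightarrow> (\<And>i. i \<ge> k \<Longrightarrow> x i = 0) \<Longrightarrow> \<sigma> * (\<Sum>i<k. (x i)\<^sup>2) \<le> (\<Sum>i<k. x i * tri x i)"
  by (auto simp: tri_ge_def)

lemma tri_ge_mono: "tri_ge \<sigma> k \<Longrightarrow> \<sigma>' \<le> \<sigma> \<Longrightarrow> tri_ge \<sigma>' k"
  unfolding tri_ge_def
  by (meson mult_right_mono order_trans sum_nonneg zero_le_power2)

lemma tri_ge_Suc: assumes "tri_ge \<sigma> (Suc k)" shows "tri_ge \<sigma> k"
  unfolding tri_ge_def
proof (intro allI impI)
  fix x :: "nat \<Rightarrow> real" assume x: "\<forall>i\<ge>k. x i = 0"
  then have "\<sigma> * (\<Sum>i<Suc k. (x i)\<^sup>2) \<le> (\<Sum>i<Suc k. x i * tri x i)"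
    using tri_geD[OF assms, of x] by auto
  with x show "\<sigma> * (\<Sum>i<k. (x i)\<^sup>2) \<le> (\<Sum>i<k. x i * tri x i)" by simp
qed

text \<open>Summation by parts: the symmetric couplings inside the block cancel, and only the link
  \<open>b k\<close> across the cut is left. Neither function has to vanish outside the block; the
  boundary term is what ties a block to the next row or column.\<close>

lemma green:
  "(\<Sum>j<k. u j * tri f j) - (\<Sum>j<k. f j * tri u j) = b k * (u (k-1) * f k - u k * f (k-1))"
proof (induction k)
  case (Suc k)
  have "(\<Sum>j<Suc k. u j * tri f j) - (\<Sum>j<Suc k. f j * tri u j)
    = b k * (u (k-1) * f k - u k * f (k-1)) + (u k * tri f k - f k * tri u k)"
    using Suc by simp
  also have "\<dots> = b (Suc k) * (u k * f (Suc k) - u (Suc k) * f k)"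
    unfolding tri_def by (simp add: algebra_simps)
  finally show ?case by simp
qed simp

lemma tri_add_scale: "tri (\<lambda>i. f i + c * g i) i = tri f i + c * tri g i"
  unfolding tri_def by (simp add: algebra_simps)

text \<open>The vector is -(T_k - \<sigma>)^(-1) b_k e_(k-1) completed by 1, the column that
  eliminates row \<open>k\<close> in a block factorization of T - \<sigma>. Within the first
  \<open>k + 1\<close> rows its image under T - \<sigma> is the pivot times the last unit
  vector.\<close>

lemma schur_vector:
  assumes "\<And>f. \<exists>u. (\<forall>i\<ge>k. u i = 0) \<and> (\<forall>i<k. tri u i - \<sigma> * u i = f i)"
  obtains s where "s k = 1" "\<And>i. i > k \<Longrightarrow> s i = 0" "\<And>i. i < k \<Longrightarrow> tri s i = \<sigma> * s i"
proof -
  obtain v where v: "\<And>i. i \<ge> k \<Longrightarrow> v i = 0"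
    "\<And>i. i < k \<Longrightarrow> tri v i - \<sigma> * v i = (if Suc i = k then - b k else 0)"
    using assms[of "\<lambda>i. if Suc i = k then - b k else 0"] by blast
  \<comment> \<open>The explicit factor 1 gives \<open>s\<close> the shape required by
    \<open>tri_add_scale\<close>.\<close>
  define s where "s = (\<lambda>i. v i + 1 * (if i = k then 1 else 0))"
  have "tri s i = \<sigma> * s i" if "i < k" for i
  proof -
    have "tri s i = tri v i + (if Suc i = k then b k else 0)"
      unfolding s_def tri_add_scale using that by (auto simp: tri_def)
    with v(2)[OF that] that show ?thesis by (auto simp: s_def split: if_splits)
  qed
  moreover have "s k = 1" "\<And>i. i > k \<Longrightarrow> s i = 0" using v(1) by (auto simp: s_def)
  ultimately show ?thesis using that by blast
qed

text \<open>Elimination, one row at a time: a solution for the first \<open>k\<close> rows is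
  corrected by a multiple of the Schur vector, which leaves those rows intact. The division is by
  the pivot, and the pivot is the value of the form T - \<sigma> at the Schur vector, positive by
  the margin \<open>\<sigma>' - \<sigma>\<close>.\<close>

lemma tri_solve:
  assumes "tri_ge \<sigma>' k" "\<sigma> < \<sigma>'"
  shows "\<exists>u. (\<forall>i\<ge>k. u i = 0) \<and> (\<forall>i<k. tri u i - \<sigma> * u i = f i)"
  using assms(1)
proof (induction k arbitrary: f)
  case 0
  show ?case by (intro exI[of _ "\<lambda>_. 0"]) simp
next
  case (Suc k)
  note IH = Suc.IH[OF tri_ge_Suc[OF Suc.prems]]
  obtain s where s: "s k = 1" "\<And>i. i > k \<Longrightarrow> s i = 0" "\<And>i. i < k \<Longrightarrow> tri s i = \<sigma> * s i"
    using schur_vector[OF IH] by blast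
  define p where "p = tri s k - \<sigma> * s k"
  have "\<sigma>' * (\<Sum>i<Suc k. (s i)\<^sup>2) \<le> (\<Sum>i<Suc k. s i * tri s i)"
    using tri_geD[OF Suc.prems, of s] s(2) by auto
  also have "\<dots> = p + \<sigma> * (\<Sum>i<Suc k. (s i)\<^sup>2)"
    using s(1,3) by (simp add: p_def sum_distrib_left power2_eq_square algebra_simps)
  finally have "(\<sigma>' - \<sigma>) * (\<Sum>i<Suc k. (s i)\<^sup>2) \<le> p" by (simp add: algebra_simps)
  moreover have "(\<Sum>i<Suc k. (s i)\<^sup>2) > 0" using s(1) by (simp add: add_nonneg_pos sum_nonneg)
  ultimately have "p > 0" using assms(2)
    by (meson diff_gt_0_iff_gt less_le_trans mult_pos_pos)
  obtain u where u: "\<And>i. i \<ge> k \<Longrightarrow> u i = 0" "\<And>i. i < k \<Longrightarrow> tri u i - \<sigma> * u i = f i"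
    using IH by blast
  define c where "c = (f k - tri u k) / p"
  have "tri (\<lambda>i. u i + c * s i) i - \<sigma> * (u i + c * s i) = f i" if "i < Suc k" for i
  proof (cases "i = k")
    case True
    have "c * p = f k - tri u k" using \<open>p > 0\<close> by (simp add: c_def)
    then show ?thesis using True u(1)[of k] by (simp add: tri_add_scale p_def algebra_simps)
  next
    case False
    with that have "i < k" by simp
    with u(2)[of i] s(3)[of i] show ?thesis by (simp add: tri_add_scale algebra_simps)
  qed
  moreover have "u i + c * s i = 0" if "i \<ge> Suc k" for i
    using that u(1) s(2) by simp
  ultimately show ?case by (intro exI[of _ "\<lambda>i. u i + c * s i"]) auto
qed

text \<open>\<open>G j\<close> is column \<open>j\<close> of the inverse of T_k - \<sigma>.
  Coercivity with margin \<open>\<sigma>' - \<sigma>\<close> bounds the norm of this inverse, and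
  its entries with it.\<close>

lemma green_function:
  assumes "tri_ge \<sigma>' k" "\<sigma> < \<sigma>'"
  obtains G where
    "\<And>i j. i \<ge> k \<Longrightarrow> G j i = 0"
    "\<And>i j. i < k \<Longrightarrow> tri (G j) i = \<sigma> * G j i + (if i = j then 1 else 0)"
    "\<And>i j. i < k \<Longrightarrow> j < k \<Longrightarrow> G j i = G i j"
    "\<And>i j. i < k \<Longrightarrow> j < k \<Longrightarrow> \<bar>G j i\<bar> \<le> 1 / (\<sigma>' - \<sigma>)"
proof -
  have "\<forall>j. \<exists>u. (\<forall>i\<ge>k. u i = 0) \<and> (\<forall>i<k. tri u i - \<sigma> * u i = (if i = j then 1 else 0))"
    by (intro allI tri_solve[OF assms])
  then obtain G where G0: "\<And>j. (\<forall>i\<ge>k. G j i = 0)"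
    "\<And>j. (\<forall>i<k. tri (G j) i - \<sigma> * G j i = (if i = j then 1 else 0))" by metis
  have Ga: "\<And>i j. i \<ge> k \<Longrightarrow> G j i = 0" using G0 by blast
  have Gb: "\<And>i j. i < k \<Longrightarrow> tri (G j) i = \<sigma> * G j i + (if i = j then 1 else 0)"
  proof -
    fix i j assume "i < k"
    then have "tri (G j) i - \<sigma> * G j i = (if i = j then 1 else 0)" using G0(2) by blast
    then show "tri (G j) i = \<sigma> * G j i + (if i = j then 1 else 0)" by linarith
  qed
  have pair: "(\<Sum>i<k. f i * tri (G j) i) = \<sigma> * (\<Sum>i<k. f i * G j i) + f j" if "j < k" for f j
    using that by (simp add: Gb distrib_left sum.distrib sum_delta_mult sum_distrib_left mult_ac)
  have Gc: "G j i = G i j" if "i < k" "j < k" for i j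
    using green[of "G i" "G j" k] pair[OF that(2), of "G i"] pair[OF that(1), of "G j"] Ga[of k]
    by (simp add: mult.commute)
  have Gd: "\<bar>G j i\<bar> \<le> 1 / (\<sigma>' - \<sigma>)" if "i < k" "j < k" for i j
  proof -
    define S where "S = (\<Sum>i<k. (G j i)\<^sup>2)"
    have "\<sigma>' * S \<le> (\<Sum>i<k. G j i * tri (G j) i)"
      unfolding S_def using tri_geD[OF assms(1), of "G j"] Ga by blast
    then have 1: "(\<sigma>' - \<sigma>) * S \<le> G j j"
      using pair[OF that(2), of "G j"] by (simp add: S_def power2_eq_square algebra_simps)
    have le: "(G j i)\<^sup>2 \<le> S" if "i < k" for i
      unfolding S_def using that by (intro member_le_sum) auto
    have S0: "S \<ge> 0" unfolding S_def by (simp add: sum_nonneg)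
    have r: "\<bar>G j i\<bar> \<le> sqrt S" if "i < k" for i
      using le[OF that] real_le_rsqrt[of "\<bar>G j i\<bar>" S] by simp
    \<comment> \<open>The margin times |G j|^2 is at most the single entry \<open>G j j\<close>,
      which is at most |G j|; dividing by |G j| gives the bound.\<close>
    have "sqrt S \<le> 1 / (\<sigma>' - \<sigma>)"
      using sqrt_le_inverse[of "\<sigma>' - \<sigma>" S] 1 r[OF that(2)] S0 assms(2) by simp
    with r[OF that(1)] show ?thesis by linarith
  qed
  show ?thesis using that Ga Gb Gc Gd by blast
qed

text \<open>The weights \<open>\<rho>\<^sup>i\<close> conjugate the tridiagonal form into itself plus a small perturbation
  (the Combes--Thomas argument), so its inverse decays away from the diagonal.\<close>

lemma tri_inverse_decay:
  assumes ge: "tri_ge \<sigma> m" and u: "\<And>i. i \<ge> m \<Longrightarrow> u i = 0"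
    "\<And>i. i < m \<Longrightarrow> tri u i = (if i = 0 then 1 else 0)"
    and \<rho>: "\<rho> \<ge> 1" and B: "\<And>i. i < m \<Longrightarrow> \<bar>b i\<bar> \<le> B" and \<tau>: "\<tau> > 0" "\<sigma> \<ge> \<tau> + B * (\<rho> - 1)\<^sup>2"
    and k: "k < m"
  shows "\<bar>u k\<bar> * \<rho> ^ k \<le> 1 / \<tau>"
proof -
  define x where "x = (\<lambda>i. \<rho> ^ i * u i)"
  define \<theta> where "\<theta> = \<rho> + 1 / \<rho> - 2"
  have \<theta>: "0 \<le> \<theta>" "\<theta> \<le> (\<rho> - 1)\<^sup>2"
  proof -
    have eq: "\<theta> = (\<rho> - 1)\<^sup>2 / \<rho>"
      using \<rho> by (simp add: \<theta>_def field_simps power2_eq_square)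
    show "0 \<le> \<theta>" unfolding eq using \<rho> by simp
    show "\<theta> \<le> (\<rho> - 1)\<^sup>2" unfolding eq using \<rho> by (simp add: divide_le_eq mult_le_cancel_left1)
  qed
  define S where "S = (\<Sum>i<m. (x i)\<^sup>2)"
  \<comment> \<open>Each link \<open>b i\<close> contributes twice its product to the form of
    \<open>x\<close>, but \<rho> + 1/\<rho> times it to the weighted form of \<open>u\<close>; hence
    the defect \<theta>. The last link of a partial sum has been met from one side only, which is
    the correction at \<open>k\<close>.\<close>
  have form: "(\<Sum>i<k. x i * tri x i) = (\<Sum>i<k. \<rho> ^ (2 * i) * (u i * tri u i))
      - \<theta> * (\<Sum>i<k. b i * (x (i - 1) * x i)) + b k * x (k-1) * x k * (1 - 1 / \<rho>)" for k
  proof (induction k)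
    case (Suc k)
    have up: "\<rho> ^ (2 * k) * (u k * (b (Suc k) * u (Suc k))) = b (Suc k) * x k * x (Suc k) / \<rho>"
      using \<rho> by (simp add: x_def field_simps power_mult power2_eq_square power_mult_distrib)
    have dn: "\<rho> ^ (2 * k) * (u k * (b k * u (k-1))) = b k * x (k-1) * x k * \<rho>"
      using \<rho> by (cases k) (simp_all add: x_def field_simps power_mult power2_eq_square power_mult_distrib)
    have mid: "\<rho> ^ (2 * k) * (u k * (al k * u k)) = al k * x k * x k"
      by (simp add: x_def power_mult power2_eq_square power_mult_distrib)
    have "\<rho> ^ (2 * k) * (u k * tri u k) = b k * x (k-1) * x k * \<rho> + al k * x k * x k
        + b (Suc k) * x k * x (Suc k) / \<rho>"
      unfolding up[symmetric] dn[symmetric] mid[symmetric] tri_def by (simp add: algebra_simps)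
    then show ?case using Suc
      by (simp add: tri_def \<theta>_def algebra_simps)
  qed simp
  have cs: "(\<Sum>i<k. \<bar>b i * (x (i-1) * x i)\<bar>) \<le> B * ((\<Sum>i<k. (x i)\<^sup>2) - (x (k-1))\<^sup>2 / 2)"
    if "0 < k" "k \<le> m" for k
    using that
  proof (induction k rule: nat_induct_non_zero)
    case 1
    then have "0 \<le> B" using B[of 0] by simp
    then show ?case by simp
  next
    case (Suc k)
    have "\<bar>x (k-1) * x k\<bar> \<le> ((x (k-1))\<^sup>2 + (x k)\<^sup>2) / 2"
      using sum_squares_bound[of "\<bar>x (k-1)\<bar>" "\<bar>x k\<bar>"] by (simp add: abs_mult)
    moreover have "\<bar>b k\<bar> \<le> B" using B Suc.prems by simp
    ultimately have "\<bar>b k * (x (k-1) * x k)\<bar> \<le> B * (((x (k-1))\<^sup>2 + (x k)\<^sup>2) / 2)"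
      unfolding abs_mult[of "b k"] by (intro mult_mono) auto
    then show ?case using Suc by (simp add: algebra_simps)
  qed
  have "0 < m" using k by simp
  have B0: "B \<ge> 0" using B[OF k] by linarith
  have S0: "S \<ge> 0" unfolding S_def by (simp add: sum_nonneg)
  have xS: "\<bar>x i\<bar> \<le> sqrt S" if "i < m" for i
  proof -
    have "(x i)\<^sup>2 \<le> S" unfolding S_def using that by (intro member_le_sum) auto
    then show ?thesis using real_le_rsqrt[of "\<bar>x i\<bar>" S] by simp
  qed
  have "(\<Sum>i<m. \<rho> ^ (2 * i) * (u i * tri u i)) = (\<Sum>i<m. \<rho> ^ (2 * i) * u i * (if i = 0 then 1 else 0))"
    using u(2) by (intro sum.cong) auto
  also have "\<dots> = x 0" using sum_delta_mult[OF \<open>0 < m\<close>] by (simp add: x_def)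
  finally have 1: "(\<Sum>i<m. x i * tri x i) = x 0 - \<theta> * (\<Sum>i<m. b i * (x (i - 1) * x i))"
    using form[of m] u(1)[of m] by (simp add: x_def)
  have "\<bar>\<Sum>i<m. b i * (x (i - 1) * x i)\<bar> \<le> B * (S - (x (m-1))\<^sup>2 / 2)"
    unfolding S_def by (rule order_trans[OF sum_abs cs[OF \<open>0 < m\<close> order_refl]])
  also have "\<dots> \<le> B * S" using B0 by (intro mult_left_mono) auto
  finally have "\<theta> * \<bar>\<Sum>i<m. b i * (x (i - 1) * x i)\<bar> \<le> (\<rho> - 1)\<^sup>2 * (B * S)"
    using \<theta> B0 S0 by (intro mult_mono) auto
  moreover have "- \<theta> * (\<Sum>i<m. b i * (x (i - 1) * x i)) \<le> \<theta> * \<bar>\<Sum>i<m. b i * (x (i - 1) * x i)\<bar>"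
    using \<theta>(1) by (simp add: abs_if mult_nonneg_nonneg)
  moreover have "\<sigma> * S \<le> (\<Sum>i<m. x i * tri x i)"
    unfolding S_def using tri_geD[OF ge, of x] u(1) by (simp add: x_def)
  moreover have "(\<tau> + B * (\<rho> - 1)\<^sup>2) * S \<le> \<sigma> * S" using \<tau>(2) S0 by (rule mult_right_mono)
  \<comment> \<open>The right-hand side is the first unit vector with weight \<rho>^0 = 1, so the
    weighted form reduces to the entry \<open>x 0\<close>, which is at most the norm of
    \<open>x\<close>.\<close>
  ultimately have "\<tau> * S \<le> x 0" using 1 by (simp add: algebra_simps)
  then have "sqrt S \<le> 1 / \<tau>"
    using xS[OF \<open>0 < m\<close>] \<tau>(1) S0 by (intro sqrt_le_inverse) auto
  with xS[OF k] have "\<bar>x k\<bar> \<le> 1 / \<tau>" by linarith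
  then show ?thesis using \<rho> by (simp add: x_def abs_mult mult.commute)
qed

end

section \<open>Locally orthogonal bases\<close>

lemma abs_double_sum_le:
  fixes s :: "nat \<Rightarrow> real"
  assumes "\<And>i j. i < k \<Longrightarrow> j < k \<Longrightarrow> \<bar>c i j\<bar> \<le> h"
  shows "\<bar>\<Sum>i<k. \<Sum>j<k. s i * s j * c i j\<bar> \<le> h * (\<Sum>i<k. \<bar>s i\<bar>)\<^sup>2"
proof -
  have "\<bar>\<Sum>i<k. \<Sum>j<k. s i * s j * c i j\<bar> \<le> (\<Sum>i<k. \<Sum>j<k. \<bar>s i * s j * c i j\<bar>)"
    by (intro order_trans[OF sum_abs] sum_mono sum_abs)
  also have "\<dots> \<le> (\<Sum>i<k. \<Sum>j<k. h * (\<bar>s i\<bar> * \<bar>s j\<bar>))"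
    using assms by (intro sum_mono) (auto simp: abs_mult mult.commute intro!: mult_right_mono)
  also have "\<dots> = h * (\<Sum>i<k. \<bar>s i\<bar>)\<^sup>2"
    unfolding power2_eq_square sum_product by (simp only: sum_distrib_left)
  finally show ?thesis .
qed

lemma sum_abs_squared_le:
  fixes s :: "nat \<Rightarrow> real"
  shows "(\<Sum>i<k. \<bar>s i\<bar>)\<^sup>2 \<le> real k * (\<Sum>i<k. (s i)\<^sup>2)"
  using sum_squared_le_sum_of_squares[of "\<lambda>i. \<bar>s i\<bar>" "{..<k}"] by (simp add: mult.commute)

text \<open>The entries \<open>N i j\<close> stand for the inner products of the \<open>i\<close>-th barred with the \<open>j\<close>-th
  underlined Lanczos vector. They need not be small off the diagonal; only consecutive vectors
  are orthogonal, and \<open>N\<close> is symmetric up to \<open>\<eta>\<close>.\<close>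

locale lanczos_array = tridiagonal al b for al b :: "nat \<Rightarrow> real" +
  fixes N :: "nat \<Rightarrow> nat \<Rightarrow> real" and m :: nat and l \<eta> :: real
  assumes N_diag: "i < m \<Longrightarrow> N i i = 1"
    and N_super: "i < m \<Longrightarrow> N i (Suc i) = 0"
    and N_asym: "i < m \<Longrightarrow> j < m \<Longrightarrow> \<bar>N i j - N j i\<bar> \<le> \<eta>"
    and form_sym: "i < m \<Longrightarrow> j < m \<Longrightarrow> tri (N i) j = tri (N j) i"
    and coercive: "k \<le> m \<Longrightarrow>
      l * ((\<Sum>i<k. \<Sum>j<k. s i * s j * N i j) - \<eta> * (\<Sum>i<k. \<bar>s i\<bar>)\<^sup>2)
        \<le> (\<Sum>i<k. \<Sum>j<k. s i * s j * tri (N i) j)"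
    and l_pos: "l > 0" and \<eta>_nonneg: "\<eta> \<ge> 0"
begin

section \<open>The commutator with the upper part, and positivity of the pivots\<close>

definition R :: "nat \<Rightarrow> nat \<Rightarrow> real" where
  "R i j = (if i < j then N i j else 0)"

text \<open>Entry (i, j) of TR - RT: the first term applies T to column \<open>j\<close> of
  \<open>R\<close>, the second to row \<open>i\<close>. The infinite T is used, so entries of
  \<open>R\<close> just outside a block enter as well.\<close>

definition H :: "nat \<Rightarrow> nat \<Rightarrow> real" where
  "H i j = tri (\<lambda>p. R p j) i - tri (R i) j"

text \<open>Symmetry of the form makes the commutator of the strictly upper part \<open>R\<close> with the
  tridiagonal matrix small, although \<open>R\<close> itself is not.\<close>

lemma H_bound:
  assumes i: "i < m" and j: "j < m" and K: "\<And>i. i < m \<Longrightarrow> \<bar>al i\<bar> \<le> K" "\<And>i. i < m \<Longrightarrow> \<bar>b i\<bar> \<le> K"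
  shows "\<bar>H i j\<bar> \<le> 3 * K * \<eta>"
proof (cases "i < j")
  case True
  \<comment> \<open>On indices up to \<open>j\<close>, row \<open>j\<close> of \<open>N\<close> is
    column \<open>j\<close> of \<open>R\<close> plus the unit diagonal entry, with an error
    \<open>d\<close> that comes from asymmetry alone.\<close>
  define d where "d = (\<lambda>p. N j p - R p j - (if p = j then 1 else 0))"
  have d: "\<bar>d p\<bar> \<le> \<eta>" if "p \<le> j" for p
    using that j N_asym[of j p] N_diag[of j] \<eta>_nonneg by (auto simp: d_def R_def)
  have "tri (N i) j = tri (R i) j + (if Suc i = j then b j else 0)"
    using True N_diag[OF i] by (auto simp: tri_def R_def algebra_simps)
  moreover have "tri (N j) i = tri (\<lambda>p. R p j) i + (if Suc i = j then b j else 0)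
      + (b i * d (i-1) + al i * d i + b (Suc i) * d (Suc i))"
    using True by (auto simp: tri_def d_def algebra_simps)
  ultimately have "H i j = - (b i * d (i-1) + al i * d i + b (Suc i) * d (Suc i))"
    using form_sym[OF i j] by (simp add: H_def)
  moreover have "\<bar>b i * d (i-1)\<bar> \<le> K * \<eta>" "\<bar>al i * d i\<bar> \<le> K * \<eta>" "\<bar>b (Suc i) * d (Suc i)\<bar> \<le> K * \<eta>"
    unfolding abs_mult using d K True i j by (auto intro!: mult_mono intro: order_trans[OF abs_ge_zero])
  ultimately show ?thesis by linarith
next
  case False
  \<comment> \<open>On and below the diagonal the commutator vanishes outright: it reaches only
    entries of \<open>R\<close> at or below the first superdiagonal, which are zero by definition or
    by \<open>N_super\<close>.\<close>
  have "b i * R (i-1) j = 0"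
  proof (cases "i = 0 \<or> \<not> i - 1 < j")
    case out: False
    then have "j = Suc (i-1)" using False by linarith
    then show ?thesis using N_super[of "i-1"] i by (simp add: R_def)
  qed (auto simp: R_def)
  moreover have "R i (Suc j) = 0"
    using False N_super[OF i] by (auto simp: R_def less_Suc_eq)
  ultimately have "H i j = 0" using False by (auto simp: H_def tri_def R_def)
  moreover have "0 \<le> K" using K(1)[OF i] by linarith
  ultimately show ?thesis using \<eta>_nonneg by simp
qed

text \<open>Over the block, tr(G(TR - RT)) would vanish by cyclicity, as G commutes with T_k; what
  remains is the link from \<open>k - 1\<close> to \<open>k\<close>. A column \<open>j < k\<close>
  of \<open>R\<close> is zero at index \<open>k\<close>, so only the rows of \<open>R\<close>
  contribute, each through \<open>R i k\<close>. The unit terms drop out because \<open>R\<close>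
  has zero diagonal.\<close>

lemma column_sum_eq_trace:
  assumes G: "\<And>i j. i \<ge> k \<Longrightarrow> G j i = 0"
    "\<And>i j. i < k \<Longrightarrow> tri (G j) i = \<sigma> * G j i + (if i = j then 1 else 0)"
    "\<And>i j. i < k \<Longrightarrow> j < k \<Longrightarrow> G j i = G i j"
  shows "- b k * (\<Sum>i<k. G i (k-1) * R i k) = (\<Sum>i<k. \<Sum>j<k. G j i * H i j)"
proof -
  have pair: "(\<Sum>i<k. f i * tri (G j) i) = \<sigma> * (\<Sum>i<k. f i * G j i) + f j" if "j < k" for f j
    using that by (simp add: G(2) distrib_left sum.distrib sum_delta_mult sum_distrib_left mult_ac)
  have 1: "(\<Sum>i<k. G j i * tri (\<lambda>p. R p j) i) = \<sigma> * (\<Sum>i<k. R i j * G j i)" if "j < k" for j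
    using green[of "G j" "\<lambda>p. R p j" k] pair[OF that, of "\<lambda>p. R p j"] that G(1)[of k]
    by (simp add: R_def)
  have 2: "(\<Sum>j<k. G j i * tri (R i) j) = \<sigma> * (\<Sum>j<k. R i j * G j i) + b k * (G i (k-1) * R i k)"
    if "i < k" for i
  proof -
    have "(\<Sum>j<k. G j i * tri (R i) j) = (\<Sum>j<k. G i j * tri (R i) j)"
      using that by (intro sum.cong) (auto simp: G(3))
    also have "\<dots> = \<sigma> * (\<Sum>j<k. R i j * G i j) + b k * (G i (k-1) * R i k)"
      using green[of "G i" "R i" k] pair[OF that, of "R i"] G(1)[of k] by (simp add: R_def)
    also have "(\<Sum>j<k. R i j * G i j) = (\<Sum>j<k. R i j * G j i)"
      using that by (intro sum.cong) (auto simp: G(3))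
    finally show ?thesis .
  qed
  have "(\<Sum>i<k. \<Sum>j<k. G j i * H i j) = (\<Sum>i<k. \<Sum>j<k. G j i * tri (\<lambda>p. R p j) i)
      - (\<Sum>i<k. \<Sum>j<k. G j i * tri (R i) j)"
    by (simp add: H_def right_diff_distrib sum_subtractf)
  also have "(\<Sum>i<k. \<Sum>j<k. G j i * tri (\<lambda>p. R p j) i) = (\<Sum>j<k. \<Sum>i<k. G j i * tri (\<lambda>p. R p j) i)"
    by (rule sum.swap)
  also have "\<dots> = \<sigma> * (\<Sum>j<k. \<Sum>i<k. R i j * G j i)"
    using 1 by (simp add: sum_distrib_left)
  also have "(\<Sum>j<k. \<Sum>i<k. R i j * G j i) = (\<Sum>i<k. \<Sum>j<k. R i j * G j i)"
    by (rule sum.swap)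
  also have "(\<Sum>i<k. \<Sum>j<k. G j i * tri (R i) j)
      = \<sigma> * (\<Sum>i<k. \<Sum>j<k. R i j * G j i) + b k * (\<Sum>i<k. G i (k-1) * R i k)"
    using 2 by (simp add: sum.distrib sum_distrib_left)
  finally show ?thesis by simp
qed

text \<open>s^T R s is summed by columns. Above index \<open>k\<close> the entries of
  \<open>s\<close> are multiples of the last column of the Green function of block \<open>k\<close>,
  so column \<open>k\<close> contributes the square of \<open>s k\<close> times a trace with at most
  m^2 terms, each a Green function entry times a commutator entry. Every \<open>k\<close> has its
  own Green function, since \<open>tri_ge\<close> passes to smaller blocks.\<close>

lemma cross_term_bound:
  assumes n: "n < m" and ge: "tri_ge \<sigma>' n" and \<sigma>: "\<sigma> < \<sigma>'"
    and s: "\<And>i. i < n \<Longrightarrow> tri s i = \<sigma> * s i"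
    and K: "\<And>i. i < m \<Longrightarrow> \<bar>al i\<bar> \<le> K" "\<And>i. i < m \<Longrightarrow> \<bar>b i\<bar> \<le> K"
  shows "\<bar>\<Sum>i<Suc n. \<Sum>j<Suc n. s i * s j * R i j\<bar>
    \<le> (real m)\<^sup>2 * (3 * K * \<eta>) / (\<sigma>' - \<sigma>) * (\<Sum>k<Suc n. (s k)\<^sup>2)"
proof -
  have K0: "K \<ge> 0" using K(1)[OF n] by linarith
  have col: "\<bar>\<Sum>i<k. s i * s k * R i k\<bar> \<le> (real m)\<^sup>2 * (3 * K * \<eta>) / (\<sigma>' - \<sigma>) * (s k)\<^sup>2"
    if k: "k \<le> n" for k
  proof -
    have "tri_ge \<sigma>' k" using k ge by (induction rule: inc_induct) (auto intro: tri_ge_Suc)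
    from green_function[OF this \<sigma>] obtain G where G: "\<And>i j. i \<ge> k \<Longrightarrow> G j i = 0"
      "\<And>i j. i < k \<Longrightarrow> tri (G j) i = \<sigma> * G j i + (if i = j then 1 else 0)"
      "\<And>i j. i < k \<Longrightarrow> j < k \<Longrightarrow> G j i = G i j"
      "\<And>i j. i < k \<Longrightarrow> j < k \<Longrightarrow> \<bar>G j i\<bar> \<le> 1 / (\<sigma>' - \<sigma>)" by blast
    \<comment> \<open>In the first \<open>k\<close> rows \<open>s\<close> solves the homogeneous
      equation, so Green's identity against \<open>G i\<close> expresses \<open>s i\<close> by the
      boundary value \<open>s k\<close>.\<close>
    have si: "s i = - b k * s k * G i (k-1)" if "i < k" for i
    proof -
      have "(\<Sum>p<k. s p * tri (G i) p) = \<sigma> * (\<Sum>p<k. s p * G i p) + s i"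
        using that by (simp add: G(2) distrib_left sum.distrib sum_delta_mult sum_distrib_left mult_ac)
      moreover have "(\<Sum>p<k. G i p * tri s p) = \<sigma> * (\<Sum>p<k. s p * G i p)"
        using s k by (simp add: sum_distrib_left mult_ac)
      ultimately have "s i = - (b k * (G i (k-1) * s k))" using green[of "G i" s k] G(1)[of k] by simp
      then show ?thesis by (simp add: mult_ac)
    qed
    have "(\<Sum>i<k. s i * s k * R i k) = (s k)\<^sup>2 * (- b k * (\<Sum>i<k. G i (k-1) * R i k))"
      unfolding sum_distrib_left by (intro sum.cong) (simp_all add: si power2_eq_square)
    also have "\<dots> = (s k)\<^sup>2 * (\<Sum>i<k. \<Sum>j<k. G j i * H i j)"
      by (subst column_sum_eq_trace[OF G(1-3)]) auto
    finally have eq: "(\<Sum>i<k. s i * s k * R i k) = (s k)\<^sup>2 * (\<Sum>i<k. \<Sum>j<k. G j i * H i j)" .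
    have "\<bar>\<Sum>i<k. \<Sum>j<k. G j i * H i j\<bar> \<le> (\<Sum>i<k. \<Sum>j<k. \<bar>G j i * H i j\<bar>)"
      by (intro order_trans[OF sum_abs] sum_mono sum_abs)
    also have "\<dots> \<le> (\<Sum>i<k. \<Sum>j<k. 1 / (\<sigma>' - \<sigma>) * (3 * K * \<eta>))"
      unfolding abs_mult using G(4) H_bound[OF _ _ K] k n \<sigma> by (intro sum_mono mult_mono) auto
    also have "\<dots> = (real k)\<^sup>2 * (3 * K * \<eta> / (\<sigma>' - \<sigma>))" by (simp add: power2_eq_square)
    also have "\<dots> \<le> (real m)\<^sup>2 * (3 * K * \<eta> / (\<sigma>' - \<sigma>))"
      using k n \<sigma> K0 \<eta>_nonneg by (intro mult_right_mono power_mono divide_nonneg_nonneg) auto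
    also have "\<dots> = (real m)\<^sup>2 * (3 * K * \<eta>) / (\<sigma>' - \<sigma>)" by simp
    finally show ?thesis unfolding eq abs_mult by (simp only: mult.commute[of _ "(s k)\<^sup>2"] abs_power2 mult_left_mono zero_le_power2)
  qed
  have "(\<Sum>i<Suc n. \<Sum>j<Suc n. s i * s j * R i j) = (\<Sum>j<Suc n. \<Sum>i<Suc n. s i * s j * R i j)"
    by (rule sum.swap)
  also have "\<dots> = (\<Sum>j<Suc n. \<Sum>i<j. s i * s j * R i j)"
    by (intro sum.cong refl sum.mono_neutral_right) (auto simp: R_def)
  finally have "\<bar>\<Sum>i<Suc n. \<Sum>j<Suc n. s i * s j * R i j\<bar> \<le> (\<Sum>j<Suc n. \<bar>\<Sum>i<j. s i * s j * R i j\<bar>)"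
    by (simp only: sum_abs)
  also have "\<dots> \<le> (\<Sum>j<Suc n. (real m)\<^sup>2 * (3 * K * \<eta>) / (\<sigma>' - \<sigma>) * (s j)\<^sup>2)"
    by (intro sum_mono col) auto
  finally show ?thesis by (simp only: sum_distrib_left)
qed

text \<open>T s is \<sigma> s plus the pivot in row \<open>n\<close>, so the form NT yields \<sigma>
  s^T N s, plus \<open>p\<close> times column \<open>n\<close> of N, plus the link to column
  \<open>n + 1\<close>. The diagonal entry of N gives \<open>p\<close>; the rest consists of columns
  of \<open>R\<close> that need not be small, partly with the unknown \<open>p\<close> as a factor.
  Exactly these terms occur in s^T H s with the opposite sign.\<close>

lemma schur_pivot_energy:
  assumes n: "n < m" and s: "s n = 1" "\<And>i. i > n \<Longrightarrow> s i = 0" "\<And>i. i < n \<Longrightarrow> tri s i = \<sigma> * s i"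
  defines "p \<equiv> tri s n - \<sigma>"
  shows "(\<Sum>i<Suc n. \<Sum>j<Suc n. s i * s j * tri (N i) j)
    = \<sigma> * (\<Sum>i<Suc n. \<Sum>j<Suc n. s i * s j * N i j) + p - (\<Sum>i<Suc n. \<Sum>j<Suc n. s i * s j * H i j)"
proof -
  let ?k = "Suc n"
  have pair: "(\<Sum>j<?k. f j * tri s j) = \<sigma> * (\<Sum>j<?k. s j * f j) + p * f n" for f
    using s by (simp add: p_def sum_distrib_left algebra_simps)
  have row: "(\<Sum>j<?k. s j * tri f j) = \<sigma> * (\<Sum>j<?k. s j * f j) + p * f n + b ?k * f ?k" for f
    using green[of s f ?k] pair[of f] s(1,2) by simp
  have rowN: "(\<Sum>j<?k. s j * tri (N i) j) = \<sigma> * (\<Sum>j<?k. s j * N i j) + p * R i n + b ?k * R i ?k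
      + (if i = n then p else 0)" if "i < ?k" for i
    using row[of "N i"] that N_diag[OF n] by (auto simp: R_def)
  have E: "(\<Sum>i<?k. \<Sum>j<?k. s i * s j * tri (N i) j) = \<sigma> * (\<Sum>i<?k. \<Sum>j<?k. s i * s j * N i j)
      + p + (\<Sum>i<?k. s i * (p * R i n + b ?k * R i ?k))"
  proof -
    have "(\<Sum>i<?k. \<Sum>j<?k. s i * s j * tri (N i) j) = (\<Sum>i<?k. s i * (\<Sum>j<?k. s j * tri (N i) j))"
      unfolding sum_distrib_left by (simp only: mult.assoc)
    also have "\<dots> = (\<Sum>i<?k. s i * (\<sigma> * (\<Sum>j<?k. s j * N i j)) + s i * (p * R i n + b ?k * R i ?k)
      + p * (s i * (if i = n then 1 else 0)))"
      by (intro sum.cong refl) (subst rowN, auto simp: algebra_simps)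
    also have "\<dots> = (\<Sum>i<?k. s i * (\<sigma> * (\<Sum>j<?k. s j * N i j)))
      + (\<Sum>i<?k. s i * (p * R i n + b ?k * R i ?k)) + p"
      using sum_delta_mult[of n ?k s] s(1) by (simp only: sum.distrib sum_distrib_left[symmetric])
    also have "(\<Sum>i<?k. s i * (\<sigma> * (\<Sum>j<?k. s j * N i j))) = \<sigma> * (\<Sum>i<?k. \<Sum>j<?k. s i * s j * N i j)"
      unfolding sum_distrib_left by (simp only: mult_ac)
    finally show ?thesis by linarith
  qed
  \<comment> \<open>Columns \<open>j \<le> n\<close> of \<open>R\<close> vanish at \<open>n\<close>
    and at \<open>n + 1\<close>, so TR produces neither a pivot term nor a boundary term.\<close>
  have C: "(\<Sum>i<?k. s i * tri (\<lambda>p. R p j) i) = \<sigma> * (\<Sum>i<?k. s i * R i j)" if "j < ?k" for j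
    using row[of "\<lambda>p. R p j"] that by (simp add: R_def)
  have "(\<Sum>i<?k. \<Sum>j<?k. s i * s j * H i j) = (\<Sum>i<?k. \<Sum>j<?k. s j * (s i * tri (\<lambda>p. R p j) i))
      - (\<Sum>i<?k. \<Sum>j<?k. s i * (s j * tri (R i) j))"
    by (simp add: H_def algebra_simps sum_subtractf del: sum.lessThan_Suc)
  also have "(\<Sum>i<?k. \<Sum>j<?k. s j * (s i * tri (\<lambda>p. R p j) i))
      = (\<Sum>j<?k. s j * (\<Sum>i<?k. s i * tri (\<lambda>p. R p j) i))"
    unfolding sum_distrib_left by (rule sum.swap)
  also have "\<dots> = (\<Sum>j<?k. s j * (\<sigma> * (\<Sum>i<?k. s i * R i j)))"
    by (intro sum.cong refl) (subst C, auto)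
  also have "\<dots> = \<sigma> * (\<Sum>i<?k. \<Sum>j<?k. s i * s j * R i j)"
    unfolding sum_distrib_left by (subst sum.swap) (simp only: mult_ac)
  also have "(\<Sum>i<?k. \<Sum>j<?k. s i * (s j * tri (R i) j)) = (\<Sum>i<?k. s i * (\<sigma> * (\<Sum>j<?k. s j * R i j)))
      + (\<Sum>i<?k. s i * (p * R i n + b ?k * R i ?k))"
    unfolding sum_distrib_left[symmetric] sum.distrib[symmetric]
    by (intro sum.cong refl) (subst row, simp only: algebra_simps)
  also have "(\<Sum>i<?k. s i * (\<sigma> * (\<Sum>j<?k. s j * R i j))) = \<sigma> * (\<Sum>i<?k. \<Sum>j<?k. s i * s j * R i j)"
    unfolding sum_distrib_left by (simp only: mult_ac)
  finally show ?thesis using E by linarith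
qed

text \<open>N is the identity plus R plus the transpose of R, up to the asymmetry \<open>e\<close>
  below the diagonal.\<close>

lemma gram_lower_bound:
  assumes "k \<le> m"
  shows "(\<Sum>i<k. (s i)\<^sup>2) + 2 * (\<Sum>i<k. \<Sum>j<k. s i * s j * R i j) - \<eta> * (\<Sum>i<k. \<bar>s i\<bar>)\<^sup>2
    \<le> (\<Sum>i<k. \<Sum>j<k. s i * s j * N i j)"
proof -
  define e where "e = (\<lambda>i j. if j < i then N i j - N j i else 0)"
  have "\<bar>e i j\<bar> \<le> \<eta>" if "i < k" "j < k" for i j
    using N_asym[of i j] that assms \<eta>_nonneg by (auto simp: e_def)
  then have e: "\<bar>\<Sum>i<k. \<Sum>j<k. s i * s j * e i j\<bar> \<le> \<eta> * (\<Sum>i<k. \<bar>s i\<bar>)\<^sup>2"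
    by (rule abs_double_sum_le)
  have "s i * s j * N i j = s i * (s j * (if j = i then 1 else 0)) + s i * s j * R i j
      + s j * s i * R j i + s i * s j * e i j" if "i < k" for i j
    using N_diag[of i] that assms by (auto simp: R_def e_def algebra_simps)
  then have "(\<Sum>i<k. \<Sum>j<k. s i * s j * N i j) = (\<Sum>i<k. \<Sum>j<k. s i * (s j * (if j = i then 1 else 0))
      + s i * s j * R i j + s j * s i * R j i + s i * s j * e i j)"
    by (intro sum.cong refl) auto
  also have "\<dots> = (\<Sum>i<k. s i * (\<Sum>j<k. s j * (if j = i then 1 else 0)))
      + (\<Sum>i<k. \<Sum>j<k. s i * s j * R i j) + (\<Sum>i<k. \<Sum>j<k. s j * s i * R j i)
      + (\<Sum>i<k. \<Sum>j<k. s i * s j * e i j)"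
    by (simp only: sum.distrib sum_distrib_left)
  also have "(\<Sum>i<k. \<Sum>j<k. s j * s i * R j i) = (\<Sum>i<k. \<Sum>j<k. s i * s j * R i j)"
    by (rule sum.swap)
  also have "(\<Sum>i<k. s i * (\<Sum>j<k. s j * (if j = i then 1 else 0))) = (\<Sum>i<k. (s i)\<^sup>2)"
    by (intro sum.cong refl) (simp add: sum_delta_mult power2_eq_square)
  finally show ?thesis using e by linarith
qed

text \<open>Coercivity at the Schur vector is compared with its energy, giving (l - \<sigma>) s^T N
  s \<le> p up to errors. Since s^T N s \<ge> |s|^2/2 and \<sigma> \<le> 3l/4, the left side is at
  least l|s|^2/8, more than the errors l|s|^2/96 and l|s|^2/32 together; so the pivot is positive,
  and the bound extends by one row at level \<sigma>.\<close>

lemma tri_ge_step: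
  assumes n: "n < m" and ge: "tri_ge \<sigma>' n" and \<sigma>: "\<sigma> < \<sigma>'" "\<sigma> \<le> 3 * l / 4"
    and K: "\<And>i. i < m \<Longrightarrow> \<bar>al i\<bar> \<le> K" "\<And>i. i < m \<Longrightarrow> \<bar>b i\<bar> \<le> K"
    and gap: "(real m)\<^sup>2 * (3 * K * \<eta>) / (\<sigma>' - \<sigma>) \<le> 1 / 8"
    and h: "3 * K * \<eta> * m \<le> l / 32" and \<eta>: "\<eta> * m \<le> 1 / 96"
  shows "tri_ge \<sigma> (Suc n)"
proof -
  let ?k = "Suc n"
  obtain s where s: "s n = 1" "\<And>i. i > n \<Longrightarrow> s i = 0" "\<And>i. i < n \<Longrightarrow> tri s i = \<sigma> * s i"
    using schur_vector[OF tri_solve[OF ge \<sigma>(1)]] by blast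
  define p where "p = tri s n - \<sigma>"
  define S where "S = (\<Sum>i<?k. (s i)\<^sup>2)"
  define V where "V = (\<Sum>i<?k. \<bar>s i\<bar>)\<^sup>2"
  define \<nu> where "\<nu> = (\<Sum>i<?k. \<Sum>j<?k. s i * s j * N i j)"
  define X where "X = (\<Sum>i<?k. \<Sum>j<?k. s i * s j * R i j)"
  define Y where "Y = (\<Sum>i<?k. \<Sum>j<?k. s i * s j * H i j)"
  have S: "S > 0" unfolding S_def using s(1) by (simp add: add_nonneg_pos sum_nonneg)
  have K0: "K \<ge> 0" using K(1)[OF n] by linarith
  have "V \<le> ?k * S" unfolding V_def S_def by (rule sum_abs_squared_le)
  also have "\<dots> \<le> m * S" using n S by (intro mult_right_mono) auto
  finally have V: "V \<le> m * S" .
  have "\<bar>X\<bar> \<le> (real m)\<^sup>2 * (3 * K * \<eta>) / (\<sigma>' - \<sigma>) * S"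
    unfolding X_def S_def using n ge \<sigma>(1) s(3) K by (rule cross_term_bound)
  also have "\<dots> \<le> 1 / 8 * S" using gap S by (intro mult_right_mono) auto
  finally have X: "\<bar>X\<bar> \<le> 1 / 8 * S" .
  have "\<eta> * V \<le> \<eta> * m * S" using mult_left_mono[OF V \<eta>_nonneg] by (simp add: mult.assoc)
  also have "\<dots> \<le> 1 / 96 * S" using \<eta> S by (intro mult_right_mono) auto
  finally have \<eta>V: "\<eta> * V \<le> 1 / 96 * S" .
  have "\<bar>Y\<bar> \<le> 3 * K * \<eta> * V" unfolding Y_def V_def
    using H_bound[OF _ _ K] n by (intro abs_double_sum_le) auto
  also have "\<dots> \<le> 3 * K * \<eta> * m * S"
    using mult_left_mono[OF V, of "3 * K * \<eta>"] K0 \<eta>_nonneg by (simp add: mult.assoc)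
  also have "\<dots> \<le> l / 32 * S" using h S by (intro mult_right_mono) auto
  finally have Y: "\<bar>Y\<bar> \<le> l / 32 * S" .
  have \<nu>: "S / 2 \<le> \<nu>"
    using gram_lower_bound[of ?k s] n X \<eta>V unfolding S_def[symmetric] X_def[symmetric] \<nu>_def[symmetric]
      V_def[symmetric] by simp
  have "l * (\<nu> - \<eta> * V) \<le> \<sigma> * \<nu> + p - Y"
    using coercive[of ?k s] n schur_pivot_energy[where s = s and n = n and \<sigma> = \<sigma>, OF n s]
    by (simp add: \<nu>_def V_def Y_def p_def del: sum.lessThan_Suc)
  moreover have "\<sigma> * \<nu> \<le> 3 * l / 4 * \<nu>" using \<sigma>(2) \<nu> S by (intro mult_right_mono) auto
  moreover have "l * (\<eta> * V) \<le> l * (1 / 96 * S)" using \<eta>V l_pos by (intro mult_left_mono) auto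
  moreover have "l * (S / 2) \<le> l * \<nu>" using \<nu> l_pos by (intro mult_left_mono) auto
  moreover have "l * S > 0" using S l_pos by simp
  ultimately have p: "p > 0" using Y by (simp add: algebra_simps abs_le_iff)
  show ?thesis
    unfolding tri_ge_def
  proof (intro allI impI)
    fix x :: "nat \<Rightarrow> real" assume x: "\<forall>i\<ge>?k. x i = 0"
    \<comment> \<open>Completing the square: subtracting \<open>x n\<close> times the Schur vector
      leaves a vector supported on the old block, and the form of T - \<sigma> splits into that of
      \<open>y\<close> and \<open>p\<close> times the square of \<open>x n\<close>.\<close>
    define y where "y = (\<lambda>i. x i + (- x n) * s i)"
    have y0: "y i = 0" if "i \<ge> n" for i
      using that x s(1,2) by (cases "i = n") (auto simp: y_def)
    have tx: "tri x i = tri y i + x n * tri s i" for i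
      using tri_add_scale[of x "- x n" s i] by (simp add: y_def)
    have "(\<Sum>i<?k. x i * tri x i) = (\<Sum>i<?k. x i * tri y i) + x n * (\<Sum>i<?k. x i * tri s i)"
      by (simp add: tx distrib_left sum.distrib sum_distrib_left mult_ac)
    also have "(\<Sum>i<?k. x i * tri y i) = (\<Sum>i<?k. y i * tri x i)"
      using green[of x y ?k] x y0[of ?k] by simp
    also have "\<dots> = (\<Sum>i<n. y i * tri y i) + \<sigma> * (\<Sum>i<n. y i * (x n * s i))"
      using y0[of n] s(3) by (simp add: tx distrib_left sum.distrib sum_distrib_left mult_ac)
    also have "(\<Sum>i<?k. x i * tri s i) = \<sigma> * (\<Sum>i<?k. x i * s i) + p * x n"
      using s(1,3) by (simp add: p_def sum_distrib_left algebra_simps)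
    finally have e1: "(\<Sum>i<?k. x i * tri x i) = (\<Sum>i<n. y i * tri y i) + \<sigma> * (\<Sum>i<n. y i * (x n * s i))
        + x n * (\<sigma> * (\<Sum>i<?k. x i * s i) + p * x n)" .
    have "(x i)\<^sup>2 = (y i)\<^sup>2 + y i * (x n * s i) + x n * (x i * s i)" for i
      by (simp add: y_def power2_eq_square algebra_simps)
    then have "(\<Sum>i<?k. (x i)\<^sup>2) = (\<Sum>i<?k. (y i)\<^sup>2) + (\<Sum>i<?k. y i * (x n * s i)) + x n * (\<Sum>i<?k. x i * s i)"
      by (simp add: sum.distrib sum_distrib_left del: sum.lessThan_Suc)
    then have e2: "(\<Sum>i<?k. (x i)\<^sup>2) = (\<Sum>i<n. (y i)\<^sup>2) + (\<Sum>i<n. y i * (x n * s i)) + x n * (\<Sum>i<?k. x i * s i)"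
      using y0[of n] by simp
    have "\<sigma> * (\<Sum>i<n. (y i)\<^sup>2) \<le> (\<Sum>i<n. y i * tri y i)"
      using tri_geD[OF tri_ge_mono[OF ge], of \<sigma> y] \<sigma>(1) y0 by simp
    moreover have "0 \<le> p * x n * x n" using p by (simp add: mult.assoc)
    ultimately show "\<sigma> * (\<Sum>i<?k. (x i)\<^sup>2) \<le> (\<Sum>i<?k. x i * tri x i)"
      unfolding e1 e2 by (simp add: algebra_simps del: sum.lessThan_Suc)
  qed
qed

text \<open>Each added row lowers the level by l/(4m), from 3l/4 for the empty block to l/2 after
  \<open>m\<close> rows. With this gap the condition on the cross term becomes exactly 96 m^3 K
  \<eta> \<le> l, and it implies the other two smallness conditions.\<close>

lemma tri_ge_half:
  assumes K: "\<And>i. i < m \<Longrightarrow> \<bar>al i\<bar> \<le> K" "\<And>i. i < m \<Longrightarrow> \<bar>b i\<bar> \<le> K" "l \<le> K"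
    and small: "96 * real m ^ 3 * K * \<eta> \<le> l"
  shows "tri_ge (l / 2) m"
proof -
  have "tri_ge (l * (3/4 - real k / (4 * real m))) k" if "k \<le> m" for k
    using that
  proof (induction k)
    case 0
    show ?case by (simp add: tri_ge_def)
  next
    case (Suc k)
    have m: "real m \<ge> 1" using Suc.prems by simp
    have Kp: "K > 0" using l_pos K(3) by linarith
    have m3: "real m \<le> real m ^ 3" using power_increasing[of 1 3 "real m"] m by simp
    have "96 * K * \<eta> * real m \<le> 96 * K * \<eta> * real m ^ 3"
      using m3 Kp \<eta>_nonneg by (intro mult_left_mono) auto
    also have "\<dots> \<le> l" using small by (simp add: mult_ac)
    finally have h: "96 * K * \<eta> * real m \<le> l" .
    then have "96 * K * \<eta> * real m \<le> K" using K(3) by linarith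
    then have e: "\<eta> * real m \<le> 1 / 96" using Kp by (simp add: field_simps)
    have d: "l * (3/4 - real k / (4 * real m)) - l * (3/4 - real (Suc k) / (4 * real m)) = l / (4 * real m)"
      using m by (simp add: field_simps)
    show ?case
    proof (rule tri_ge_step[OF _ Suc.IH _ _ K(1,2)])
      show "l * (3/4 - real (Suc k) / (4 * real m)) < l * (3/4 - real k / (4 * real m))"
        using d l_pos m by (smt (verit) divide_pos_pos)
      show "l * (3/4 - real (Suc k) / (4 * real m)) \<le> 3 * l / 4"
        using l_pos m by (simp add: algebra_simps)
      show "(real m)\<^sup>2 * (3 * K * \<eta>) /
        (l * (3/4 - real k / (4 * real m)) - l * (3/4 - real (Suc k) / (4 * real m))) \<le> 1/8"
        unfolding d using small l_pos m by (simp add: field_simps power2_eq_square power3_eq_cube)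
      show "3 * K * \<eta> * real m \<le> l / 32" using h by linarith
    qed (use Suc.prems e in auto)
  qed
  from this[of m] show ?thesis by (cases "m = 0") (auto simp: tri_ge_def)
qed

text \<open>Comparing the two expressions for the entry \<open>(i, i + 1)\<close> of the form shows that
  \<open>b i * b (i + 1) * N (i - 1) (i + 1)\<close> grows by at most \<open>O(\<eta>)\<close> in each step, so that
  \<open>b i\<close> is essentially that entry.\<close>

lemma coefficient_bounds:
  assumes b_nonneg: "\<And>i. i < m \<Longrightarrow> 0 \<le> b i"
    and diag: "\<And>i. i < m \<Longrightarrow> \<bar>tri (N i) i\<bar> \<le> D0"
    and off: "\<And>i. Suc i < m \<Longrightarrow> \<bar>tri (N i) (Suc i)\<bar> \<le> D"
    and B: "0 \<le> B" "D + m * (\<eta> * (B + K)) \<le> B" and K: "D0 + \<eta> * B \<le> K"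
    and i: "i < m"
  shows "b i \<le> B" "\<bar>al i\<bar> \<le> K"
proof -
  define F where "F = (\<lambda>i. b i * b (Suc i) * N (i - 1) (Suc i))"
  have al: "\<bar>al i\<bar> \<le> K" if i: "i < m" and bi: "b i \<le> B" for i
  proof -
    have "\<bar>b i * N i (i-1)\<bar> \<le> B * \<eta>"
    proof (cases i)
      case (Suc k)
      then show ?thesis unfolding abs_mult
        using N_asym[of i k] N_super[of k] i b_nonneg[OF i] bi by (intro mult_mono) auto
    qed (use B \<eta>_nonneg in simp)
    moreover have "al i = tri (N i) i - b i * N i (i-1)"
      using N_diag[OF i] N_super[OF i] by (simp add: tri_def)
    ultimately show ?thesis using diag[OF i] K by (simp add: mult.commute)
  qed
  have "b i \<le> B \<and> \<bar>F i\<bar> \<le> i * (\<eta> * B * (B + K))" if "i < m" for i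
    using that
  proof (induction i)
    case 0
    then show ?case using B by (simp add: F_def)
  next
    case (Suc i)
    let ?j = "Suc i"
    have IH: "b i \<le> B" "\<bar>F i\<bar> \<le> i * (\<eta> * B * (B + K))" and i: "i < m" "?j < m" using Suc by auto
    have ali: "\<bar>al i\<bar> \<le> K" using al i IH by blast
    have b: "0 \<le> b i" "0 \<le> b ?j" using b_nonneg i by auto
    have K0: "K \<ge> 0" using ali by linarith
    have a: "tri (N i) ?j = b ?j + b (Suc ?j) * N i (Suc ?j)"
      using N_diag[OF i(1)] N_super[OF i(1)] by (simp add: tri_def)
    have "tri (N ?j) i = b i * N ?j (i-1) + al i * N ?j i + b ?j"
      using N_diag[OF i(2)] by (simp add: tri_def)
    then have "b (Suc ?j) * N i (Suc ?j) = b i * N ?j (i-1) + al i * N ?j i"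
      using a form_sym[OF i] by simp
    then have "F ?j = b ?j * (b i * N ?j (i-1) + al i * N ?j i)"
      unfolding F_def by (metis diff_Suc_1 mult.assoc)
    also have "\<dots> = F i + b ?j * (b i * (N ?j (i-1) - N (i-1) ?j) + al i * N ?j i)"
      by (simp add: F_def algebra_simps)
    finally have F: "F ?j = F i + b ?j * (b i * (N ?j (i-1) - N (i-1) ?j) + al i * N ?j i)" .
    have "\<bar>b i * (N ?j (i-1) - N (i-1) ?j)\<bar> \<le> B * \<eta>"
      unfolding abs_mult using b IH(1) N_asym[of ?j "i-1"] i by (intro mult_mono) auto
    moreover have "\<bar>al i * N ?j i\<bar> \<le> K * \<eta>"
      unfolding abs_mult using ali N_asym[of ?j i] N_super[of i] i K0 by (intro mult_mono) auto
    ultimately have "\<bar>b i * (N ?j (i-1) - N (i-1) ?j) + al i * N ?j i\<bar> \<le> \<eta> * (B + K)"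
      by (simp add: algebra_simps)
    then have "\<bar>b ?j * (b i * (N ?j (i-1) - N (i-1) ?j) + al i * N ?j i)\<bar> \<le> b ?j * (\<eta> * (B + K))"
      unfolding abs_mult using b by (intro mult_mono) auto
    then have Fle: "\<bar>F ?j\<bar> \<le> \<bar>F i\<bar> + b ?j * (\<eta> * (B + K))" unfolding F by linarith
    \<comment> \<open>Entry (i, j) of the form is b_j plus a far term; multiplied by b_j the far
      term is \<open>F ?j\<close>, so the square of b_j is controlled by the form entry and the
      accumulated \<open>F\<close>.\<close>
    have sq: "b ?j * b ?j = b ?j * tri (N i) ?j - F ?j"
      unfolding a F_def by (simp add: algebra_simps)
    have "b ?j * tri (N i) ?j \<le> b ?j * D" using off[OF i(2)] b by (intro mult_left_mono) auto
    then have le: "b ?j * b ?j \<le> b ?j * D + i * (\<eta> * B * (B + K)) + b ?j * (\<eta> * (B + K))"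
      using sq Fle IH(2) by linarith
    have e0: "0 \<le> \<eta> * (B + K)" using \<eta>_nonneg B K0 by simp
    have bB: "b ?j \<le> B"
    proof (rule ccontr)
      assume "\<not> b ?j \<le> B"
      then have gt: "B < b ?j" by simp
      \<comment> \<open>The bound on \<open>F i\<close> carries a factor \<open>B\<close>. If b_j
        exceeded \<open>B\<close>, that factor could be raised to b_j and the whole inequality
        divided by b_j.\<close>
      have "i * (\<eta> * (B + K)) * B \<le> i * (\<eta> * (B + K)) * b ?j"
        using gt e0 by (intro mult_left_mono) auto
      with le have "b ?j * b ?j \<le> b ?j * (D + ?j * (\<eta> * (B + K)))" by (simp add: algebra_simps)
      then have "b ?j \<le> D + ?j * (\<eta> * (B + K))" using gt B(1) by (simp add: mult_le_cancel_left)
      also have "\<dots> \<le> D + m * (\<eta> * (B + K))" using i e0 by (intro add_left_mono mult_right_mono) auto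
      also have "\<dots> \<le> B" by (rule B(2))
      finally show False using gt by simp
    qed
    have "b ?j * (\<eta> * (B + K)) \<le> B * (\<eta> * (B + K))" using bB e0 by (rule mult_right_mono)
    with Fle IH(2) have "\<bar>F ?j\<bar> \<le> ?j * (\<eta> * B * (B + K))" by (simp add: algebra_simps)
    with bB show ?case by simp
  qed
  with i show "b i \<le> B" by blast
  with al i show "\<bar>al i\<bar> \<le> K" by blast
qed

end

section \<open>Symmetric matrices and square roots\<close>

lemma sym_scalar_prod:
  fixes B :: "real mat"
  assumes "B \<in> carrier_mat n n" "transpose_mat B = B" "x \<in> carrier_vec n" "y \<in> carrier_vec n"
  shows "x \<bullet> (B *\<^sub>v y) = y \<bullet> (B *\<^sub>v x)"
  using transpose_vec_mult_scalar[OF assms(1,4,3)] assms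
    comm_scalar_prod[of "B *\<^sub>v x" n y] by simp

lemma form_expand:
  fixes B :: "real mat"
  assumes "B \<in> carrier_mat n n" "transpose_mat B = B" "x \<in> carrier_vec n" "y \<in> carrier_vec n"
  shows "(x + t \<cdot>\<^sub>v y) \<bullet> (B *\<^sub>v (x + t \<cdot>\<^sub>v y)) = x \<bullet> (B *\<^sub>v x) + 2 * t * (x \<bullet> (B *\<^sub>v y)) + t\<^sup>2 * (y \<bullet> (B *\<^sub>v y))"
proof -
  have B: "B *\<^sub>v x \<in> carrier_vec n" "B *\<^sub>v y \<in> carrier_vec n" using assms by auto
  have "B *\<^sub>v (x + t \<cdot>\<^sub>v y) = B *\<^sub>v x + t \<cdot>\<^sub>v (B *\<^sub>v y)"
    using assms by (simp add: mult_add_distrib_mat_vec[of _ n n] mult_mat_vec[of _ n n])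
  then have "(x + t \<cdot>\<^sub>v y) \<bullet> (B *\<^sub>v (x + t \<cdot>\<^sub>v y))
      = x \<bullet> (B *\<^sub>v x) + t * (x \<bullet> (B *\<^sub>v y)) + t * (y \<bullet> (B *\<^sub>v x)) + t * (t * (y \<bullet> (B *\<^sub>v y)))"
    using assms B
    by (simp add: add_scalar_prod_distrib[of _ n] scalar_prod_add_distrib[of _ n]
        smult_scalar_prod_distrib[of _ n] scalar_prod_smult_distrib[of _ n] algebra_simps)
  then show ?thesis using sym_scalar_prod[OF assms] by (simp add: power2_eq_square algebra_simps)
qed

text \<open>Formulated for polynomials because it serves both a semidefinite matrix and the
  difference A - lM of two forms. Either may be degenerate, hence the case of a vanishing leading
  coefficient.\<close>

lemma quadratic_nonneg_discriminant:
  fixes a b c :: real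
  assumes "\<And>t. 0 \<le> a + 2 * t * b + t\<^sup>2 * c"
  shows "b\<^sup>2 \<le> a * c"
proof (cases "c = 0")
  case True
  have "b = 0"
  proof (rule ccontr)
    assume "b \<noteq> 0"
    then show False using assms[of "- (a + 1) / (2 * b)"] True by (simp add: field_simps)
  qed
  with True show ?thesis by simp
next
  case False
  have "c > 0"
  proof (rule ccontr)
    assume "\<not> c > 0"
    with False have c: "c < 0" by simp
    \<comment> \<open>So large that t^2 c, for negative \<open>c\<close>, outweighs both lower
      terms; the summand 1 ensures t \<ge> 1.\<close>
    define t where "t = (\<bar>a\<bar> + 2 * \<bar>b\<bar> + 1) / \<bar>c\<bar> + 1"
    have t1: "t \<ge> 1" unfolding t_def by simp
    have tc: "t * c = - (\<bar>a\<bar> + 2 * \<bar>b\<bar> + 1) + c" using c by (simp add: t_def field_simps)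
    have "t\<^sup>2 * c = t * (t * c)" by (simp add: power2_eq_square)
    also have "\<dots> \<le> t * - (\<bar>a\<bar> + 2 * \<bar>b\<bar> + 1)" using tc c t1 by (intro mult_left_mono) auto
    finally have "t\<^sup>2 * c \<le> - t * \<bar>a\<bar> - 2 * t * \<bar>b\<bar> - t" by (simp add: algebra_simps)
    moreover have "\<bar>a\<bar> \<le> t * \<bar>a\<bar>" using t1 by (simp add: mult_le_cancel_right1)
    moreover have "t * b \<le> t * \<bar>b\<bar>" using t1 by (intro mult_left_mono) auto
    moreover have "a \<le> \<bar>a\<bar>" by simp
    ultimately show False using assms[of t] t1 by (simp add: mult.assoc)
  qed
  have "0 \<le> a + 2 * (- b / c) * b + (- b / c)\<^sup>2 * c" by (rule assms)
  also have "\<dots> = a - b\<^sup>2 / c" using False by (simp add: power2_eq_square field_simps)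
  finally show ?thesis using \<open>c > 0\<close> by (simp add: field_simps)
qed

lemma form_cauchy_schwarz:
  fixes B :: "real mat"
  assumes B: "B \<in> carrier_mat n n" "transpose_mat B = B"
    and psd: "\<And>x. x \<in> carrier_vec n \<Longrightarrow> 0 \<le> x \<bullet> (B *\<^sub>v x)"
    and "x \<in> carrier_vec n" "y \<in> carrier_vec n"
  shows "(x \<bullet> (B *\<^sub>v y))\<^sup>2 \<le> (x \<bullet> (B *\<^sub>v x)) * (y \<bullet> (B *\<^sub>v y))"
proof (rule quadratic_nonneg_discriminant)
  fix t show "0 \<le> x \<bullet> (B *\<^sub>v x) + 2 * t * (x \<bullet> (B *\<^sub>v y)) + t\<^sup>2 * (y \<bullet> (B *\<^sub>v y))"
    using form_expand[OF B assms(4,5), of t] psd[of "x + t \<cdot>\<^sub>v y"] assms(4,5) by simp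
qed

lemma scalar_prod_self_pos:
  fixes x :: "real vec"
  assumes "x \<in> carrier_vec n" "x \<noteq> 0\<^sub>v n"
  shows "x \<bullet> x > 0"
proof -
  obtain i where i: "i < n" "x $ i \<noteq> 0" using assms by (metis carrier_vecD eq_vecI index_zero_vec)
  have "0 < (x $ i)\<^sup>2" using i by simp
  also have "\<dots> \<le> (\<Sum>j\<in>{0..<n}. (x $ j)\<^sup>2)" using i by (intro member_le_sum) auto
  finally show ?thesis using assms by (simp add: scalar_prod_def power2_eq_square)
qed

lemma scalar_prod_self_nonneg: "0 \<le> x \<bullet> (x :: real vec)"
  by (simp add: scalar_prod_def sum_nonneg)

lemma mult_mat_zero_vec: "(B :: real mat) \<in> carrier_mat n n \<Longrightarrow> B *\<^sub>v 0\<^sub>v n = 0\<^sub>v n"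
  by (intro eq_vecI) auto

text \<open>\<open>minv\<close> falls back to the zero matrix, so its inverse property has to be
  earned from a trivial kernel, by way of the determinant.\<close>

lemma minv_inverse:
  assumes B: "B \<in> carrier_mat n n" and inj: "\<And>x. x \<in> carrier_vec n \<Longrightarrow> B *\<^sub>v x = 0\<^sub>v n \<Longrightarrow> x = 0\<^sub>v n"
  shows "minv B \<in> carrier_mat n n" "B * minv B = 1\<^sub>m n" "minv B * B = 1\<^sub>m n"
proof -
  have "det B \<noteq> 0" using det_0_iff_vec_prod_zero[OF B] inj by blast
  then have "B \<in> Units (ring_mat TYPE(real) n undefined)" using B by (rule det_non_zero_imp_unit[rotated])
  then obtain C where C: "mat_inverse B = Some C" using mat_inverse(1)[OF B, of undefined] by blast
  then have "minv B = C" by (simp add: minv_def)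
  with mat_inverse(2)[OF B C] show "minv B \<in> carrier_mat n n" "B * minv B = 1\<^sub>m n" "minv B * B = 1\<^sub>m n"
    by auto
qed

lemma spd_injective:
  assumes "spd n B" "x \<in> carrier_vec n" "B *\<^sub>v x = 0\<^sub>v n"
  shows "x = 0\<^sub>v n"
  using assms by (metis less_irrefl scalar_prod_right_zero spd_def)

lemma spdD:
  assumes "spd n B"
  shows "B \<in> carrier_mat n n" "transpose_mat B = B"
    "\<And>x. x \<in> carrier_vec n \<Longrightarrow> x \<noteq> 0\<^sub>v n \<Longrightarrow> 0 < x \<bullet> (B *\<^sub>v x)"
    "\<And>x. x \<in> carrier_vec n \<Longrightarrow> 0 \<le> x \<bullet> (B *\<^sub>v x)"
    "minv B \<in> carrier_mat n n" "B * minv B = 1\<^sub>m n" "minv B * B = 1\<^sub>m n"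
proof -
  show B: "B \<in> carrier_mat n n" "transpose_mat B = B"
    and pos: "\<And>x. x \<in> carrier_vec n \<Longrightarrow> x \<noteq> 0\<^sub>v n \<Longrightarrow> 0 < x \<bullet> (B *\<^sub>v x)"
    using assms by (auto simp: spd_def)
  show "0 \<le> x \<bullet> (B *\<^sub>v x)" if "x \<in> carrier_vec n" for x
    using pos[OF that] that B by (cases "x = 0\<^sub>v n") auto
  show "minv B \<in> carrier_mat n n" "B * minv B = 1\<^sub>m n" "minv B * B = 1\<^sub>m n"
    using minv_inverse[OF B(1)] spd_injective[OF assms] by blast+
qed

lemma spd_minv:
  assumes M: "spd n M"
  shows "spd n (minv M)"
proof -
  note D = spdD[OF M]
  let ?P = "minv M"
  \<comment> \<open>Transposing the identity for the right inverse makes the transposed inverse a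
    left inverse of M, and left and right inverses agree.\<close>
  have tr: "transpose_mat ?P * M = 1\<^sub>m n"
    using transpose_mult[OF D(1) D(5)] D(2,6) by simp
  have "transpose_mat ?P = transpose_mat ?P * (M * ?P)" using D(5,6) by simp
  also have "\<dots> = (transpose_mat ?P * M) * ?P"
    using D(1,5) by (intro assoc_mult_mat[symmetric]) auto
  also have "\<dots> = ?P" using D(5) by (simp add: tr)
  finally have sym: "transpose_mat ?P = ?P" .
  have "0 < x \<bullet> (?P *\<^sub>v x)" if x: "x \<in> carrier_vec n" "x \<noteq> 0\<^sub>v n" for x
  proof -
    let ?p = "?P *\<^sub>v x"
    have p: "?p \<in> carrier_vec n" using D(5) x by auto
    have Mp: "M *\<^sub>v ?p = x" using assoc_mult_mat_vec[OF D(1,5) x(1)] D(6) x by simp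
    then have "?p \<noteq> 0\<^sub>v n" using x mult_mat_zero_vec[OF D(1)] by auto
    then have "0 < ?p \<bullet> (M *\<^sub>v ?p)" using D(3) p by blast
    then show ?thesis using Mp comm_scalar_prod[OF p x(1)] by simp
  qed
  then show ?thesis using sym D(5) by (auto simp: spd_def)
qed

lemma form_bounded:
  fixes B :: "real mat"
  assumes B: "B \<in> carrier_mat n n"
  obtains K where "K > 0" "\<And>x. x \<in> carrier_vec n \<Longrightarrow> \<bar>x \<bullet> (B *\<^sub>v x)\<bar> \<le> K * (x \<bullet> x)"
proof -
  define K where "K = (\<Sum>i\<in>{0..<n}. \<Sum>j\<in>{0..<n}. \<bar>B $$ (i, j)\<bar>)"
  have "\<bar>x \<bullet> (B *\<^sub>v x)\<bar> \<le> (K + 1) * (x \<bullet> x)" if x: "x \<in> carrier_vec n" for x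
  proof -
    have xx: "\<bar>x $ i\<bar> * \<bar>x $ j\<bar> \<le> x \<bullet> x" if "i < n" "j < n" for i j
    proof -
      have le: "(x $ i)\<^sup>2 \<le> x \<bullet> x" if "i < n" for i
      proof -
        have "(x $ i)\<^sup>2 \<le> (\<Sum>j\<in>{0..<n}. (x $ j)\<^sup>2)" using that by (intro member_le_sum) auto
        then show ?thesis using x by (simp add: scalar_prod_def power2_eq_square)
      qed
      have "2 * (\<bar>x $ i\<bar> * \<bar>x $ j\<bar>) \<le> (x $ i)\<^sup>2 + (x $ j)\<^sup>2"
        using sum_squares_bound[of "\<bar>x $ i\<bar>" "\<bar>x $ j\<bar>"] by simp
      with le[of i] le[of j] that show ?thesis by linarith
    qed
    have "x \<bullet> (B *\<^sub>v x) = (\<Sum>i\<in>{0..<n}. \<Sum>j\<in>{0..<n}. B $$ (i, j) * (x $ i * x $ j))"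
      using B x by (simp add: scalar_prod_def sum_distrib_left mult_ac)
    also have "\<bar>\<dots>\<bar> \<le> (\<Sum>i\<in>{0..<n}. \<Sum>j\<in>{0..<n}. \<bar>B $$ (i, j) * (x $ i * x $ j)\<bar>)"
      by (intro order_trans[OF sum_abs] sum_mono sum_abs)
    also have "\<dots> \<le> (\<Sum>i\<in>{0..<n}. \<Sum>j\<in>{0..<n}. \<bar>B $$ (i, j)\<bar> * (x \<bullet> x))"
      using xx by (intro sum_mono) (auto simp: abs_mult intro!: mult_left_mono)
    also have "\<dots> = K * (x \<bullet> x)" by (simp add: K_def sum_distrib_right)
    also have "\<dots> \<le> (K + 1) * (x \<bullet> x)"
      using scalar_prod_self_nonneg[of x] by (intro mult_right_mono) auto
    finally show ?thesis .
  qed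
  moreover have "K + 1 > 0" by (simp add: K_def add_nonneg_pos sum_nonneg)
  ultimately show ?thesis using that by blast
qed

text \<open>The infimum of the Rayleigh quotient is attained: otherwise \<open>B - \<mu>\<close> would be invertible, and
  a positive semidefinite matrix with a bounded inverse is bounded below by a positive constant.\<close>

lemma rayleigh_min_eigenvector:
  fixes B :: "real mat"
  assumes n: "n \<ge> 1" and B: "B \<in> carrier_mat n n" "transpose_mat B = B"
  obtains \<mu> v where "v \<in> carrier_vec n" "v \<noteq> 0\<^sub>v n" "B *\<^sub>v v = \<mu> \<cdot>\<^sub>v v"
    "\<And>x. x \<in> carrier_vec n \<Longrightarrow> \<mu> * (x \<bullet> x) \<le> x \<bullet> (B *\<^sub>v x)"
proof -
  obtain K where K: "K > 0" "\<And>x. x \<in> carrier_vec n \<Longrightarrow> \<bar>x \<bullet> (B *\<^sub>v x)\<bar> \<le> K * (x \<bullet> x)"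
    by (rule form_bounded[OF B(1)]) (rule that)
  define S where "S = {\<mu>. \<forall>x\<in>carrier_vec n. \<mu> * (x \<bullet> x) \<le> x \<bullet> (B *\<^sub>v x)}"
  define \<mu> where "\<mu> = Sup S"
  have "- K \<in> S" using K(2) by (force simp: S_def)
  then have ne: "S \<noteq> {}" by blast
  define e where "e = (unit_vec n 0 :: real vec)"
  have e: "e \<in> carrier_vec n" "e \<bullet> e = 1" using n by (auto simp: e_def)
  have "\<nu> \<le> e \<bullet> (B *\<^sub>v e)" if "\<nu> \<in> S" for \<nu> using that e by (auto simp: S_def)
  then have bdd: "bdd_above S" by (auto simp: bdd_above_def)
  have S: "\<mu> * (x \<bullet> x) \<le> x \<bullet> (B *\<^sub>v x)" if x: "x \<in> carrier_vec n" for x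
  proof (cases "x = 0\<^sub>v n")
    case False
    then have p: "x \<bullet> x > 0" using x scalar_prod_self_pos by blast
    have "\<mu> \<le> x \<bullet> (B *\<^sub>v x) / (x \<bullet> x)" unfolding \<mu>_def
      using ne p x by (intro cSup_least) (auto simp: S_def field_simps)
    then show ?thesis using p by (simp add: field_simps)
  qed (use B in simp)
  define C where "C = B - \<mu> \<cdot>\<^sub>m 1\<^sub>m n"
  have C: "C \<in> carrier_mat n n"
    unfolding C_def by (intro minus_carrier_mat smult_carrier_mat one_carrier_mat)
  have Csym: "transpose_mat C = C"
  proof (rule eq_matI)
    fix i j assume ij: "i < dim_row C" "j < dim_col C"
    have "B $$ (j, i) = B $$ (i, j)" using B ij C by (metis carrier_matD index_transpose_mat(1))
    then show "transpose_mat C $$ (i, j) = C $$ (i, j)" using ij C B by (simp add: C_def)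
  qed (use C in auto)
  have Cx: "C *\<^sub>v x = B *\<^sub>v x - \<mu> \<cdot>\<^sub>v x" if "x \<in> carrier_vec n" for x
  proof -
    have "(\<mu> \<cdot>\<^sub>m 1\<^sub>m n) *\<^sub>v x = \<mu> \<cdot>\<^sub>v x"
    proof (rule eq_vecI)
      fix i assume "i < dim_vec (\<mu> \<cdot>\<^sub>v x)"
      then have i: "i < n" using that by simp
      have "((\<mu> \<cdot>\<^sub>m 1\<^sub>m n) *\<^sub>v x) $ i = (\<Sum>j\<in>{0..<n}. \<mu> * (if j = i then 1 else 0) * x $ j)"
        using that i by (simp add: scalar_prod_def)
      also have "\<dots> = (\<Sum>j\<in>{0..<n}. if j = i then \<mu> * x $ j else 0)"
        by (intro sum.cong) auto
      finally show "((\<mu> \<cdot>\<^sub>m 1\<^sub>m n) *\<^sub>v x) $ i = (\<mu> \<cdot>\<^sub>v x) $ i" using that i by simp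
    qed (use that in simp)
    then show ?thesis using that B unfolding C_def by (simp add: minus_mult_distrib_mat_vec[of _ n n])
  qed
  have Cf: "x \<bullet> (C *\<^sub>v x) = x \<bullet> (B *\<^sub>v x) - \<mu> * (x \<bullet> x)" if "x \<in> carrier_vec n" for x
    using that B by (simp add: Cx scalar_prod_minus_distrib[of _ n])
  have psd: "0 \<le> x \<bullet> (C *\<^sub>v x)" if "x \<in> carrier_vec n" for x using S[OF that] Cf[OF that] by simp
  have "\<exists>v\<in>carrier_vec n. v \<noteq> 0\<^sub>v n \<and> C *\<^sub>v v = 0\<^sub>v n"
  proof (rule ccontr)
    assume "\<not> ?thesis"
    then have inj: "\<And>x. x \<in> carrier_vec n \<Longrightarrow> C *\<^sub>v x = 0\<^sub>v n \<Longrightarrow> x = 0\<^sub>v n" by blast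
    define V where "V = minv C"
    have V: "V \<in> carrier_mat n n" "C * V = 1\<^sub>m n" using minv_inverse[OF C inj] by (auto simp: V_def)
    obtain H where H: "H > 0" "\<And>x. x \<in> carrier_vec n \<Longrightarrow> \<bar>x \<bullet> (V *\<^sub>v x)\<bar> \<le> H * (x \<bullet> x)"
      by (rule form_bounded[OF V(1)]) (rule that)
    \<comment> \<open>Cauchy-Schwarz for \<open>C\<close> between \<open>x\<close> and its preimage
      under \<open>C\<close> bounds |x|^4 by x^T C x times x^T V x, and the last factor is at most
      H|x|^2. So C \<ge> 1/H, against the choice of \<mu> as a supremum.\<close>
    have "(\<mu> + 1 / H) * (x \<bullet> x) \<le> x \<bullet> (B *\<^sub>v x)" if x: "x \<in> carrier_vec n" for x
    proof (cases "x = 0\<^sub>v n")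
      case False
      then have p: "x \<bullet> x > 0" using x scalar_prod_self_pos by blast
      let ?y = "V *\<^sub>v x"
      have y: "?y \<in> carrier_vec n" using V x by auto
      have Cy: "C *\<^sub>v ?y = x" using assoc_mult_mat_vec[OF C V(1) x] V(2) x by simp
      have "(x \<bullet> x)\<^sup>2 \<le> (x \<bullet> (C *\<^sub>v x)) * (?y \<bullet> x)"
        using form_cauchy_schwarz[OF C Csym psd x y] Cy by simp
      also have "?y \<bullet> x = x \<bullet> ?y" using comm_scalar_prod x y by blast
      also have "(x \<bullet> (C *\<^sub>v x)) * (x \<bullet> ?y) \<le> (x \<bullet> (C *\<^sub>v x)) * (H * (x \<bullet> x))"
        using H(2)[OF x] psd[OF x] by (intro mult_left_mono) auto
      finally have "x \<bullet> x \<le> (x \<bullet> (C *\<^sub>v x)) * H"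
        using p by (simp add: power2_eq_square mult.assoc[symmetric])
      then show ?thesis using Cf[OF x] H(1) by (simp add: field_simps)
    qed (use B in simp)
    then have "\<mu> + 1 / H \<in> S" by (simp add: S_def)
    then have "\<mu> + 1 / H \<le> \<mu>" unfolding \<mu>_def using bdd by (rule cSup_upper)
    then show False using H(1) by simp
  qed
  then obtain v where v: "v \<in> carrier_vec n" "v \<noteq> 0\<^sub>v n" "C *\<^sub>v v = 0\<^sub>v n" by blast
  have "B *\<^sub>v v = \<mu> \<cdot>\<^sub>v v"
  proof (rule eq_vecI)
    fix i assume i: "i < dim_vec (\<mu> \<cdot>\<^sub>v v)"
    have "(B *\<^sub>v v - \<mu> \<cdot>\<^sub>v v) $ i = 0" using v i Cx[OF v(1)] by simp
    then show "(B *\<^sub>v v) $ i = (\<mu> \<cdot>\<^sub>v v) $ i" using i v B by simp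
  qed (use v B in auto)
  with v S show ?thesis using that by blast
qed

lemma rayleigh_max_eigenvector:
  fixes B :: "real mat"
  assumes n: "n \<ge> 1" and B: "B \<in> carrier_mat n n" "transpose_mat B = B"
  obtains \<mu> v where "v \<in> carrier_vec n" "v \<noteq> 0\<^sub>v n" "B *\<^sub>v v = \<mu> \<cdot>\<^sub>v v"
    "\<And>x. x \<in> carrier_vec n \<Longrightarrow> x \<bullet> (B *\<^sub>v x) \<le> \<mu> * (x \<bullet> x)"
proof -
  have "- B \<in> carrier_mat n n" "transpose_mat (- B) = - B" using B by (auto simp: transpose_uminus)
  then obtain \<mu> v where v: "v \<in> carrier_vec n" "v \<noteq> 0\<^sub>v n"
    "- B *\<^sub>v v = \<mu> \<cdot>\<^sub>v v" "\<And>x. x \<in> carrier_vec n \<Longrightarrow> \<mu> * (x \<bullet> x) \<le> x \<bullet> (- B *\<^sub>v x)"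
    by (rule rayleigh_min_eigenvector[OF n]) (rule that)
  have neg: "- B *\<^sub>v x = - (B *\<^sub>v x)" if "x \<in> carrier_vec n" for x using that B by simp
  have "B *\<^sub>v v = (- \<mu>) \<cdot>\<^sub>v v"
  proof (rule eq_vecI)
    fix i assume i: "i < dim_vec ((- \<mu>) \<cdot>\<^sub>v v)"
    have "(- (B *\<^sub>v v)) $ i = (\<mu> \<cdot>\<^sub>v v) $ i" using v(3) neg[OF v(1)] by simp
    then show "(B *\<^sub>v v) $ i = ((- \<mu>) \<cdot>\<^sub>v v) $ i" using i v(1) B(1) by simp
  qed (use v(1) B(1) in auto)
  moreover have "x \<bullet> (B *\<^sub>v x) \<le> (- \<mu>) * (x \<bullet> x)" if "x \<in> carrier_vec n" for x
    using v(4)[OF that] neg[OF that] that B by simp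
  ultimately show ?thesis using that v by blast
qed

text \<open>Every eigenvalue is a Rayleigh quotient, so it lies between the extreme values of the
  quotient, which are eigenvalues themselves. This identifies the \<open>Min\<close> and
  \<open>Max\<close> over the finite spectrum that occur in \<open>cond_number\<close>.\<close>

lemma spectrum_bounds:
  fixes B :: "real mat"
  assumes n: "n \<ge> 1" and B: "B \<in> carrier_mat n n" "transpose_mat B = B"
  shows "Min (spectrum B) \<in> spectrum B" "Max (spectrum B) \<in> spectrum B"
    "\<And>x. x \<in> carrier_vec n \<Longrightarrow> Min (spectrum B) * (x \<bullet> x) \<le> x \<bullet> (B *\<^sub>v x)"
    "\<And>x. x \<in> carrier_vec n \<Longrightarrow> x \<bullet> (B *\<^sub>v x) \<le> Max (spectrum B) * (x \<bullet> x)"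
proof -
  obtain l v where v: "v \<in> carrier_vec n" "v \<noteq> 0\<^sub>v n" "B *\<^sub>v v = l \<cdot>\<^sub>v v"
    "\<And>x. x \<in> carrier_vec n \<Longrightarrow> l * (x \<bullet> x) \<le> x \<bullet> (B *\<^sub>v x)"
    by (rule rayleigh_min_eigenvector[OF n B]) (rule that)
  obtain h w where w: "w \<in> carrier_vec n" "w \<noteq> 0\<^sub>v n" "B *\<^sub>v w = h \<cdot>\<^sub>v w"
    "\<And>x. x \<in> carrier_vec n \<Longrightarrow> x \<bullet> (B *\<^sub>v x) \<le> h * (x \<bullet> x)"
    by (rule rayleigh_max_eigenvector[OF n B]) (rule that)
  have fin: "finite (spectrum B)" using card_finite_spectrum[OF B(1)] by blast
  have l: "l \<in> spectrum B" and h: "h \<in> spectrum B"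
    using v w B unfolding spectrum_def eigenvalue_def eigenvector_def by auto
  have "l \<le> k \<and> k \<le> h" if k: "k \<in> spectrum B" for k
  proof -
    obtain x where x: "x \<in> carrier_vec n" "x \<noteq> 0\<^sub>v n" "B *\<^sub>v x = k \<cdot>\<^sub>v x"
      using k B unfolding spectrum_def eigenvalue_def eigenvector_def by auto
    have "x \<bullet> (B *\<^sub>v x) = k * (x \<bullet> x)" using x by simp
    with v(4)[OF x(1)] w(4)[OF x(1)] scalar_prod_self_pos[OF x(1,2)] show ?thesis by auto
  qed
  then have "Min (spectrum B) = l" "Max (spectrum B) = h"
    using fin l h by (auto intro!: Min_eqI Max_eqI)
  with l h v(4) w(4) show "Min (spectrum B) \<in> spectrum B" "Max (spectrum B) \<in> spectrum B"
    "\<And>x. x \<in> carrier_vec n \<Longrightarrow> Min (spectrum B) * (x \<bullet> x) \<le> x \<bullet> (B *\<^sub>v x)"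
    "\<And>x. x \<in> carrier_vec n \<Longrightarrow> x \<bullet> (B *\<^sub>v x) \<le> Max (spectrum B) * (x \<bullet> x)" by auto
qed

section \<open>Orthonormal eigenbases and the positive definite square root\<close>

definition dyad_sum :: "nat \<Rightarrow> nat \<Rightarrow> (nat \<Rightarrow> real) \<Rightarrow> (nat \<Rightarrow> real vec) \<Rightarrow> real mat" where
  "dyad_sum n k f v = mat n n (\<lambda>(r, s). \<Sum>i<k. f i * (v i $ r) * (v i $ s))"

lemma dyad_sum_carrier [simp]: "dyad_sum n k f v \<in> carrier_mat n n"
  and dyad_sum_sym [simp]: "transpose_mat (dyad_sum n k f v) = dyad_sum n k f v"
  by (auto simp: dyad_sum_def mult_ac)

lemma dyad_sum_mult_vec:
  assumes "x \<in> carrier_vec n" "r < n" "\<And>i. i < k \<Longrightarrow> v i \<in> carrier_vec n"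
  shows "(dyad_sum n k f v *\<^sub>v x) $ r = (\<Sum>i<k. f i * (v i \<bullet> x) * (v i $ r))"
proof -
  have "(dyad_sum n k f v *\<^sub>v x) $ r = (\<Sum>s\<in>{0..<n}. \<Sum>i<k. f i * (v i $ r) * (v i $ s) * x $ s)"
    using assms by (simp add: dyad_sum_def scalar_prod_def sum_distrib_right)
  also have "\<dots> = (\<Sum>i<k. \<Sum>s\<in>{0..<n}. f i * (v i $ r) * (v i $ s) * x $ s)" by (rule sum.swap)
  also have "\<dots> = (\<Sum>i<k. f i * (v i \<bullet> x) * (v i $ r))"
    using assms by (intro sum.cong) (auto simp: scalar_prod_def sum_distrib_left sum_distrib_right mult_ac)
  finally show ?thesis .
qed

lemma dyad_sum_form:
  assumes "x \<in> carrier_vec n" "\<And>i. i < k \<Longrightarrow> v i \<in> carrier_vec n"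
  shows "x \<bullet> (dyad_sum n k f v *\<^sub>v x) = (\<Sum>i<k. f i * (v i \<bullet> x)\<^sup>2)"
proof -
  have "x \<bullet> (dyad_sum n k f v *\<^sub>v x) = (\<Sum>r\<in>{0..<n}. x $ r * (\<Sum>i<k. f i * (v i \<bullet> x) * (v i $ r)))"
    unfolding scalar_prod_def[of x "dyad_sum n k f v *\<^sub>v x"] using assms
    by (intro sum.cong) (auto simp: dyad_sum_mult_vec carrier_matD[OF dyad_sum_carrier] simp del: index_mult_mat_vec)
  also have "\<dots> = (\<Sum>i<k. \<Sum>r\<in>{0..<n}. x $ r * (f i * (v i \<bullet> x) * (v i $ r)))"
    unfolding sum_distrib_left by (rule sum.swap)
  also have "\<dots> = (\<Sum>i<k. f i * (v i \<bullet> x)\<^sup>2)"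
  proof (rule sum.cong[OF refl])
    fix i assume "i \<in> {..<k}"
    have "(\<Sum>r\<in>{0..<n}. x $ r * (f i * (v i \<bullet> x) * (v i $ r))) = f i * (v i \<bullet> x) * (\<Sum>r\<in>{0..<n}. v i $ r * x $ r)"
      unfolding sum_distrib_left by (simp add: mult_ac)
    also have "(\<Sum>r\<in>{0..<n}. v i $ r * x $ r) = v i \<bullet> x" using assms by (simp add: scalar_prod_def)
    finally show "(\<Sum>r\<in>{0..<n}. x $ r * (f i * (v i \<bullet> x) * (v i $ r))) = f i * (v i \<bullet> x)\<^sup>2"
      by (simp add: power2_eq_square)
  qed
  finally show ?thesis .
qed

definition orthonormal_eigenvectors :: "nat \<Rightarrow> real mat \<Rightarrow> nat \<Rightarrow> (nat \<Rightarrow> real vec) \<Rightarrow> (nat \<Rightarrow> real) \<Rightarrow> bool" where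
  "orthonormal_eigenvectors n B k v e \<longleftrightarrow>
     (\<forall>i<k. v i \<in> carrier_vec n \<and> B *\<^sub>v v i = e i \<cdot>\<^sub>v v i) \<and>
     (\<forall>i<k. \<forall>j<k. v i \<bullet> v j = (if i = j then 1 else 0))"

text \<open>The vectors become the rows of a square matrix padded with zero rows. As row
  \<open>k\<close> is zero, there is no right inverse, hence a nontrivial kernel.\<close>

lemma exists_orthogonal_vec:
  assumes k: "k < n" and v: "\<And>i. i < k \<Longrightarrow> v i \<in> carrier_vec n"
  obtains y :: "real vec" where "y \<in> carrier_vec n" "y \<noteq> 0\<^sub>v n" "\<And>i. i < k \<Longrightarrow> v i \<bullet> y = 0"
proof -
  define Y where "Y = mat n n (\<lambda>(i, j). if i < k then v i $ j else 0)"
  have Y: "Y \<in> carrier_mat n n" by (simp add: Y_def)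
  have "\<exists>y\<in>carrier_vec n. y \<noteq> 0\<^sub>v n \<and> Y *\<^sub>v y = 0\<^sub>v n"
  proof (rule ccontr)
    assume "\<not> ?thesis"
    then have V: "minv Y \<in> carrier_mat n n" "Y * minv Y = 1\<^sub>m n" using minv_inverse[OF Y] by blast+
    have "(Y * minv Y) $$ (k, k) = 0" using V(1) k by (simp add: Y_def scalar_prod_def)
    then show False using V(2) k by simp
  qed
  then obtain y where y: "y \<in> carrier_vec n" "y \<noteq> 0\<^sub>v n" "Y *\<^sub>v y = 0\<^sub>v n" by blast
  have "v i \<bullet> y = 0" if "i < k" for i
  proof -
    have "(Y *\<^sub>v y) $ i = v i \<bullet> y" using that k y(1) v by (simp add: Y_def scalar_prod_def)
    then show ?thesis using y(3) that k by simp
  qed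
  with y show ?thesis using that by blast
qed

text \<open>Adding a large multiple of \<open>\<Sum>i<k. v\<^sub>i v\<^sub>i\<^sup>T\<close> moves the known eigenvalues above all others,
  so that a minimiser of the Rayleigh quotient is orthogonal to the known eigenvectors.\<close>

lemma extend_orthonormal_eigenvectors:
  assumes B: "B \<in> carrier_mat n n" "transpose_mat B = B" and k: "k < n"
    and v: "orthonormal_eigenvectors n B k v e"
  shows "\<exists>v e. orthonormal_eigenvectors n B (Suc k) v e"
proof -
  have vc: "\<And>i. i < k \<Longrightarrow> v i \<in> carrier_vec n" and ve: "\<And>i. i < k \<Longrightarrow> B *\<^sub>v v i = e i \<cdot>\<^sub>v v i"
    and vv: "\<And>i j. i < k \<Longrightarrow> j < k \<Longrightarrow> v i \<bullet> v j = (if i = j then 1 else 0)"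
    using v by (auto simp: orthonormal_eigenvectors_def)
  obtain K where K: "K > 0" "\<And>x. x \<in> carrier_vec n \<Longrightarrow> \<bar>x \<bullet> (B *\<^sub>v x)\<bar> \<le> K * (x \<bullet> x)"
    by (rule form_bounded[OF B(1)]) (rule that)
  \<comment> \<open>After the shift each known eigenvalue exceeds K, while a vector orthogonal to
    all known eigenvectors still has quotient at most K. So the minimum \<mu> lies strictly below
    the shifted eigenvalues, and symmetry of \<open>W\<close> forces orthogonality.\<close>
  define c where "c = K + 1 + (\<Sum>i<k. \<bar>e i\<bar>)"
  have c: "e i + c > K" if "i < k" for i
    using member_le_sum[of i "{..<k}" "\<lambda>i. \<bar>e i\<bar>"] that by (simp add: c_def)
  define P where "P = dyad_sum n k (\<lambda>_. c) v"
  define W where "W = B + P"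
  have P: "P \<in> carrier_mat n n" by (simp add: P_def)
  have W: "W \<in> carrier_mat n n" "transpose_mat W = W"
    using B P by (auto simp: W_def transpose_add[of _ n n]) (simp add: P_def)
  have Wx: "W *\<^sub>v x = B *\<^sub>v x + P *\<^sub>v x" if "x \<in> carrier_vec n" for x
    using that B P by (simp add: W_def add_mult_distrib_mat_vec[of _ n n])
  have Wv: "W *\<^sub>v v j = (e j + c) \<cdot>\<^sub>v v j" if j: "j < k" for j
  proof (rule eq_vecI)
    fix r assume "r < dim_vec ((e j + c) \<cdot>\<^sub>v v j)"
    then have r: "r < n" using vc[OF j] by simp
    have "(P *\<^sub>v v j) $ r = (\<Sum>i<k. c * (v i \<bullet> v j) * (v i $ r))"
      unfolding P_def using vc j r by (intro dyad_sum_mult_vec) auto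
    also have "\<dots> = (\<Sum>i<k. if i = j then c * v j $ r else 0)"
      using vv j by (intro sum.cong) auto
    also have "\<dots> = c * v j $ r" using j by simp
    finally show "(W *\<^sub>v v j) $ r = ((e j + c) \<cdot>\<^sub>v v j) $ r"
      using Wx[OF vc[OF j]] ve[OF j] vc[OF j] r P by (simp add: algebra_simps del: index_mult_mat_vec)
  qed (use vc[OF j] W in auto)
  have "n \<ge> 1" using k by simp
  from this W obtain \<mu> w where w: "w \<in> carrier_vec n" "w \<noteq> 0\<^sub>v n" "W *\<^sub>v w = \<mu> \<cdot>\<^sub>v w"
    "\<And>x. x \<in> carrier_vec n \<Longrightarrow> \<mu> * (x \<bullet> x) \<le> x \<bullet> (W *\<^sub>v x)"
    by (rule rayleigh_min_eigenvector) (rule that)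
  obtain y where y: "y \<in> carrier_vec n" "y \<noteq> 0\<^sub>v n" "\<And>i. i < k \<Longrightarrow> v i \<bullet> y = 0"
    using exists_orthogonal_vec[of k n v, OF k vc] by blast
  have "y \<bullet> (P *\<^sub>v y) = 0" unfolding P_def using y vc by (simp add: dyad_sum_form)
  then have "y \<bullet> (W *\<^sub>v y) = y \<bullet> (B *\<^sub>v y)"
    using Wx[OF y(1)] y(1) B P by (simp add: scalar_prod_add_distrib[of _ n])
  then have "\<mu> * (y \<bullet> y) \<le> K * (y \<bullet> y)" using w(4)[OF y(1)] K(2)[OF y(1)] by linarith
  then have \<mu>: "\<mu> \<le> K" using scalar_prod_self_pos[OF y(1,2)] by simp
  have wv: "v j \<bullet> w = 0" if j: "j < k" for j
  proof -
    have "v j \<bullet> (W *\<^sub>v w) = w \<bullet> (W *\<^sub>v v j)" using sym_scalar_prod[OF W vc[OF j] w(1)] .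
    then have "\<mu> * (v j \<bullet> w) = (e j + c) * (w \<bullet> v j)" using w(1,3) Wv[OF j] vc[OF j] by simp
    then have "(e j + c - \<mu>) * (v j \<bullet> w) = 0"
      using comm_scalar_prod[OF w(1) vc[OF j]] by (simp add: algebra_simps)
    then show ?thesis using c[OF j] \<mu> by auto
  qed
  have Pw: "P *\<^sub>v w = 0\<^sub>v n"
  proof (rule eq_vecI)
    fix r assume "r < dim_vec (0\<^sub>v n :: real vec)"
    then have "(P *\<^sub>v w) $ r = (\<Sum>i<k. c * (v i \<bullet> w) * (v i $ r))"
      unfolding P_def using vc w(1) by (intro dyad_sum_mult_vec) auto
    then show "(P *\<^sub>v w) $ r = 0\<^sub>v n $ r" using wv \<open>r < dim_vec _\<close> by simp
  qed (use P in auto)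
  then have Bw: "B *\<^sub>v w = \<mu> \<cdot>\<^sub>v w" using Wx[OF w(1)] w(1,3) B by simp
  define u where "u = (1 / sqrt (w \<bullet> w)) \<cdot>\<^sub>v w"
  have pos: "w \<bullet> w > 0" using scalar_prod_self_pos[OF w(1,2)] .
  have u: "u \<in> carrier_vec n" using w(1) by (simp add: u_def)
  have uu: "u \<bullet> u = 1" using w(1) pos by (simp add: u_def)
  have Bu: "B *\<^sub>v u = \<mu> \<cdot>\<^sub>v u"
    using w(1) Bw B by (simp add: u_def mult_mat_vec[of _ n n] smult_smult_assoc mult.commute)
  have vu: "v j \<bullet> u = 0" "u \<bullet> v j = 0" if "j < k" for j
    using wv[OF that] vc[OF that] w(1) comm_scalar_prod[OF w(1) vc[OF that]] by (auto simp: u_def)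
  have "orthonormal_eigenvectors n B (Suc k) (v(k := u)) (e(k := \<mu>))"
    unfolding orthonormal_eigenvectors_def using vc ve vv u uu Bu vu by (auto simp: less_Suc_eq)
  then show ?thesis by blast
qed

lemma spectral_theorem:
  assumes B: "B \<in> carrier_mat n n" "transpose_mat B = B"
  obtains v e where "orthonormal_eigenvectors n B n v e"
proof -
  have "\<exists>v e. orthonormal_eigenvectors n B k v e" if "k \<le> n" for k
    using that
  proof (induction k)
    case (Suc k)
    then show ?case using extend_orthonormal_eigenvectors[OF B, of k] by (meson Suc_le_lessD Suc_leD)
  qed (intro exI[of _ "\<lambda>_. 0\<^sub>v n"] exI[of _ "\<lambda>_. 0"], simp add: orthonormal_eigenvectors_def)
  then show ?thesis using that by blast
qed

text \<open>For orthonormal vectors \<open>dyad_sum\<close> is a functional calculus: the dyads are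
  mutually orthogonal projections, so coefficients multiply. It is applied with square roots as
  coefficients.\<close>

lemma dyad_sum_mult:
  assumes v: "\<And>i. i < k \<Longrightarrow> v i \<in> carrier_vec n"
    and vv: "\<And>i j. i < k \<Longrightarrow> j < k \<Longrightarrow> v i \<bullet> v j = (if i = j then 1 else 0)"
  shows "dyad_sum n k f v * dyad_sum n k g v = dyad_sum n k (\<lambda>i. f i * g i) v"
proof (rule eq_matI)
  fix r t assume "r < dim_row (dyad_sum n k (\<lambda>i. f i * g i) v)" "t < dim_col (dyad_sum n k (\<lambda>i. f i * g i) v)"
  then have rt: "r < n" "t < n" by (auto simp: dyad_sum_def)
  have c: "col (dyad_sum n k g v) t \<in> carrier_vec n"
    by (intro carrier_vecI) (simp add: dyad_sum_def)
  have ip: "v i \<bullet> col (dyad_sum n k g v) t = g i * v i $ t" if i: "i < k" for i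
  proof -
    have "v i \<bullet> col (dyad_sum n k g v) t = (\<Sum>s\<in>{0..<n}. \<Sum>j<k. v i $ s * (g j * v j $ s * v j $ t))"
      using rt by (simp add: scalar_prod_def dyad_sum_def sum_distrib_left)
    also have "\<dots> = (\<Sum>j<k. \<Sum>s\<in>{0..<n}. v i $ s * (g j * v j $ s * v j $ t))" by (rule sum.swap)
    also have "\<dots> = (\<Sum>j<k. g j * v j $ t * (v i \<bullet> v j))"
      using v by (intro sum.cong) (auto simp: scalar_prod_def sum_distrib_left carrier_vecD[OF v] mult_ac)
    also have "\<dots> = (\<Sum>j<k. if j = i then g i * v i $ t else 0)"
      using vv i by (intro sum.cong) auto
    finally show ?thesis using i by simp
  qed
  have "(dyad_sum n k f v * dyad_sum n k g v) $$ (r, t) = (dyad_sum n k f v *\<^sub>v col (dyad_sum n k g v) t) $ r"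
    using rt by (simp add: dyad_sum_def)
  also have "\<dots> = (\<Sum>i<k. f i * (g i * v i $ t) * v i $ r)"
    using dyad_sum_mult_vec[where f = f and v = v and k = k, OF c rt(1) v] ip by simp
  also have "\<dots> = dyad_sum n k (\<lambda>i. f i * g i) v $$ (r, t)"
    using rt by (simp add: dyad_sum_def mult_ac)
  finally show "(dyad_sum n k f v * dyad_sum n k g v) $$ (r, t) = dyad_sum n k (\<lambda>i. f i * g i) v $$ (r, t)" .
qed (auto simp: dyad_sum_def)

text \<open>Orthonormality says U^T U = 1 for the matrix with columns \<open>v i\<close>; for a
  square matrix this gives U U^T = 1, the resolution of the identity.\<close>

lemma dyad_sum_complete:
  assumes v: "\<And>i. i < n \<Longrightarrow> v i \<in> carrier_vec n"
    and vv: "\<And>i j. i < n \<Longrightarrow> j < n \<Longrightarrow> v i \<bullet> v j = (if i = j then 1 else 0)"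
  shows "dyad_sum n n (\<lambda>_. 1) v = 1\<^sub>m n"
proof -
  define U where "U = mat n n (\<lambda>(r, i). v i $ r)"
  have U: "U \<in> carrier_mat n n" "transpose_mat U \<in> carrier_mat n n" by (auto simp: U_def)
  have "transpose_mat U * U = 1\<^sub>m n"
  proof (rule eq_matI)
    fix i j assume "i < dim_row (1\<^sub>m n :: real mat)" "j < dim_col (1\<^sub>m n :: real mat)"
    then have ij: "i < n" "j < n" by auto
    have "(transpose_mat U * U) $$ (i, j) = v i \<bullet> v j"
      using ij v[of j] by (simp add: U_def scalar_prod_def)
    then show "(transpose_mat U * U) $$ (i, j) = 1\<^sub>m n $$ (i, j)" using ij vv by simp
  qed (auto simp: U_def)
  then have "U * transpose_mat U = 1\<^sub>m n" using mat_mult_left_right_inverse[OF U(2,1)] by blast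
  moreover have "U * transpose_mat U = dyad_sum n n (\<lambda>_. 1) v"
    by (rule eq_matI) (auto simp: U_def dyad_sum_def scalar_prod_def lessThan_atLeast0)
  ultimately show ?thesis by simp
qed

lemma spd_sqrt_exists:
  assumes B: "spd n B"
  shows "\<exists>S. spd n S \<and> S * S = B"
proof -
  note D = spdD[OF B]
  obtain v e where "orthonormal_eigenvectors n B n v e" using spectral_theorem[OF D(1,2)] .
  then have vc: "\<And>i. i < n \<Longrightarrow> v i \<in> carrier_vec n" and ve: "\<And>i. i < n \<Longrightarrow> B *\<^sub>v v i = e i \<cdot>\<^sub>v v i"
    and vv: "\<And>i j. i < n \<Longrightarrow> j < n \<Longrightarrow> v i \<bullet> v j = (if i = j then 1 else 0)"
    by (auto simp: orthonormal_eigenvectors_def)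
  have e: "e i > 0" if i: "i < n" for i
  proof -
    have "v i \<noteq> 0\<^sub>v n" using vv[OF i i] by auto
    then have "0 < v i \<bullet> (B *\<^sub>v v i)" using D(3) vc[OF i] by blast
    then show ?thesis using ve[OF i] vv[OF i i] vc[OF i] by simp
  qed
  have id: "dyad_sum n n (\<lambda>_. 1) v = 1\<^sub>m n" using dyad_sum_complete vc vv by blast
  have "B = dyad_sum n n e v"
  proof (rule eq_matI)
    fix r t assume rt: "r < dim_row (dyad_sum n n e v)" "t < dim_col (dyad_sum n n e v)"
    then have rt: "r < n" "t < n" by (auto simp: dyad_sum_def)
    \<comment> \<open>Inserting the resolution of the identity and applying \<open>B\<close> to each
      eigenvector produces the spectral decomposition.\<close>
    have "B $$ (r, t) = (B * dyad_sum n n (\<lambda>_. 1) v) $$ (r, t)" unfolding id using D(1) by simp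
    also have "\<dots> = (\<Sum>s\<in>{0..<n}. \<Sum>i<n. B $$ (r, s) * (v i $ s * v i $ t))"
      using D(1) rt by (simp add: dyad_sum_def scalar_prod_def sum_distrib_left)
    also have "\<dots> = (\<Sum>i<n. \<Sum>s\<in>{0..<n}. B $$ (r, s) * (v i $ s * v i $ t))" by (rule sum.swap)
    also have "\<dots> = (\<Sum>i<n. (B *\<^sub>v v i) $ r * v i $ t)"
      using D(1) rt vc by (intro sum.cong) (auto simp: scalar_prod_def sum_distrib_left
            carrier_vecD[OF vc] mult_ac intro!: sum.cong)
    also have "\<dots> = dyad_sum n n e v $$ (r, t)"
      using rt ve vc by (auto simp: dyad_sum_def carrier_vecD[OF vc] intro!: sum.cong)
    finally show "B $$ (r, t) = dyad_sum n n e v $$ (r, t)" .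
  qed (use D(1) in \<open>auto simp: dyad_sum_def\<close>)
  also have "\<dots> = dyad_sum n n (\<lambda>i. sqrt (e i) * sqrt (e i)) v"
    using e by (intro eq_matI) (auto simp: dyad_sum_def less_imp_le intro!: sum.cong)
  also have "\<dots> = dyad_sum n n (\<lambda>i. sqrt (e i)) v * dyad_sum n n (\<lambda>i. sqrt (e i)) v"
    using dyad_sum_mult[OF vc vv] by simp
  finally have sq: "dyad_sum n n (\<lambda>i. sqrt (e i)) v * dyad_sum n n (\<lambda>i. sqrt (e i)) v = B" by simp
  have "0 < x \<bullet> (dyad_sum n n (\<lambda>i. sqrt (e i)) v *\<^sub>v x)" if x: "x \<in> carrier_vec n" "x \<noteq> 0\<^sub>v n" for x
  proof -
    have "\<exists>i<n. v i \<bullet> x \<noteq> 0"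
    proof (rule ccontr)
      assume "\<not> ?thesis"
      then have "(\<Sum>i<n. 1 * (v i \<bullet> x)\<^sup>2) = 0" by simp
      then have "x \<bullet> (1\<^sub>m n *\<^sub>v x) = 0"
        using dyad_sum_form[where f = "\<lambda>_. 1" and v = v and k = n, OF x(1) vc] by (simp add: id)
      then show False using scalar_prod_self_pos[OF x] x by simp
    qed
    then obtain i where i: "i < n" "v i \<bullet> x \<noteq> 0" by blast
    have "0 < sqrt (e i) * (v i \<bullet> x)\<^sup>2" using i e by simp
    also have "\<dots> \<le> (\<Sum>i<n. sqrt (e i) * (v i \<bullet> x)\<^sup>2)"
      using i e by (intro member_le_sum) (auto simp: less_imp_le)
    finally show ?thesis using dyad_sum_form[OF x(1) vc] by simp
  qed
  then have "spd n (dyad_sum n n (\<lambda>i. sqrt (e i)) v)" by (auto simp: spd_def)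
  with sq show ?thesis by blast
qed

text \<open>If \<open>S\<^sup>2 = S'\<^sup>2\<close> and \<open>D = S - S'\<close> then \<open>S D + D S' = 0\<close>, so an eigenvector \<open>v\<close> of \<open>D\<close> for \<open>\<mu>\<close>
  satisfies \<open>\<mu> (v\<^sup>T S v + v\<^sup>T S' v) = 0\<close>.\<close>

lemma spd_sqrt_diff_nonneg:
  assumes S: "spd n S" and S': "spd n S'" and eq: "S * S = S' * S'" and n: "n \<ge> 1"
    and x: "x \<in> carrier_vec n"
  shows "0 \<le> x \<bullet> ((S - S') *\<^sub>v x)"
proof -
  note D = spdD[OF S] and D' = spdD[OF S']
  have c: "S - S' \<in> carrier_mat n n" "transpose_mat (S - S') = S - S'"
    using D D' by (auto simp: transpose_minus[of _ n n])
  obtain \<mu> v where v: "v \<in> carrier_vec n" "v \<noteq> 0\<^sub>v n" "(S - S') *\<^sub>v v = \<mu> \<cdot>\<^sub>v v"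
    "\<And>x. x \<in> carrier_vec n \<Longrightarrow> \<mu> * (x \<bullet> x) \<le> x \<bullet> ((S - S') *\<^sub>v x)"
    by (rule rayleigh_min_eigenvector[OF n c]) (rule that)
  let ?s = "S *\<^sub>v v" and ?t = "S' *\<^sub>v v"
  have st: "?s \<in> carrier_vec n" "?t \<in> carrier_vec n" using D D' v by auto
  have Dv: "?s - ?t = \<mu> \<cdot>\<^sub>v v" using v(1,3) D(1) D'(1) by (simp add: minus_mult_distrib_mat_vec[of _ n n])
  have "S *\<^sub>v ?s = S' *\<^sub>v ?t"
    using assoc_mult_mat_vec[OF D(1,1) v(1)] assoc_mult_mat_vec[OF D'(1,1) v(1)] eq by simp
  then have "v \<bullet> (S *\<^sub>v ?s) = v \<bullet> (S' *\<^sub>v ?t)" by simp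
  then have ss: "?s \<bullet> ?s = ?t \<bullet> ?t"
    using sym_scalar_prod[OF D(1,2) v(1) st(1)] sym_scalar_prod[OF D'(1,2) v(1) st(2)] by simp
  have "(?s - ?t) \<bullet> (?s + ?t) = 0"
    using ss st comm_scalar_prod[OF st]
    by (simp add: minus_scalar_prod_distrib[of _ n] scalar_prod_add_distrib[of _ n])
  then have "\<mu> * (v \<bullet> ?s + v \<bullet> ?t) = 0"
    unfolding Dv using v(1) st by (simp add: scalar_prod_add_distrib[of _ n] distrib_left)
  moreover have "0 < v \<bullet> ?s" "0 < v \<bullet> ?t" using D(3) D'(3) v(1,2) by auto
  ultimately have "\<mu> = 0" by simp
  then show ?thesis using v(4)[OF x] by simp
qed

text \<open>Exchanging the roles of the two roots shows that the form of their difference is zero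
  everywhere; Cauchy-Schwarz for this semidefinite form then kills each entry.\<close>

lemma spd_sqrt_unique:
  assumes S: "spd n S" and S': "spd n S'" and eq: "S * S = S' * S'" and n: "n \<ge> 1"
  shows "S = S'"
proof -
  note D = spdD[OF S] and D' = spdD[OF S']
  have c: "S - S' \<in> carrier_mat n n" "transpose_mat (S - S') = S - S'"
    using D D' by (auto simp: transpose_minus[of _ n n])
  have nn: "0 \<le> x \<bullet> ((S - S') *\<^sub>v x)" if "x \<in> carrier_vec n" for x
    by (rule spd_sqrt_diff_nonneg[OF S S' eq n that])
  have z: "x \<bullet> ((S - S') *\<^sub>v x) = 0" if x: "x \<in> carrier_vec n" for x
  proof -
    have "0 \<le> x \<bullet> ((S' - S) *\<^sub>v x)" by (rule spd_sqrt_diff_nonneg[OF S' S eq[symmetric] n x])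
    then have "0 \<le> - (x \<bullet> ((S - S') *\<^sub>v x))"
      using x D(1) D'(1) by (simp add: minus_mult_distrib_mat_vec[of _ n n] scalar_prod_minus_distrib[of _ n])
    with nn[OF x] show ?thesis by simp
  qed
  show ?thesis
  proof (rule eq_matI)
    fix i j assume "i < dim_row S'" "j < dim_col S'"
    then have ij: "i < n" "j < n" using D'(1) by auto
    have "(unit_vec n i \<bullet> ((S - S') *\<^sub>v unit_vec n j))\<^sup>2 \<le> 0"
      using form_cauchy_schwarz[OF c nn, of "unit_vec n i" "unit_vec n j"] z[of "unit_vec n i"] by simp
    then have "unit_vec n i \<bullet> ((S - S') *\<^sub>v unit_vec n j) = 0" by simp
    then have "(S - S') $$ (i, j) = 0" using ij c(1) D D' by simp
    then show "S $$ (i, j) = S' $$ (i, j)" using ij D(1) D'(1) by simp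
  qed (use D D' in auto)
qed

text \<open>\<open>inv_sqrt_mat\<close> is a definite description and carries no information until
  existence and uniqueness of the root are both known; this is the purpose of the spectral theorem
  here.\<close>

lemma inv_sqrt_mat_spd:
  assumes M: "spd n M" and n: "n \<ge> 1"
  shows "spd n (inv_sqrt_mat n M)" "inv_sqrt_mat n M * inv_sqrt_mat n M = minv M"
proof -
  have "\<exists>!S. spd n S \<and> S * S = minv M"
    using spd_sqrt_exists[OF spd_minv[OF M]] spd_sqrt_unique[OF _ _ _ n] by metis
  from theI'[OF this] show "spd n (inv_sqrt_mat n M)" "inv_sqrt_mat n M * inv_sqrt_mat n M = minv M"
    by (auto simp: inv_sqrt_mat_def)
qed

text \<open>With y = M^(1/2) x, obtained as \<open>S *\<^sub>v (M *\<^sub>v x)\<close>, the Rayleigh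
  quotient of the preconditioned matrix at \<open>y\<close> is that of A relative to M at
  \<open>x\<close>. From here on the inequalities lM \<le> A \<le> \<kappa> l M stand in for square
  roots and eigenvalues.\<close>

lemma preconditioned_bounds:
  assumes A: "spd n A" and M: "spd n M" and n: "n \<ge> 1"
  defines "\<kappa> \<equiv> cond_number (inv_sqrt_mat n M * A * inv_sqrt_mat n M)"
  obtains l where "l > 0" "\<kappa> \<ge> 1"
    "\<And>x. x \<in> carrier_vec n \<Longrightarrow> l * (x \<bullet> (M *\<^sub>v x)) \<le> x \<bullet> (A *\<^sub>v x)"
    "\<And>x. x \<in> carrier_vec n \<Longrightarrow> x \<bullet> (A *\<^sub>v x) \<le> \<kappa> * l * (x \<bullet> (M *\<^sub>v x))"
proof -
  define S where "S = inv_sqrt_mat n M"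
  have S: "spd n S" "S * S = minv M" using inv_sqrt_mat_spd[OF M n] by (auto simp: S_def)
  note DS = spdD[OF S(1)] and DA = spdD[OF A] and DM = spdD[OF M]
  define B where "B = S * A * S"
  have B: "B \<in> carrier_mat n n" using DS DA by (auto simp: B_def)
  have Bsym: "transpose_mat B = B"
    using DS(1,2) DA(1,2) by (simp add: B_def transpose_mult[of _ n n _ n] assoc_mult_mat[of _ n n _ n _ n])
  have Bx: "B *\<^sub>v y = S *\<^sub>v (A *\<^sub>v (S *\<^sub>v y))" if "y \<in> carrier_vec n" for y
    using that DS(1) DA(1) by (simp add: B_def assoc_mult_mat_vec[of _ n n _ n])
  have form: "y \<bullet> (B *\<^sub>v y) = (S *\<^sub>v y) \<bullet> (A *\<^sub>v (S *\<^sub>v y))" if y: "y \<in> carrier_vec n" for y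
  proof -
    have "A *\<^sub>v (S *\<^sub>v y) \<in> carrier_vec n" "S *\<^sub>v y \<in> carrier_vec n" using DS(1) DA(1) y by auto
    then show ?thesis
      using sym_scalar_prod[OF DS(1,2) y, of "A *\<^sub>v (S *\<^sub>v y)"] comm_scalar_prod Bx[OF y] by metis
  qed
  define l where "l = Min (spectrum B)"
  define h where "h = Max (spectrum B)"
  note sp = spectrum_bounds[OF n B Bsym, folded l_def h_def]
  have "l > 0"
  proof -
    obtain v where v: "v \<in> carrier_vec n" "v \<noteq> 0\<^sub>v n" "B *\<^sub>v v = l \<cdot>\<^sub>v v"
      using sp(1) B unfolding spectrum_def eigenvalue_def eigenvector_def by auto
    have "S *\<^sub>v v \<noteq> 0\<^sub>v n" using spd_injective[OF S(1) v(1)] v(2) by blast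
    then have "0 < (S *\<^sub>v v) \<bullet> (A *\<^sub>v (S *\<^sub>v v))" using DA(3) DS(1) v(1) by simp
    then have "0 < l * (v \<bullet> v)" using form[OF v(1)] v by simp
    then show ?thesis using scalar_prod_self_pos[OF v(1,2)] by (simp add: zero_less_mult_iff)
  qed
  have \<kappa>: "\<kappa> = h / l" by (simp add: \<kappa>_def cond_number_def h_def l_def B_def S_def)
  have bounds: "l * (x \<bullet> (M *\<^sub>v x)) \<le> x \<bullet> (A *\<^sub>v x) \<and> x \<bullet> (A *\<^sub>v x) \<le> h * (x \<bullet> (M *\<^sub>v x))"
    if x: "x \<in> carrier_vec n" for x
  proof -
    define y where "y = S *\<^sub>v (M *\<^sub>v x)"
    have Mx: "M *\<^sub>v x \<in> carrier_vec n" using DM(1) x by simp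
    have y: "y \<in> carrier_vec n" using DS(1) Mx by (simp add: y_def)
    have "S *\<^sub>v y = (S * S) *\<^sub>v (M *\<^sub>v x)" unfolding y_def using DS(1) Mx by simp
    also have "\<dots> = (minv M * M) *\<^sub>v x" unfolding S(2) using DM(1,5) x by simp
    also have "\<dots> = x" using DM(7) x by simp
    finally have Sy: "S *\<^sub>v y = x" .
    have "y \<bullet> y = (M *\<^sub>v x) \<bullet> (S *\<^sub>v y)" using sym_scalar_prod[OF DS(1,2) y Mx] by (simp add: y_def)
    then have "y \<bullet> y = x \<bullet> (M *\<^sub>v x)" using Sy comm_scalar_prod[OF x Mx] by simp
    then show ?thesis using sp(3,4)[OF y] form[OF y] Sy by simp
  qed
  have "l \<le> h"
  proof -
    obtain e :: "real vec" where e: "e \<in> carrier_vec n" "e \<noteq> 0\<^sub>v n"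
      using n that[of "unit_vec n 0"] unit_vec_nonzero[of 0 n] by simp
    then have "l * (e \<bullet> (M *\<^sub>v e)) \<le> h * (e \<bullet> (M *\<^sub>v e))" "0 < e \<bullet> (M *\<^sub>v e)"
      using bounds[OF e(1)] DM(3)[OF e] by linarith+
    then show ?thesis by (rule mult_right_le_imp_le)
  qed
  with \<open>l > 0\<close> have "\<kappa> \<ge> 1" "\<kappa> * l = h" by (auto simp: \<kappa>)
  with \<open>l > 0\<close> bounds show ?thesis using that by metis
qed

section \<open>The inexact Lanczos recurrence\<close>

lemma mnorm_nonneg: "spd n B \<Longrightarrow> x \<in> carrier_vec n \<Longrightarrow> 0 \<le> mnorm B x"
  by (simp add: mnorm_def spdD(4))

lemma mnorm_square: "spd n B \<Longrightarrow> x \<in> carrier_vec n \<Longrightarrow> (mnorm B x)\<^sup>2 = x \<bullet> (B *\<^sub>v x)"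
  by (simp add: mnorm_def spdD(4))

lemma mnorm_cauchy_schwarz:
  assumes B: "spd n B" and x: "x \<in> carrier_vec n" "y \<in> carrier_vec n"
  shows "\<bar>x \<bullet> (B *\<^sub>v y)\<bar> \<le> mnorm B x * mnorm B y"
proof -
  have "(x \<bullet> (B *\<^sub>v y))\<^sup>2 \<le> (mnorm B x * mnorm B y)\<^sup>2"
    using form_cauchy_schwarz[OF spdD(1,2,4)[OF B] x] mnorm_square[OF B] x
    by (simp add: power_mult_distrib)
  then show ?thesis
    by (rule abs_le_square_iff[THEN iffD2, THEN order_trans])
      (simp add: mnorm_nonneg[OF B] x abs_mult)
qed

lemma mnorm_smult:
  assumes B: "spd n B" and x: "x \<in> carrier_vec n"
  shows "mnorm B (c \<cdot>\<^sub>v x) = \<bar>c\<bar> * mnorm B x"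
proof -
  have "(c \<cdot>\<^sub>v x) \<bullet> (B *\<^sub>v (c \<cdot>\<^sub>v x)) = c\<^sup>2 * (x \<bullet> (B *\<^sub>v x))"
    using x spdD(1)[OF B] by (simp add: mult_mat_vec[of _ n n] power2_eq_square)
  then show ?thesis by (simp add: mnorm_def real_sqrt_mult)
qed

definition lincomb :: "nat \<Rightarrow> nat \<Rightarrow> (nat \<Rightarrow> real) \<Rightarrow> (nat \<Rightarrow> real vec) \<Rightarrow> real vec" where
  "lincomb n k s y = vec n (\<lambda>r. \<Sum>i<k. s i * y i $ r)"

lemma lincomb_carrier [simp]: "lincomb n k s y \<in> carrier_vec n"
  by (simp add: lincomb_def)

lemma lincomb_scalar_prod:
  assumes "x \<in> carrier_vec n" "\<And>i. i < k \<Longrightarrow> y i \<in> carrier_vec n"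
  shows "lincomb n k s y \<bullet> x = (\<Sum>i<k. s i * (y i \<bullet> x))"
proof -
  have "lincomb n k s y \<bullet> x = (\<Sum>r\<in>{0..<n}. \<Sum>i<k. s i * y i $ r * x $ r)"
    using assms(1) by (simp add: lincomb_def scalar_prod_def sum_distrib_right)
  also have "\<dots> = (\<Sum>i<k. \<Sum>r\<in>{0..<n}. s i * y i $ r * x $ r)" by (rule sum.swap)
  also have "\<dots> = (\<Sum>i<k. s i * (y i \<bullet> x))"
    using assms(1) by (intro sum.cong) (auto simp: scalar_prod_def sum_distrib_left mult_ac)
  finally show ?thesis .
qed

lemma lincomb_form:
  assumes B: "B \<in> carrier_mat n n" "transpose_mat B = B" and x: "x \<in> carrier_vec n"
    and y: "\<And>i. i < k \<Longrightarrow> y i \<in> carrier_vec n"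
  shows "x \<bullet> (B *\<^sub>v lincomb n k s y) = (\<Sum>i<k. s i * (x \<bullet> (B *\<^sub>v y i)))"
proof -
  have "x \<bullet> (B *\<^sub>v lincomb n k s y) = lincomb n k s y \<bullet> (B *\<^sub>v x)"
    by (rule sym_scalar_prod[OF B x]) simp
  also have "\<dots> = (\<Sum>i<k. s i * (y i \<bullet> (B *\<^sub>v x)))"
    using B x y by (intro lincomb_scalar_prod) auto
  also have "\<dots> = (\<Sum>i<k. s i * (x \<bullet> (B *\<^sub>v y i)))"
    using sym_scalar_prod[OF B x] y by (intro sum.cong) auto
  finally show ?thesis .
qed

lemma lincomb_square_form:
  assumes B: "B \<in> carrier_mat n n" "transpose_mat B = B"
    and y: "\<And>i. i < k \<Longrightarrow> y i \<in> carrier_vec n"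
  shows "lincomb n k s y \<bullet> (B *\<^sub>v lincomb n k s y) = (\<Sum>i<k. \<Sum>j<k. s i * s j * (y i \<bullet> (B *\<^sub>v y j)))"
proof -
  have "lincomb n k s y \<bullet> (B *\<^sub>v lincomb n k s y) = (\<Sum>i<k. s i * (y i \<bullet> (B *\<^sub>v lincomb n k s y)))"
    using B y by (intro lincomb_scalar_prod) auto
  also have "\<dots> = (\<Sum>i<k. s i * (\<Sum>j<k. s j * (y i \<bullet> (B *\<^sub>v y j))))"
    using lincomb_form[OF B _ y] y by (intro sum.cong) auto
  finally show ?thesis by (simp add: sum_distrib_left mult.assoc)
qed

section \<open>What an inexact solve preserves\<close>

locale inexact_preconditioner =
  fixes n :: nat and A M :: "real mat" and l \<kappa> \<epsilon>0 :: real and solve :: "real vec \<Rightarrow> real vec"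
  assumes A: "spd n A" and M: "spd n M" and l_pos: "0 < l" and \<kappa>_ge_1: "1 \<le> \<kappa>"
    and lower: "\<And>x. x \<in> carrier_vec n \<Longrightarrow> l * (x \<bullet> (M *\<^sub>v x)) \<le> x \<bullet> (A *\<^sub>v x)"
    and upper: "\<And>x. x \<in> carrier_vec n \<Longrightarrow> x \<bullet> (A *\<^sub>v x) \<le> \<kappa> * l * (x \<bullet> (M *\<^sub>v x))"
    and \<epsilon>0: "0 \<le> \<epsilon>0" "\<epsilon>0 \<le> 1 / 10"
    and solve_carrier: "\<And>r. r \<in> carrier_vec n \<Longrightarrow> solve r \<in> carrier_vec n"
    and solve_error: "\<And>r. r \<in> carrier_vec n \<Longrightarrow>
      mnorm M (solve r - minv M *\<^sub>v r) \<le> \<epsilon>0 * mnorm M (minv M *\<^sub>v r)"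
begin

lemma minv_carrier: "r \<in> carrier_vec n \<Longrightarrow> minv M *\<^sub>v r \<in> carrier_vec n"
  using spdD(5)[OF M] by simp

lemma M_minv: "r \<in> carrier_vec n \<Longrightarrow> M *\<^sub>v (minv M *\<^sub>v r) = r"
  using assoc_mult_mat_vec[OF spdD(1,5)[OF M]] spdD(6)[OF M] by simp

text \<open>The M-norm of M^(-1) r acts as the dual norm of \<open>r\<close>.\<close>

lemma scalar_prod_residual:
  assumes "x \<in> carrier_vec n" "r \<in> carrier_vec n"
  shows "\<bar>x \<bullet> r\<bar> \<le> mnorm M x * mnorm M (minv M *\<^sub>v r)"
  using mnorm_cauchy_schwarz[OF M assms(1) minv_carrier[OF assms(2)]] M_minv[OF assms(2)] by simp

lemma minv_mnorm_square:
  assumes r: "r \<in> carrier_vec n"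
  shows "(mnorm M (minv M *\<^sub>v r))\<^sup>2 = (minv M *\<^sub>v r) \<bullet> r"
  using mnorm_square[OF M minv_carrier[OF r]] M_minv[OF r] by simp

lemma minv_mnorm_pos:
  assumes r: "r \<in> carrier_vec n" "r \<noteq> 0\<^sub>v n"
  shows "0 < mnorm M (minv M *\<^sub>v r)"
proof -
  have "minv M *\<^sub>v r \<noteq> 0\<^sub>v n" using M_minv[OF r(1)] r(2) mult_mat_zero_vec[OF spdD(1)[OF M]] by auto
  then show ?thesis using spdD(3)[OF M minv_carrier[OF r(1)]] by (simp add: mnorm_def)
qed

text \<open>The deviation is the pairing of s - M^(-1) r with \<open>r\<close>. For small
  \<open>\<epsilon>0\<close> it keeps the product positive, so the square roots of the algorithm are
  taken of positive numbers.\<close>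

lemma approx_inverse_form:
  assumes r: "r \<in> carrier_vec n" and s: "s \<in> carrier_vec n"
    and err: "mnorm M (s - minv M *\<^sub>v r) \<le> \<epsilon>0 * mnorm M (minv M *\<^sub>v r)"
  shows "\<bar>s \<bullet> r - (mnorm M (minv M *\<^sub>v r))\<^sup>2\<bar> \<le> \<epsilon>0 * (mnorm M (minv M *\<^sub>v r))\<^sup>2"
proof -
  let ?p = "minv M *\<^sub>v r"
  have p: "?p \<in> carrier_vec n" using minv_carrier r by blast
  have "s \<bullet> r - (mnorm M ?p)\<^sup>2 = (s - ?p) \<bullet> r"
    using minv_mnorm_square[OF r] r s p by (simp add: minus_scalar_prod_distrib[of _ n])
  also have "\<bar>\<dots>\<bar> \<le> mnorm M (s - ?p) * mnorm M ?p"
    using r s p by (intro scalar_prod_residual) auto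
  also have "\<dots> \<le> (\<epsilon>0 * mnorm M ?p) * mnorm M ?p"
    using err mnorm_nonneg[OF M p] by (intro mult_right_mono) auto
  finally show ?thesis by (simp add: power2_eq_square mult.assoc)
qed

text \<open>What one iteration guarantees, without its history. Near-symmetry and the Gram estimate
  for Lanczos vectors with distant indices use nothing else.\<close>

definition pair :: "real vec \<Rightarrow> real vec \<Rightarrow> bool" where
  "pair q y \<longleftrightarrow> q \<in> carrier_vec n \<and> y \<in> carrier_vec n \<and> y \<bullet> q = 1 \<and>
     mnorm M (y - minv M *\<^sub>v q) \<le> \<epsilon>0 * mnorm M (minv M *\<^sub>v q)"

text \<open>The error bound for \<open>solve\<close> is relative, so it survives the scaling by
  1/\<beta>; the scaling itself makes the pairing exactly 1.\<close>

lemma normalized_pair: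
  assumes r: "r \<in> carrier_vec n" "r \<noteq> 0\<^sub>v n"
  defines "\<beta> \<equiv> sqrt (r \<bullet> solve r)"
  shows "\<beta> > 0" "pair ((1 / \<beta>) \<cdot>\<^sub>v r) ((1 / \<beta>) \<cdot>\<^sub>v solve r)"
    "\<beta>\<^sup>2 \<le> (1 + \<epsilon>0) * (mnorm M (minv M *\<^sub>v r))\<^sup>2"
proof -
  let ?p = "minv M *\<^sub>v r" and ?s = "solve r"
  have c: "?p \<in> carrier_vec n" "?s \<in> carrier_vec n" using minv_carrier solve_carrier r by auto
  have pos: "0 < (mnorm M ?p)\<^sup>2" using minv_mnorm_pos[OF r] by simp
  have f: "\<bar>?s \<bullet> r - (mnorm M ?p)\<^sup>2\<bar> \<le> \<epsilon>0 * (mnorm M ?p)\<^sup>2"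
    using approx_inverse_form[OF r(1) c(2) solve_error[OF r(1)]] .
  have cs: "?s \<bullet> r = r \<bullet> ?s" using comm_scalar_prod c r by blast
  have "\<epsilon>0 * (mnorm M ?p)\<^sup>2 \<le> 1 / 10 * (mnorm M ?p)\<^sup>2" using \<epsilon>0 pos by (intro mult_right_mono) auto
  then have rs: "0 < r \<bullet> ?s" using f cs pos by linarith
  then show \<beta>: "\<beta> > 0" by (simp add: \<beta>_def)
  have \<beta>2: "\<beta>\<^sup>2 = r \<bullet> ?s" using rs by (simp add: \<beta>_def)
  show "\<beta>\<^sup>2 \<le> (1 + \<epsilon>0) * (mnorm M ?p)\<^sup>2" using f cs \<beta>2 by (simp add: algebra_simps)
  have m1: "minv M *\<^sub>v ((1 / \<beta>) \<cdot>\<^sub>v r) = (1 / \<beta>) \<cdot>\<^sub>v ?p"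
    using r spdD(5)[OF M] by (simp add: mult_mat_vec[of _ n n])
  have m2: "(1 / \<beta>) \<cdot>\<^sub>v ?s - (1 / \<beta>) \<cdot>\<^sub>v ?p = (1 / \<beta>) \<cdot>\<^sub>v (?s - ?p)"
    using c by (intro eq_vecI) (auto simp: right_diff_distrib carrier_matD[OF spdD(5)[OF M]])
  have m3: "mnorm M ((1 / \<beta>) \<cdot>\<^sub>v (?s - ?p)) \<le> \<epsilon>0 * mnorm M ((1 / \<beta>) \<cdot>\<^sub>v ?p)"
    using solve_error[OF r(1)] \<beta> c mnorm_smult[OF M] by (simp add: divide_right_mono)
  have m4: "((1 / \<beta>) \<cdot>\<^sub>v ?s) \<bullet> ((1 / \<beta>) \<cdot>\<^sub>v r) = 1"
  proof -
    have "((1 / \<beta>) \<cdot>\<^sub>v ?s) \<bullet> ((1 / \<beta>) \<cdot>\<^sub>v r) = 1 / \<beta> * (1 / \<beta> * (?s \<bullet> r))"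
      using c r by simp
    also have "?s \<bullet> r = \<beta> * \<beta>" using cs \<beta>2 by (simp add: power2_eq_square)
    finally show ?thesis using \<beta> by simp
  qed
  show "pair ((1 / \<beta>) \<cdot>\<^sub>v r) ((1 / \<beta>) \<cdot>\<^sub>v solve r)"
    unfolding pair_def using c r m3 by (intro conjI m4) (simp_all add: m1 m2)
qed

text \<open>An early stop is therefore an exact breakdown: a vanishing \<beta> means a vanishing
  vector \<open>w\<close>, in spite of the inexact solves.\<close>

lemma solve_zero_imp_zero:
  "r \<in> carrier_vec n \<Longrightarrow> sqrt (r \<bullet> solve r) = 0 \<Longrightarrow> r = 0\<^sub>v n"
  using normalized_pair(1) by force

lemma pair_residual_norm:
  assumes "pair q y"
  shows "mnorm M (minv M *\<^sub>v q) \<le> 11 / 10"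
proof -
  let ?g = "mnorm M (minv M *\<^sub>v q)"
  have "\<bar>1 - ?g\<^sup>2\<bar> \<le> \<epsilon>0 * ?g\<^sup>2" using approx_inverse_form[of q y] assms by (simp add: pair_def)
  moreover have "\<epsilon>0 * ?g\<^sup>2 \<le> 1 / 10 * ?g\<^sup>2" using \<epsilon>0 by (intro mult_right_mono) auto
  ultimately have "?g\<^sup>2 \<le> (11 / 10)\<^sup>2" by (simp add: power2_eq_square)
  then show ?thesis by (rule power2_le_imp_le) simp
qed

text \<open>M y - q is M applied to the error of \<open>y\<close>; the factor 11/10 bounds the
  M-norm of M^(-1) q.\<close>

lemma pair_form_deviation:
  assumes "pair q y" "x \<in> carrier_vec n"
  shows "\<bar>x \<bullet> (M *\<^sub>v y) - x \<bullet> q\<bar> \<le> mnorm M x * (11 / 10 * \<epsilon>0)"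
proof -
  let ?p = "minv M *\<^sub>v q"
  have c: "q \<in> carrier_vec n" "y \<in> carrier_vec n" "?p \<in> carrier_vec n"
    and err: "mnorm M (y - ?p) \<le> \<epsilon>0 * mnorm M ?p"
    using assms minv_carrier by (auto simp: pair_def)
  have "M *\<^sub>v (y - ?p) = M *\<^sub>v y - q"
    using c spdD(1)[OF M] by (simp add: mult_minus_distrib_mat_vec[of _ n n] M_minv)
  then have "x \<bullet> (M *\<^sub>v y) - x \<bullet> q = x \<bullet> (M *\<^sub>v (y - ?p))"
    using c assms(2) spdD(1)[OF M] by (simp add: scalar_prod_minus_distrib[of _ n])
  also have "\<bar>\<dots>\<bar> \<le> mnorm M x * mnorm M (y - ?p)"
    using c assms(2) by (intro mnorm_cauchy_schwarz[OF M]) auto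
  also have "mnorm M x * mnorm M (y - ?p) \<le> mnorm M x * (\<epsilon>0 * (11 / 10))"
    using err mult_left_mono[OF pair_residual_norm[OF assms(1)] \<epsilon>0(1)] mnorm_nonneg[OF M assms(2)]
    by (intro mult_left_mono) auto
  finally show ?thesis by (simp add: mult.commute)
qed

lemma pair_norm:
  assumes "pair q y"
  shows "mnorm M y \<le> 6 / 5"
proof (rule ccontr)
  assume "\<not> ?thesis"
  then have t: "mnorm M y > 6 / 5" by simp
  have y: "y \<in> carrier_vec n" "y \<bullet> q = 1" using assms by (auto simp: pair_def)
  have "(mnorm M y)\<^sup>2 - 1 \<le> mnorm M y * (11 / 10 * \<epsilon>0)"
    using pair_form_deviation[OF assms y(1)] unfolding y(2) mnorm_square[OF M y(1)] by linarith
  also have "\<dots> \<le> mnorm M y * (11 / 100)" using \<epsilon>0 t by (intro mult_left_mono) auto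
  finally have "(mnorm M y)\<^sup>2 - 1 \<le> mnorm M y * (11 / 100)" .
  moreover have "6 / 5 * mnorm M y \<le> (mnorm M y)\<^sup>2" using t by (simp add: power2_eq_square)
  ultimately show False using t by linarith
qed

lemma pair_gram:
  assumes "pair q y" "pair q' y'"
  shows "\<bar>y' \<bullet> (M *\<^sub>v y) - y' \<bullet> q\<bar> \<le> 2 * \<epsilon>0"
proof -
  have y': "y' \<in> carrier_vec n" using assms by (simp add: pair_def)
  have "\<bar>y' \<bullet> (M *\<^sub>v y) - y' \<bullet> q\<bar> \<le> mnorm M y' * (11 / 10 * \<epsilon>0)"
    using pair_form_deviation[OF assms(1) y'] .
  also have "\<dots> \<le> 6 / 5 * (11 / 10 * \<epsilon>0)" using pair_norm[OF assms(2)] \<epsilon>0 by (intro mult_right_mono) auto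
  finally show ?thesis using \<epsilon>0 by simp
qed

text \<open>Both products lie within 2\<epsilon>0 of the symmetric quantity y^T M y'.\<close>

lemma pair_asym:
  assumes "pair q y" "pair q' y'"
  shows "\<bar>y \<bullet> q' - y' \<bullet> q\<bar> \<le> 4 * \<epsilon>0"
proof -
  have "y \<bullet> (M *\<^sub>v y') = y' \<bullet> (M *\<^sub>v y)"
    using assms by (intro sym_scalar_prod[OF spdD(1,2)[OF M]]) (auto simp: pair_def)
  then show ?thesis using pair_gram[OF assms] pair_gram[OF assms(2,1)] by linarith
qed

text \<open>Cauchy-Schwarz for the semidefinite form A - lM, which is bounded by (\<kappa> - 1) l M.
  Having \<kappa> - 1 in place of \<kappa> keeps the off-diagonal coefficients small relative to l
  when \<kappa> is near 1.\<close>

lemma form_deviation: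
  assumes x: "x \<in> carrier_vec n" and y: "y \<in> carrier_vec n"
  shows "\<bar>x \<bullet> (A *\<^sub>v y) - l * (x \<bullet> (M *\<^sub>v y))\<bar> \<le> (\<kappa> - 1) * l * (mnorm M x * mnorm M y)"
proof -
  define f where "f = (\<lambda>x. x \<bullet> (A *\<^sub>v x) - l * (x \<bullet> (M *\<^sub>v x)))"
  have f0: "0 \<le> f x" and f1: "f x \<le> (\<kappa> - 1) * l * (mnorm M x)\<^sup>2" if "x \<in> carrier_vec n" for x
    using lower[OF that] upper[OF that] mnorm_square[OF M that] by (auto simp: f_def algebra_simps)
  have "(x \<bullet> (A *\<^sub>v y) - l * (x \<bullet> (M *\<^sub>v y)))\<^sup>2 \<le> f x * f y"
  proof (rule quadratic_nonneg_discriminant)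
    fix t
    have "f (x + t \<cdot>\<^sub>v y) = f x + 2 * t * (x \<bullet> (A *\<^sub>v y) - l * (x \<bullet> (M *\<^sub>v y))) + t\<^sup>2 * f y"
      using form_expand[OF spdD(1,2)[OF A] x y, of t] form_expand[OF spdD(1,2)[OF M] x y, of t]
      unfolding f_def by (simp add: algebra_simps)
    then show "0 \<le> f x + 2 * t * (x \<bullet> (A *\<^sub>v y) - l * (x \<bullet> (M *\<^sub>v y))) + t\<^sup>2 * f y"
      using f0[of "x + t \<cdot>\<^sub>v y"] x y by simp
  qed
  also have "\<dots> \<le> ((\<kappa> - 1) * l * (mnorm M x)\<^sup>2) * ((\<kappa> - 1) * l * (mnorm M y)\<^sup>2)"
    using f0 f1 x y \<kappa>_ge_1 l_pos by (intro mult_mono) auto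
  also have "\<dots> = ((\<kappa> - 1) * l * (mnorm M x * mnorm M y))\<^sup>2"
    by (simp add: power2_eq_square mult_ac)
  finally have "\<bar>x \<bullet> (A *\<^sub>v y) - l * (x \<bullet> (M *\<^sub>v y))\<bar> \<le> \<bar>(\<kappa> - 1) * l * (mnorm M x * mnorm M y)\<bar>"
    by (simp add: abs_le_square_iff)
  also have "\<dots> = (\<kappa> - 1) * l * (mnorm M x * mnorm M y)"
    using \<kappa>_ge_1 l_pos mnorm_nonneg[OF M] x y by simp
  finally show ?thesis .
qed

end

section \<open>The recurrence as an almost symmetric array\<close>

locale inexact_lanczos = inexact_preconditioner n A M l \<kappa> \<epsilon>0 solve
  for n A M l \<kappa> \<epsilon>0 solve +
  fixes b :: "real vec"
  assumes b: "b \<in> carrier_vec n" "b \<noteq> 0\<^sub>v n"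
begin

text \<open>Indices start at 0: the index \<open>k\<close> belongs to iteration \<open>k + 1\<close> of the algorithm.\<close>

definition qp :: "nat \<Rightarrow> real vec" where "qp k = fst (lz_state A b solve k)"
definition q :: "nat \<Rightarrow> real vec" where "q k = fst (snd (lz_state A b solve k))"
definition y :: "nat \<Rightarrow> real vec" where "y k = fst (snd (snd (lz_state A b solve k)))"
definition bt :: "nat \<Rightarrow> real" where "bt k = snd (snd (snd (lz_state A b solve k)))"
definition al :: "nat \<Rightarrow> real" where "al k = (A *\<^sub>v y k - bt k \<cdot>\<^sub>v qp k) \<bullet> y k"
definition w :: "nat \<Rightarrow> real vec" where "w k = A *\<^sub>v y k - bt k \<cdot>\<^sub>v qp k - al k \<cdot>\<^sub>v q k"

lemma state_0: "qp 0 = 0\<^sub>v n" "q 0 = (1 / lz_z b solve) \<cdot>\<^sub>v b" "y 0 = (1 / lz_z b solve) \<cdot>\<^sub>v solve b" "bt 0 = 0"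
  using b by (auto simp: qp_def q_def y_def bt_def lz_z_def Let_def)

lemma state_Suc:
  "qp (Suc k) = q k" "q (Suc k) = (1 / bt (Suc k)) \<cdot>\<^sub>v w k" "y (Suc k) = (1 / bt (Suc k)) \<cdot>\<^sub>v solve (w k)"
  "bt (Suc k) = sqrt (w k \<bullet> solve (w k))"
  by (auto simp: qp_def q_def y_def bt_def w_def al_def Let_def split: prod.splits)

lemma lz_conv: "lz_qbar A b solve (Suc k) = y k" "lz_beta A b solve (Suc k) = bt k" "lz_alpha A b solve (Suc k) = al k"
  by (auto simp: lz_qbar_def lz_beta_def lz_alpha_def y_def bt_def al_def qp_def split: prod.splits)

lemma state_carrier: "qp k \<in> carrier_vec n" "q k \<in> carrier_vec n" "y k \<in> carrier_vec n" "w k \<in> carrier_vec n"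
proof -
  have w: "w k \<in> carrier_vec n" if "qp k \<in> carrier_vec n" "q k \<in> carrier_vec n" "y k \<in> carrier_vec n" for k
    using that spdD(1)[OF A] by (simp add: w_def)
  have *: "qp k \<in> carrier_vec n \<and> q k \<in> carrier_vec n \<and> y k \<in> carrier_vec n"
  proof (induction k)
    case 0
    then show ?case using b solve_carrier by (simp add: state_0)
  next
    case (Suc k)
    then show ?case using w[of k] solve_carrier by (simp add: state_Suc)
  qed
  then show "qp k \<in> carrier_vec n" "q k \<in> carrier_vec n" "y k \<in> carrier_vec n" "w k \<in> carrier_vec n"
    using w[of k] by auto
qed

text \<open>\<open>sqrt\<close> is an odd function on the reals, so the sign has to come from the
  radicand.\<close>

lemma bt_nonneg: "0 \<le> bt k"
proof (cases k)
  case (Suc j)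
  show ?thesis
  proof (cases "w j = 0\<^sub>v n")
    case True
    then show ?thesis using solve_carrier[of "0\<^sub>v n"] Suc by (simp add: state_Suc)
  next
    case False
    then show ?thesis using normalized_pair(1)[OF state_carrier(4) False] Suc by (simp add: state_Suc)
  qed
qed (simp add: state_0)

sublocale tridiagonal al bt by unfold_locales (rule state_0)

text \<open>The recurrence itself is exact; inexactness enters only the relation between
  \<open>y\<close> and \<open>q\<close>. Tested against \<open>x\<close> it reads as one row of
  \<open>tri\<close>. It also holds at a breakdown, where division by zero makes the next vector
  zero and \<open>w k\<close> is zero as well.\<close>

lemma form_recurrence:
  assumes x: "x \<in> carrier_vec n"
  shows "x \<bullet> (A *\<^sub>v y k) = tri (\<lambda>j. x \<bullet> q j) k"
proof -
  note c = state_carrier[of k] state_carrier[of "Suc k"]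
  have "bt (Suc k) * (x \<bullet> q (Suc k)) = x \<bullet> w k"
  proof (cases "bt (Suc k) = 0")
    case True
    then have "w k = 0\<^sub>v n" using solve_zero_imp_zero[OF c(4)] by (simp add: state_Suc)
    then show ?thesis using True x by simp
  next
    case False
    then show ?thesis using c x by (simp add: state_Suc(2))
  qed
  moreover have "x \<bullet> w k = x \<bullet> (A *\<^sub>v y k) - bt k * (x \<bullet> qp k) - al k * (x \<bullet> q k)"
    using x c spdD(1)[OF A] by (simp add: w_def scalar_prod_minus_distrib[of _ n])
  moreover have "bt k * (x \<bullet> qp k) = bt k * (x \<bullet> q (k - 1))"
    by (cases k) (simp_all add: state_0 state_Suc)
  ultimately show ?thesis by (simp add: tri_def)
qed

definition N :: "nat \<Rightarrow> nat \<Rightarrow> real" where "N i j = y i \<bullet> q j"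

lemma tri_N: "tri (N i) j = y i \<bullet> (A *\<^sub>v y j)"
proof -
  have "N i = (\<lambda>j. y i \<bullet> q j)" by (simp add: N_def fun_eq_iff)
  then show ?thesis using form_recurrence[OF state_carrier(3)] by simp
qed

lemma b_scale: "lz_z b solve > 0"
  using normalized_pair(1)[OF b] by (simp add: lz_z_def)

lemma state_pair:
  assumes "k = 0 \<or> bt k \<noteq> 0"
  shows "pair (q k) (y k)"
proof (cases k)
  case 0
  then show ?thesis using normalized_pair(2)[OF b] by (simp add: state_0 lz_z_def)
next
  case (Suc j)
  then have "w j \<noteq> 0\<^sub>v n" using assms solve_carrier[of "0\<^sub>v n"] by (auto simp: state_Suc(4))
  from normalized_pair(2)[OF state_carrier(4) this] show ?thesis
    using Suc by (simp add: state_Suc)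
qed

text \<open>The coefficient \<open>al k\<close> is chosen to make \<open>w k\<close> orthogonal to
  \<open>y k\<close>, and this works exactly since the pairing of \<open>y k\<close> and
  \<open>q k\<close> is 1.\<close>

lemma N_super:
  assumes "pair (q k) (y k)"
  shows "N k (Suc k) = 0"
proof -
  note c = state_carrier[of k]
  let ?u = "A *\<^sub>v y k - bt k \<cdot>\<^sub>v qp k"
  have u: "?u \<in> carrier_vec n" using c spdD(1)[OF A] by simp
  have "y k \<bullet> w k = y k \<bullet> ?u - al k * (y k \<bullet> q k)"
    using c u by (simp add: w_def scalar_prod_minus_distrib[of _ n])
  also have "\<dots> = 0" using assms comm_scalar_prod[OF u c(3)] by (simp add: pair_def al_def)
  finally show ?thesis using c by (simp add: N_def state_Suc(2))
qed

text \<open>Coercivity is lM \<le> A at a combination of the barred vectors, whose M-Gram matrix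
  agrees with \<open>N\<close> up to 2\<epsilon>0. The asymmetry bound 4\<epsilon>0 serves as the
  common \<eta>.\<close>

lemma lanczos_array:
  assumes nz: "\<And>i. 0 < i \<Longrightarrow> i < m \<Longrightarrow> bt i \<noteq> 0"
  shows "lanczos_array al bt N m l (4 * \<epsilon>0)"
proof unfold_locales
  have pr: "pair (q i) (y i)" if "i < m" for i using state_pair[of i] nz[of i] that by blast
  show "N i i = 1" if "i < m" for i using pr[OF that] by (simp add: N_def pair_def)
  show "N i (Suc i) = 0" if "i < m" for i using N_super[OF pr[OF that]] .
  show "\<bar>N i j - N j i\<bar> \<le> 4 * \<epsilon>0" if "i < m" "j < m" for i j
    unfolding N_def using pair_asym[OF pr pr] that by blast
  show "tri (N i) j = tri (N j) i" for i j
    unfolding tri_N by (rule sym_scalar_prod[OF spdD(1,2)[OF A] state_carrier(3) state_carrier(3)])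
  show "0 < l" by (rule l_pos)
  show "0 \<le> 4 * \<epsilon>0" using \<epsilon>0 by simp
  show "l * ((\<Sum>i<k. \<Sum>j<k. s i * s j * N i j) - 4 * \<epsilon>0 * (\<Sum>i<k. \<bar>s i\<bar>)\<^sup>2)
      \<le> (\<Sum>i<k. \<Sum>j<k. s i * s j * tri (N i) j)" if k: "k \<le> m" for k s
  proof -
    let ?Y = "lincomb n k s y"
    have "(\<Sum>i<k. \<Sum>j<k. s i * s j * (y i \<bullet> (M *\<^sub>v y j)))
        = (\<Sum>i<k. \<Sum>j<k. s i * s j * N i j) + (\<Sum>i<k. \<Sum>j<k. s i * s j * (y i \<bullet> (M *\<^sub>v y j) - N i j))"
      by (simp add: right_diff_distrib sum_subtractf)
    moreover have "\<bar>\<Sum>i<k. \<Sum>j<k. s i * s j * (y i \<bullet> (M *\<^sub>v y j) - N i j)\<bar> \<le> 4 * \<epsilon>0 * (\<Sum>i<k. \<bar>s i\<bar>)\<^sup>2"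
    proof (rule abs_double_sum_le)
      fix i j assume "i < k" "j < k"
      then have "pair (q i) (y i)" "pair (q j) (y j)" using pr k by auto
      from pair_gram[OF this(2,1)] show "\<bar>y i \<bullet> (M *\<^sub>v y j) - N i j\<bar> \<le> 4 * \<epsilon>0"
        unfolding N_def using \<epsilon>0 by linarith
    qed
    ultimately have "(\<Sum>i<k. \<Sum>j<k. s i * s j * N i j) - 4 * \<epsilon>0 * (\<Sum>i<k. \<bar>s i\<bar>)\<^sup>2 \<le> ?Y \<bullet> (M *\<^sub>v ?Y)"
      unfolding lincomb_square_form[OF spdD(1,2)[OF M] state_carrier(3)] by linarith
    then have "l * ((\<Sum>i<k. \<Sum>j<k. s i * s j * N i j) - 4 * \<epsilon>0 * (\<Sum>i<k. \<bar>s i\<bar>)\<^sup>2) \<le> l * (?Y \<bullet> (M *\<^sub>v ?Y))"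
      using l_pos by (intro mult_left_mono) auto
    also have "\<dots> \<le> ?Y \<bullet> (A *\<^sub>v ?Y)" by (rule lower) simp
    also have "\<dots> = (\<Sum>i<k. \<Sum>j<k. s i * s j * tri (N i) j)"
      unfolding tri_N lincomb_square_form[OF spdD(1,2)[OF A] state_carrier(3)] ..
    finally show ?thesis .
  qed
qed

text \<open>In \<open>B\<close> the summand l/64 absorbs all perturbations of a main term
  proportional to \<kappa> - 1. The number 2000 covers 96 * 3 * 4, which is what
  \<open>tri_ge_half\<close> asks for with K = 3\<kappa>l and \<eta> = 4\<epsilon>0, and keeps those
  perturbations below l/64.\<close>

lemma lanczos_bounds:
  assumes m: "m \<ge> 1" and nz: "\<And>i. 0 < i \<Longrightarrow> i < m \<Longrightarrow> bt i \<noteq> 0"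
    and small: "2000 * real m ^ 3 * \<kappa> * \<epsilon>0 \<le> 1"
  defines "B \<equiv> 2 * (\<kappa> - 1) * l + l / 64"
  shows "\<And>i. i < m \<Longrightarrow> bt i \<le> B" "tri_ge (l / 2) m"
proof -
  interpret arr: lanczos_array al bt N m l "4 * \<epsilon>0" using lanczos_array[OF nz] .
  have pr: "pair (q i) (y i)" if "i < m" for i using state_pair[of i] nz[of i] that by blast
  define K where "K = 3 * \<kappa> * l"
  have \<kappa>l: "\<kappa> * l \<ge> l" using \<kappa>_ge_1 l_pos by simp
  have B: "0 \<le> B" "B \<le> 2 * (\<kappa> * l)" using \<kappa>_ge_1 l_pos by (auto simp: B_def algebra_simps)
  have diag: "\<bar>tri (N i) i\<bar> \<le> 2 * (\<kappa> * l)" if "i < m" for i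
  proof -
    have yc: "y i \<in> carrier_vec n" by (rule state_carrier)
    have "0 \<le> tri (N i) i" unfolding tri_N using spdD(4)[OF A yc] .
    moreover have "tri (N i) i \<le> \<kappa> * l * (mnorm M (y i))\<^sup>2"
      unfolding tri_N using upper[OF yc] mnorm_square[OF M yc] by simp
    moreover have "(mnorm M (y i))\<^sup>2 \<le> 2"
      using power_mono[OF pair_norm[OF pr[OF that]] mnorm_nonneg[OF M yc], of 2] by (simp add: power_divide)
    then have "\<kappa> * l * (mnorm M (y i))\<^sup>2 \<le> \<kappa> * l * 2" using \<kappa>l l_pos by (intro mult_left_mono) auto
    ultimately show ?thesis by linarith
  qed
  \<comment> \<open>The M-product of consecutive barred vectors is nearly
    \<open>N i (Suc i) = 0\<close>, so \<open>form_deviation\<close> leaves mainly the part with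
    \<kappa> - 1; (6/5)^2 is rounded up to 2.\<close>
  have off: "\<bar>tri (N i) (Suc i)\<bar> \<le> 2 * (\<kappa> - 1) * l + 2 * l * \<epsilon>0" if i: "Suc i < m" for i
  proof -
    have p: "pair (q i) (y i)" "pair (q (Suc i)) (y (Suc i))" using pr i by auto
    have yc: "y i \<in> carrier_vec n" "y (Suc i) \<in> carrier_vec n" by (rule state_carrier)+
    have "mnorm M (y i) * mnorm M (y (Suc i)) \<le> (6 / 5) * (6 / 5)"
      using pair_norm p mnorm_nonneg[OF M] yc by (intro mult_mono) auto
    then have "(\<kappa> - 1) * l * (mnorm M (y i) * mnorm M (y (Suc i))) \<le> (\<kappa> - 1) * l * 2"
      using \<kappa>_ge_1 l_pos by (intro mult_left_mono) auto
    moreover have "\<bar>y i \<bullet> (M *\<^sub>v y (Suc i))\<bar> \<le> 2 * \<epsilon>0"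
      using pair_gram[OF p(2,1)] N_super[OF p(1)] by (simp add: N_def)
    then have "\<bar>l * (y i \<bullet> (M *\<^sub>v y (Suc i)))\<bar> \<le> l * (2 * \<epsilon>0)"
      unfolding abs_mult using l_pos by (intro mult_mono) auto
    ultimately show ?thesis unfolding tri_N using form_deviation[OF yc] by (simp add: algebra_simps)
  qed
  have m1: "real m \<ge> 1" using m by simp
  have m3: "real m \<le> real m ^ 3" using power_increasing[of 1 3 "real m"] m1 by simp
  have e1: "2000 * (real m * \<kappa> * \<epsilon>0) \<le> 1"
  proof -
    have "real m * (\<kappa> * \<epsilon>0) \<le> real m ^ 3 * (\<kappa> * \<epsilon>0)" using m3 \<kappa>_ge_1 \<epsilon>0 by (intro mult_right_mono) auto
    then show ?thesis using small by (simp add: mult.assoc)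
  qed
  have e2: "2000 * \<epsilon>0 \<le> 1"
  proof -
    have "1 * \<epsilon>0 \<le> real m * \<kappa> * \<epsilon>0" using m1 \<kappa>_ge_1 \<epsilon>0 mult_mono[of 1 "real m" 1 \<kappa>] by (intro mult_right_mono) auto
    then show ?thesis using e1 by linarith
  qed
  have e1l: "2000 * (real m * \<epsilon>0 * (\<kappa> * l)) \<le> l"
    using mult_right_mono[OF e1, of l] l_pos by (simp add: mult_ac)
  have e2l: "2000 * (l * \<epsilon>0) \<le> l" using mult_right_mono[OF e2, of l] l_pos by (simp add: mult_ac)
  have cond1: "2 * (\<kappa> - 1) * l + 2 * l * \<epsilon>0 + m * (4 * \<epsilon>0 * (B + K)) \<le> B"
  proof -
    have "real m * (4 * \<epsilon>0 * (B + K)) \<le> real m * (4 * \<epsilon>0 * (5 * (\<kappa> * l)))"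
      using B(2) \<epsilon>0 by (intro mult_left_mono) (auto simp: K_def)
    also have "\<dots> = 20 * (real m * \<epsilon>0 * (\<kappa> * l))" by simp
    finally have "real m * (4 * \<epsilon>0 * (B + K)) \<le> l / 64 - 2 * (l * \<epsilon>0)"
      using e1l e2l l_pos by linarith
    moreover have "B = 2 * (\<kappa> - 1) * l + l / 64" by (simp add: B_def)
    moreover have "2 * l * \<epsilon>0 = 2 * (l * \<epsilon>0)" by simp
    ultimately show ?thesis by linarith
  qed
  have cond2: "2 * (\<kappa> * l) + 4 * \<epsilon>0 * B \<le> K"
  proof -
    have "4 * \<epsilon>0 * B \<le> 4 * (1 / 10) * (2 * (\<kappa> * l))" using B \<epsilon>0 by (intro mult_mono) auto
    then show ?thesis using \<kappa>l l_pos unfolding K_def by linarith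
  qed
  note cb = arr.coefficient_bounds[OF bt_nonneg diag off B(1) cond1 cond2]
  show bt: "\<And>i. i < m \<Longrightarrow> bt i \<le> B" using cb(1) by blast
  have "96 * real m ^ 3 * K * (4 * \<epsilon>0) \<le> l"
  proof -
    have "2000 * (real m ^ 3 * \<kappa> * \<epsilon>0) * l \<le> 1 * l" using small l_pos by (intro mult_right_mono) (auto simp: mult_ac)
    moreover have "0 \<le> real m ^ 3 * \<kappa> * \<epsilon>0 * l" using \<kappa>_ge_1 \<epsilon>0 l_pos by simp
    ultimately show ?thesis by (simp add: K_def mult_ac)
  qed
  then show "tri_ge (l / 2) m"
  proof (rule arr.tri_ge_half[rotated -1])
    show "\<bar>al i\<bar> \<le> K" if "i < m" for i using cb(2) that by blast
    show "\<bar>bt i\<bar> \<le> K" if "i < m" for i using bt[OF that] bt_nonneg[of i] B(2) \<kappa>l l_pos by (simp add: K_def)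
    show "l \<le> K" using \<kappa>l l_pos by (simp add: K_def)
  qed
qed

end

section \<open>Convergence\<close>

context inexact_lanczos
begin

section \<open>From the last entry of the inverse to the error\<close>

lemma T_mult_vec:
  assumes v: "v \<in> carrier_vec m" and i: "i < m"
  defines "T \<equiv> mat m m (\<lambda>(i, j). if i = j then al i else if j = i + 1 then bt (i + 1)
    else if i = j + 1 then bt (j + 1) else 0)"
  shows "(T *\<^sub>v v) $ i = tri (\<lambda>j. if j < m then v $ j else 0) i"
proof -
  have "(T *\<^sub>v v) $ i = (\<Sum>j\<in>{0..<m}. (if i = j then al i else if j = i + 1 then bt (i + 1)
    else if i = j + 1 then bt (j + 1) else 0) * v $ j)"
    using v i by (simp add: T_def scalar_prod_def)
  also have "\<dots> = (\<Sum>j\<in>{0..<m}. (if j = i then al i * v $ i else 0) + (if j = Suc i then bt (Suc i) * v $ j else 0)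
      + (if Suc j = i then bt i * v $ j else 0))"
    by (intro sum.cong) auto
  also have "\<dots> = al i * v $ i + (if Suc i < m then bt (Suc i) * v $ Suc i else 0)
      + (\<Sum>j\<in>{0..<m}. if Suc j = i then bt i * v $ j else 0)"
    using i by (simp add: sum.distrib)
  also have "(\<Sum>j\<in>{0..<m}. if Suc j = i then bt i * v $ j else 0) = bt i * v $ (i - 1)"
  proof (cases i)
    case (Suc k)
    then show ?thesis using i by simp
  qed (simp add: state_0)
  finally show ?thesis using i by (simp add: tri_def less_imp_diff_less)
qed

text \<open>The residual paired with the error is the squared A-norm of the error. The pairing with
  \<open>q m\<close> costs 1/sqrt l through the M-norm, and the scale \<open>z\<close> costs
  sqrt(\<kappa> l) through M^(-1) b, so l cancels and sqrt \<kappa> remains. The constant 2 rounds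
  up (11/10)^2.\<close>

lemma lanczos_error:
  assumes m: "m \<ge> 1" and nz: "\<And>i. 0 < i \<Longrightarrow> i < m \<Longrightarrow> bt i \<noteq> 0" and ge: "tri_ge (l / 2) m"
    and iters: "lz_iters A b solve t = m"
  obtains u where "\<And>i. i \<ge> m \<Longrightarrow> u i = 0" "\<And>i. i < m \<Longrightarrow> tri u i = (if i = 0 then 1 else 0)"
    "mnorm A (lanczos_out A b solve t - minv A *\<^sub>v b)
      \<le> 2 * sqrt \<kappa> * (bt m * \<bar>u (m - 1)\<bar>) * mnorm A (minv A *\<^sub>v b)"
proof -
  define T where "T = lz_T A b solve t"
  have T_eq: "T = mat m m (\<lambda>(i, j). if i = j then al i else if j = i + 1 then bt (i + 1)
    else if i = j + 1 then bt (j + 1) else 0)"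
    unfolding T_def lz_T_def iters by (intro eq_matI) (auto simp: lz_conv)
  have T: "T \<in> carrier_mat m m" by (simp add: T_eq)
  \<comment> \<open>Coercivity makes T injective, so that \<open>minv\<close> is a true inverse and
    not its default value.\<close>
  have "v = 0\<^sub>v m" if v: "v \<in> carrier_vec m" "T *\<^sub>v v = 0\<^sub>v m" for v
  proof -
    let ?x = "\<lambda>j. if j < m then v $ j else 0"
    have "tri ?x i = 0" if "i < m" for i
      using T_mult_vec[OF v(1) that] v(2) that unfolding T_eq by simp
    then have "l / 2 * (\<Sum>i<m. (?x i)\<^sup>2) \<le> 0" using tri_geD[OF ge, of ?x] by simp
    then have "(\<Sum>i<m. (?x i)\<^sup>2) \<le> 0" using l_pos by (simp add: mult_le_0_iff)
    then have "(\<Sum>i<m. (?x i)\<^sup>2) = 0" by (intro antisym sum_nonneg) auto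
    then have "\<forall>i<m. (?x i)\<^sup>2 = 0" using sum_nonneg_eq_0_iff[of "{..<m}" "\<lambda>i. (?x i)\<^sup>2"] by simp
    then show ?thesis using v(1) by (intro eq_vecI) auto
  qed
  note inv = minv_inverse[OF T this]
  define v where "v = minv T *\<^sub>v unit_vec m 0"
  have v: "v \<in> carrier_vec m" using inv(1) by (simp add: v_def)
  have Tv: "T *\<^sub>v v = unit_vec m 0"
    using assoc_mult_mat_vec[OF T inv(1), of "unit_vec m 0"] inv(2) by (simp add: v_def)
  define u where "u = (\<lambda>j. if j < m then v $ j else 0)"
  have u0: "\<And>i. i \<ge> m \<Longrightarrow> u i = 0" by (simp add: u_def)
  have u1: "tri u i = (if i = 0 then 1 else 0)" if "i < m" for i
    using T_mult_vec[OF v that] Tv that m unfolding T_eq u_def by simp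
  define z where "z = lz_z b solve"
  define out where "out = lanczos_out A b solve t"
  have dimb: "dim_vec b = n" using b(1) by simp
  have out: "out = z \<cdot>\<^sub>v lincomb n m u y"
  proof (rule eq_vecI)
    fix r assume "r < dim_vec (z \<cdot>\<^sub>v lincomb n m u y)"
    then have r: "r < n" by (simp add: lincomb_def)
    have "(lz_Q A b solve t *\<^sub>v v) $ r = (\<Sum>j\<in>{0..<m}. y j $ r * v $ j)"
      using r v dimb by (simp add: lz_Q_def iters scalar_prod_def lz_conv[simplified])
    also have "\<dots> = (\<Sum>j<m. u j * y j $ r)" by (simp add: u_def lessThan_atLeast0 mult.commute)
    finally show "out $ r = (z \<cdot>\<^sub>v lincomb n m u y) $ r"
      using r dimb unfolding out_def lanczos_out_def iters T_def[symmetric] v_def[symmetric] z_def[symmetric]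
      by (simp add: lincomb_def lz_Q_def Let_def del: index_mult_mat_vec)
  qed (simp add: out_def lanczos_out_def lz_Q_def lincomb_def Let_def dimb)
  define xs where "xs = minv A *\<^sub>v b"
  have xs: "xs \<in> carrier_vec n" using spdD(5)[OF A] b by (simp add: xs_def)
  have Axs: "A *\<^sub>v xs = b" using assoc_mult_mat_vec[OF spdD(1,5)[OF A] b(1)] spdD(6)[OF A] b by (simp add: xs_def)
  have outc: "out \<in> carrier_vec n" by (simp add: out)
  have z: "z > 0" unfolding z_def by (rule b_scale)
  \<comment> \<open>Green's identity moves T from the Lanczos vectors to \<open>u\<close>, where it
    gives the first unit vector; the boundary term at \<open>m\<close> is the residual of the
    output.\<close>
  have form: "x \<bullet> (A *\<^sub>v out) = x \<bullet> b + z * (bt m * (u (m - 1) * (x \<bullet> q m)))" if x: "x \<in> carrier_vec n" for x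
  proof -
    have "x \<bullet> (A *\<^sub>v out) = z * (x \<bullet> (A *\<^sub>v lincomb n m u y))"
      using x spdD(1)[OF A] by (simp add: out mult_mat_vec[of _ n n])
    also have "x \<bullet> (A *\<^sub>v lincomb n m u y) = (\<Sum>j<m. u j * tri (\<lambda>j. x \<bullet> q j) j)"
      using lincomb_form[OF spdD(1,2)[OF A] x state_carrier(3)] form_recurrence[OF x] by simp
    also have "\<dots> = (\<Sum>j<m. (x \<bullet> q j) * tri u j) + bt m * (u (m-1) * (x \<bullet> q m))"
      using green[of u "\<lambda>j. x \<bullet> q j" m] u0[of m] by simp
    also have "(\<Sum>j<m. (x \<bullet> q j) * tri u j) = (\<Sum>j<m. (x \<bullet> q j) * (if j = 0 then 1 else 0))"
      using u1 by (intro sum.cong) auto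
    also have "\<dots> = x \<bullet> q 0" using m by (intro sum_delta_mult) auto
    also have "z * (x \<bullet> q 0 + bt m * (u (m-1) * (x \<bullet> q m))) = x \<bullet> b + z * (bt m * (u (m-1) * (x \<bullet> q m)))"
      using z x b by (simp add: state_0 z_def[symmetric] distrib_left)
    finally show ?thesis .
  qed
  define d where "d = out - xs"
  have d: "d \<in> carrier_vec n" using outc xs by (simp add: d_def)
  have "A *\<^sub>v d = A *\<^sub>v out - b"
    using outc xs spdD(1)[OF A] Axs by (simp add: d_def mult_minus_distrib_mat_vec[of _ n n])
  then have dd: "(mnorm A d)\<^sup>2 = z * (bt m * (u (m - 1) * (d \<bullet> q m)))"
    using form[OF d] mnorm_square[OF A d] d b outc spdD(1)[OF A] by (simp add: scalar_prod_minus_distrib[of _ n])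
  have sqrtl: "sqrt l * mnorm M x \<le> mnorm A x" if "x \<in> carrier_vec n" for x
    using real_sqrt_le_mono[OF lower[OF that]] by (simp add: mnorm_def real_sqrt_mult)
  have sqrtL: "mnorm A x \<le> sqrt \<kappa> * sqrt l * mnorm M x" if "x \<in> carrier_vec n" for x
    using real_sqrt_le_mono[OF upper[OF that]] by (simp add: mnorm_def real_sqrt_mult)
  have zb: "z \<le> 11 / 10 * (sqrt \<kappa> * sqrt l * mnorm A xs)"
  proof -
    let ?p = "minv M *\<^sub>v b"
    have p: "?p \<in> carrier_vec n" using minv_carrier b by blast
    have pos: "0 < mnorm M ?p" using minv_mnorm_pos[OF b] .
    have "(mnorm M ?p)\<^sup>2 = ?p \<bullet> (A *\<^sub>v xs)" using minv_mnorm_square[OF b(1)] Axs by simp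
    also have "\<dots> \<le> mnorm A ?p * mnorm A xs" using mnorm_cauchy_schwarz[OF A p xs] by simp
    also have "\<dots> \<le> (sqrt \<kappa> * sqrt l * mnorm M ?p) * mnorm A xs"
      using sqrtL[OF p] mnorm_nonneg[OF A xs] by (intro mult_right_mono) auto
    finally have 1: "mnorm M ?p \<le> sqrt \<kappa> * sqrt l * mnorm A xs"
      using pos by (simp add: power2_eq_square mult_ac)
    have "z\<^sup>2 \<le> (1 + \<epsilon>0) * (mnorm M ?p)\<^sup>2"
      unfolding z_def lz_z_def using normalized_pair(3)[OF b] .
    also have "\<dots> \<le> (11 / 10)\<^sup>2 * (mnorm M ?p)\<^sup>2"
      using \<epsilon>0 by (intro mult_right_mono) (auto simp: power2_eq_square)
    finally have "z\<^sup>2 \<le> (11 / 10 * mnorm M ?p)\<^sup>2" by (simp only: power_mult_distrib)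
    then have "z \<le> 11 / 10 * mnorm M ?p" by (rule power2_le_imp_le) (use pos in simp)
    with 1 show ?thesis by simp
  qed
  have "mnorm A d \<le> 2 * sqrt \<kappa> * (bt m * \<bar>u (m - 1)\<bar>) * mnorm A xs"
  \<comment> \<open>After a breakdown the residual vanishes and the output is exact. Otherwise
    \<open>q m\<close>, one step beyond the vectors that span the output, still belongs to a
    normalized pair.\<close>
  proof (cases "bt m = 0 \<or> mnorm A d = 0")
    case True
    then have "(mnorm A d)\<^sup>2 = 0" using dd by auto
    then show ?thesis using bt_nonneg[of m] \<kappa>_ge_1 mnorm_nonneg[OF A xs] by simp
  next
    case False
    then have dpos: "0 < mnorm A d" and pr: "pair (q m) (y m)"
      using mnorm_nonneg[OF A d] state_pair[of m] by auto
    define g where "g = z * (bt m * \<bar>u (m - 1)\<bar>)"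
    have g: "0 \<le> g" using z bt_nonneg[of m] by (simp add: g_def)
    have "\<bar>d \<bullet> q m\<bar> \<le> mnorm M d * mnorm M (minv M *\<^sub>v q m)"
      using scalar_prod_residual[OF d state_carrier(2)] .
    also have "\<dots> \<le> mnorm M d * (11 / 10)"
      using pair_residual_norm[OF pr] mnorm_nonneg[OF M d] by (intro mult_left_mono) auto
    finally have dq: "\<bar>d \<bullet> q m\<bar> \<le> 11 / 10 * mnorm M d" by simp
    have "(mnorm A d)\<^sup>2 \<le> \<bar>z * (bt m * (u (m - 1) * (d \<bullet> q m)))\<bar>" using dd by simp
    also have "\<dots> = g * \<bar>d \<bullet> q m\<bar>" using z bt_nonneg[of m] by (simp add: g_def abs_mult)
    also have "\<dots> \<le> g * (11 / 10 * mnorm M d)" using dq g by (rule mult_left_mono)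
    finally have "sqrt l * (mnorm A d)\<^sup>2 \<le> sqrt l * (g * (11 / 10 * mnorm M d))"
      using l_pos by (intro mult_left_mono) auto
    also have "\<dots> = 11 / 10 * g * (sqrt l * mnorm M d)" by simp
    also have "\<dots> \<le> 11 / 10 * g * mnorm A d" using sqrtl[OF d] g by (intro mult_left_mono) auto
    finally have "(sqrt l * mnorm A d) * mnorm A d \<le> (11 / 10 * g) * mnorm A d"
      by (simp add: power2_eq_square)
    then have "sqrt l * mnorm A d \<le> 11 / 10 * g" using dpos by (rule mult_right_le_imp_le)
    also have "g \<le> 11 / 10 * (sqrt \<kappa> * sqrt l * mnorm A xs) * (bt m * \<bar>u (m - 1)\<bar>)"
      unfolding g_def using zb bt_nonneg[of m] by (intro mult_right_mono) auto
    finally have "sqrt l * mnorm A d \<le> sqrt l * (121 / 100 * (sqrt \<kappa> * (bt m * \<bar>u (m - 1)\<bar>) * mnorm A xs))"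
      by (simp add: mult_ac)
    then have "mnorm A d \<le> 121 / 100 * (sqrt \<kappa> * (bt m * \<bar>u (m - 1)\<bar>) * mnorm A xs)"
      using l_pos by simp
    moreover have "0 \<le> sqrt \<kappa> * (bt m * \<bar>u (m - 1)\<bar>) * mnorm A xs"
      using \<kappa>_ge_1 bt_nonneg[of m] mnorm_nonneg[OF A xs] by simp
    ultimately show ?thesis by simp
  qed
  then show ?thesis using that[of u] u0 u1 unfolding d_def out_def xs_def by blast
qed

lemma lanczos_convergence:
  assumes t: "t \<ge> 1" and small: "2000 * (real t + 1) ^ 3 * \<kappa> * \<epsilon>0 \<le> 1"
  shows "mnorm A (lanczos_out A b solve t - minv A *\<^sub>v b)
    \<le> 8 * sqrt \<kappa> * (2 * (\<kappa> - 1) + 1 / 64) / (1 + 1 / (4 * sqrt \<kappa>)) ^ (t - 1) * mnorm A (minv A *\<^sub>v b)"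
proof -
  define m where "m = lz_iters A b solve t"
  have beta: "lz_beta A b solve (i + 1) = bt i" for i using lz_conv(2) by simp
  have m: "1 \<le> m" "m \<le> t" "\<And>i. 0 < i \<Longrightarrow> i < m \<Longrightarrow> bt i \<noteq> 0" "bt m = 0 \<or> m = t"
  proof -
    have "1 \<le> m \<and> m \<le> t \<and> (\<forall>i. 0 < i \<longrightarrow> i < m \<longrightarrow> bt i \<noteq> 0) \<and> (bt m = 0 \<or> m = t)"
    proof (cases "\<exists>i. 1 \<le> i \<and> i \<le> t \<and> bt i = 0")
      case True
      then obtain i where i: "1 \<le> i \<and> bt i = 0" "i \<le> t" by blast
      have m: "m = (LEAST i. 1 \<le> i \<and> bt i = 0)" using True by (simp add: m_def lz_iters_def beta[simplified])
      show ?thesis using LeastI[of "\<lambda>i. 1 \<le> i \<and> bt i = 0", OF i(1)] Least_le[of "\<lambda>i. 1 \<le> i \<and> bt i = 0", OF i(1)] i(2)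
          not_less_Least[of _ "\<lambda>i. 1 \<le> i \<and> bt i = 0"] unfolding m[symmetric] by (auto simp: Suc_le_eq)
    next
      case False
      then have "m = t" unfolding m_def lz_iters_def by (auto simp: beta[simplified])
      then show ?thesis using False t by auto
    qed
    then show "1 \<le> m" "m \<le> t" "\<And>i. 0 < i \<Longrightarrow> i < m \<Longrightarrow> bt i \<noteq> 0" "bt m = 0 \<or> m = t" by auto
  qed
  have small': "2000 * real k ^ 3 * \<kappa> * \<epsilon>0 \<le> 1" if "k \<le> t + 1" for k
  proof -
    have "real k \<le> real t + 1" using that by simp
    then have "real k ^ 3 \<le> (real t + 1) ^ 3" by (intro power_mono) auto
    then have "2000 * real k ^ 3 * \<kappa> * \<epsilon>0 \<le> 2000 * (real t + 1) ^ 3 * \<kappa> * \<epsilon>0"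
      using \<kappa>_ge_1 \<epsilon>0 by (intro mult_right_mono mult_left_mono) auto
    then show ?thesis using small by linarith
  qed
  define B where "B = 2 * (\<kappa> - 1) * l + l / 64"
  have sm: "2000 * real m ^ 3 * \<kappa> * \<epsilon>0 \<le> 1" using small' m(2) by simp
  have lb: "\<And>i. i < m \<Longrightarrow> bt i \<le> B"
    by (rule lanczos_bounds(1)[where m = m, folded B_def]) (use m(1,3) sm in auto)
  have ge: "tri_ge (l / 2) m" by (rule lanczos_bounds(2)) (use m(1,3) sm in auto)
  obtain u where u: "\<And>i. i \<ge> m \<Longrightarrow> u i = 0" "\<And>i. i < m \<Longrightarrow> tri u i = (if i = 0 then 1 else 0)"
    and err: "mnorm A (lanczos_out A b solve t - minv A *\<^sub>v b)
      \<le> 2 * sqrt \<kappa> * (bt m * \<bar>u (m - 1)\<bar>) * mnorm A (minv A *\<^sub>v b)"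
    using lanczos_error[OF m(1,3) ge m_def[symmetric]] by blast
  \<comment> \<open>The couplings are at most B \<le> 2\<kappa>l, so the weights lose at most
    B(\<rho> - 1)^2 \<le> l/8; with \<tau> = l/4 this fits below the lower bound l/2.\<close>
  define \<rho> where "\<rho> = 1 + 1 / (4 * sqrt \<kappa>)"
  have \<rho>: "\<rho> \<ge> 1" using \<kappa>_ge_1 by (simp add: \<rho>_def)
  have xn: "0 \<le> mnorm A (minv A *\<^sub>v b)" using spdD(5)[OF A] b by (intro mnorm_nonneg[OF A]) simp
  have B0: "0 \<le> B" using \<kappa>_ge_1 l_pos by (simp add: B_def)
  have prod: "bt m * \<bar>u (m - 1)\<bar> \<le> 4 * (2 * (\<kappa> - 1) + 1 / 64) / \<rho> ^ (t - 1)"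
  proof (cases "bt m = 0")
    case True
    then show ?thesis using \<rho> \<kappa>_ge_1 by simp
  next
    case False
    then have mt: "m = t" using m(4) by simp
    \<comment> \<open>\<open>bt m\<close> is the first coefficient outside the block, so the bounds
      are invoked for size \<open>m + 1\<close>; this is why the smallness hypothesis has t +
      1.\<close>
    have "bt m \<le> B"
    proof (rule lanczos_bounds(1)[where m = "m + 1", folded B_def])
      show "\<And>i. 0 < i \<Longrightarrow> i < m + 1 \<Longrightarrow> bt i \<noteq> 0" using m(3) False by (metis less_Suc_eq Suc_eq_plus1)
    qed (use small'[of "m + 1"] m(2) in auto)
    moreover have "\<bar>u (m - 1)\<bar> * \<rho> ^ (m - 1) \<le> 1 / (l / 4)"
    proof (rule tri_inverse_decay[OF ge u \<rho>])
      show "\<bar>bt i\<bar> \<le> B" if "i < m" for i using lb[OF that] bt_nonneg[of i] by simp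
      have "B * (\<rho> - 1)\<^sup>2 = B / (16 * \<kappa>)" using \<kappa>_ge_1 by (simp add: \<rho>_def power_divide power_mult_distrib)
      also have "\<dots> \<le> (2 * \<kappa> * l) / (16 * \<kappa>)"
        using \<kappa>_ge_1 l_pos by (intro divide_right_mono) (auto simp: B_def algebra_simps)
      also have "\<dots> = l / 8" using \<kappa>_ge_1 by simp
      finally show "l / 4 + B * (\<rho> - 1)\<^sup>2 \<le> l / 2" using l_pos by simp
    qed (use l_pos m(1) in auto)
    then have "\<bar>u (m - 1)\<bar> \<le> 4 / l / \<rho> ^ (m - 1)"
      using \<rho> by (subst pos_le_divide_eq) (auto intro: less_le_trans[of 0 1])
    ultimately have "bt m * \<bar>u (m - 1)\<bar> \<le> B * (4 / l / \<rho> ^ (m - 1))"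
      using B0 by (intro mult_mono) auto
    also have "\<dots> = 4 * (2 * (\<kappa> - 1) + 1 / 64) / \<rho> ^ (m - 1)"
    proof -
      have "B = l * (2 * (\<kappa> - 1) + 1 / 64)" by (simp add: B_def algebra_simps)
      then show ?thesis using l_pos by simp
    qed
    finally show ?thesis using mt by simp
  qed
  have "2 * sqrt \<kappa> * (bt m * \<bar>u (m - 1)\<bar>) * mnorm A (minv A *\<^sub>v b)
      \<le> 2 * sqrt \<kappa> * (4 * (2 * (\<kappa> - 1) + 1 / 64) / \<rho> ^ (t - 1)) * mnorm A (minv A *\<^sub>v b)"
    using prod xn \<kappa>_ge_1 by (intro mult_right_mono mult_left_mono) auto
  also have "\<dots> = 8 * sqrt \<kappa> * (2 * (\<kappa> - 1) + 1 / 64) / \<rho> ^ (t - 1) * mnorm A (minv A *\<^sub>v b)"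
    by simp
  finally show ?thesis using err unfolding \<rho>_def by linarith
qed

end

section \<open>Choice of the constants\<close>

lemma one_minus_inverse_le_ln:
  fixes x :: real
  assumes "x > 0"
  shows "1 - 1 / x \<le> ln x"
  using ln_le_minus_one[of "1 / x"] assms by (simp add: ln_div)

text \<open>From t + 1 \<le> 8002 X^2 and \<kappa> \<le> X the factor in front of
  \<open>\<epsilon>0\<close> is at most 2000 * 8002^3 * X^7. The exponent 100 beats this power of X
  with room to spare, and n \<ge> 2 supplies 2^(-100) against the numerical factor even if X is
  close to 1.\<close>

lemma perturbation_small:
  fixes X \<kappa> \<epsilon>0 :: real and n :: nat
  assumes X: "1 < X" and \<kappa>: "1 \<le> \<kappa>" "\<kappa> \<le> X" and n: "n \<ge> 2"
    and \<epsilon>0: "0 \<le> \<epsilon>0" "\<epsilon>0 \<le> (1 / (X * real n)) powr 100"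
  defines "t \<equiv> nat \<lceil>8000 * sqrt \<kappa> * ln X\<rceil>"
  shows "2000 * (real t + 1) ^ 3 * \<kappa> * \<epsilon>0 \<le> 1" "\<epsilon>0 \<le> 1 / 10"
proof -
  have X2: "X \<le> X\<^sup>2" "1 \<le> X\<^sup>2" using X power_increasing[of 1 2 X] one_le_power[of X 2] by auto
  have "sqrt \<kappa> \<le> X" using \<kappa> by (intro real_le_lsqrt order_trans[OF \<kappa>(2) X2(1)]) auto
  moreover have "0 \<le> ln X" "ln X \<le> X" using X ln_le_minus_one[of X] by auto
  ultimately have "sqrt \<kappa> * ln X \<le> X * X" using \<kappa> X by (intro mult_mono) auto
  moreover have "0 \<le> 8000 * sqrt \<kappa> * ln X" using \<kappa> \<open>0 \<le> ln X\<close> by simp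
  then have "real t \<le> 8000 * sqrt \<kappa> * ln X + 1" unfolding t_def by linarith
  ultimately have t: "real t + 1 \<le> 8002 * X\<^sup>2" using X2(2) by (simp add: power2_eq_square)
  have "\<epsilon>0 \<le> (1 / (X * real n)) ^ 100" using \<epsilon>0(2) X n by (simp add: powr_numeral)
  also have "\<dots> \<le> (1 / (2 * X)) ^ 100" using X n by (intro power_mono divide_left_mono) auto
  finally have e: "\<epsilon>0 \<le> (1 / (2 * X)) ^ 100" .
  have "(1 / (2 * X)) ^ 100 \<le> (1 / 2) ^ 100" using X by (intro power_mono divide_left_mono) auto
  with e show "\<epsilon>0 \<le> 1 / 10" by (simp add: power_divide)
  have "2000 * (real t + 1) ^ 3 * \<kappa> * \<epsilon>0 \<le> 2000 * (8002 * X\<^sup>2) ^ 3 * X * (1 / (2 * X)) ^ 100"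
    using t \<kappa> e \<epsilon>0 X by (intro mult_mono power_mono) auto
  also have "\<dots> = 2000 * 8002 ^ 3 / 2 ^ 100 * (X ^ 7 / X ^ 100)"
    by (simp add: power_mult_distrib power_divide power_mult[symmetric] power_Suc2[symmetric] flip: power_Suc)
  also have "\<dots> \<le> 1 * 1"
    using X by (intro mult_mono) (auto simp: divide_le_eq intro!: power_increasing)
  finally show "2000 * (real t + 1) ^ 3 * \<kappa> * \<epsilon>0 \<le> 1" by simp
qed

lemma convergence_factor_le:
  fixes \<kappa> \<epsilon> :: real
  assumes \<kappa>: "1 \<le> \<kappa>" and \<epsilon>: "0 < \<epsilon>" "\<epsilon> < 1"
  defines "t \<equiv> nat \<lceil>8000 * sqrt \<kappa> * ln (\<kappa> / \<epsilon>)\<rceil>"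
  shows "8 * sqrt \<kappa> * (2 * (\<kappa> - 1) + 1 / 64) / (1 + 1 / (4 * sqrt \<kappa>)) ^ (t - 1) \<le> \<epsilon>"
proof -
  define X where "X = \<kappa> / \<epsilon>"
  define \<rho> where "\<rho> = 1 + 1 / (4 * sqrt \<kappa>)"
  have X: "1 < X" "\<kappa> \<le> X" "\<kappa> = X * \<epsilon>" using \<kappa> \<epsilon> by (auto simp: X_def field_simps)
  have s: "1 \<le> sqrt \<kappa>" "sqrt \<kappa> \<le> \<kappa>"
    using \<kappa> by (auto intro!: real_le_lsqrt simp: power2_eq_square)
  have \<rho>: "1 \<le> \<rho>" using s by (simp add: \<rho>_def)
  have "8 * sqrt \<kappa> * (2 * (\<kappa> - 1) + 1 / 64) / \<rho> ^ (t - 1) \<le> \<epsilon>"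
  \<comment> \<open>Near X = 1 the iteration count may be 1 and there is no decay to use; then
    \<epsilon> \<ge> 100/101, while the prefactor is at most 0.29 thanks to \<kappa> - 1. Otherwise
    ln X is at least 1/101 and the decay does the work.\<close>
  proof (cases "X \<le> 101 / 100")
    case True
    have "X * \<epsilon> \<ge> 1" using X(3) \<kappa> by simp
    moreover have "X * \<epsilon> \<le> 101 / 100 * \<epsilon>" using True \<epsilon> by (intro mult_right_mono) auto
    ultimately have \<epsilon>l: "100 / 101 \<le> \<epsilon>" by simp
    have \<kappa>u: "\<kappa> \<le> 101 / 100" using X(2) True by simp
    have "8 * sqrt \<kappa> * (2 * (\<kappa> - 1) + 1 / 64) / \<rho> ^ (t - 1) \<le> 8 * sqrt \<kappa> * (2 * (\<kappa> - 1) + 1 / 64)"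
      using divide_left_mono[of 1 "\<rho> ^ (t - 1)" "8 * sqrt \<kappa> * (2 * (\<kappa> - 1) + 1 / 64)"] \<rho> \<kappa> s
      by (simp add: one_le_power less_le_trans[of 0 1])
    also have "\<dots> \<le> 8 * (101 / 100) * (2 / 100 + 1 / 64)"
      using \<kappa>u s \<kappa> by (intro mult_mono) auto
    finally show ?thesis using \<epsilon>l by simp
  next
    case False
    define L where "L = ln X"
    have "1 - 1 / X \<le> L" unfolding L_def using X by (intro one_minus_inverse_le_ln) simp
    moreover have "1 / X \<le> 100 / 101" using False X by (simp add: field_simps)
    ultimately have L: "1 / 101 \<le> L" by simp
    have "1 - 1 / \<rho> \<le> ln \<rho>" using \<rho> by (intro one_minus_inverse_le_ln) simp
    moreover have "1 / \<rho> = 4 * sqrt \<kappa> / (4 * sqrt \<kappa> + 1)" using s by (simp add: \<rho>_def field_simps)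
    then have "1 - 1 / \<rho> = 1 / (4 * sqrt \<kappa> + 1)"
    proof -
      have "4 * sqrt \<kappa> + 1 \<noteq> 0" using s by linarith
      then show ?thesis unfolding \<open>1 / \<rho> = _\<close> by (simp add: diff_eq_eq add_divide_distrib[symmetric])
    qed
    moreover have "0 < sqrt \<kappa>" "0 < 4 * sqrt \<kappa> + 1" using s by linarith+
    then have "1 / (5 * sqrt \<kappa>) \<le> 1 / (4 * sqrt \<kappa> + 1)"
      using s by (intro divide_left_mono mult_pos_pos; linarith)
    ultimately have ln\<rho>: "1 / (5 * sqrt \<kappa>) \<le> ln \<rho>" by linarith
    have a0: "0 < 8000 * sqrt \<kappa> * L" using s L by simp
    have t: "8000 * sqrt \<kappa> * L \<le> real t" unfolding t_def L_def X_def by linarith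
    with a0 have "t \<ge> 1" by (cases t) auto
    then have t1: "8000 * sqrt \<kappa> * L - 1 \<le> real (t - 1)" using t by simp
    have sL: "1 * (1 / 101) \<le> sqrt \<kappa> * L" using s L by (intro mult_mono) auto
    \<comment> \<open>Here 1600 = 8000/5, with 5 sqrt \<kappa> from the lower bound for ln \<rho>,
      and 1/5 pays for \<open>t - 1\<close>. The prefactor asks for 2L + 15 at most, and 1598 L
      exceeds 15 + 1/5 once L \<ge> 1/101; this fixes the size of 8000.\<close>
    have "1600 * L - 1 / 5 \<le> (8000 * sqrt \<kappa> * L - 1) * (1 / (5 * sqrt \<kappa>))"
      using s by (simp add: field_simps)
    also have "\<dots> \<le> real (t - 1) * ln \<rho>"
      using t1 ln\<rho> sL s by (intro mult_mono) auto
    finally have "1600 * L - 1 / 5 \<le> ln (\<rho> ^ (t - 1))" using \<rho> by (simp add: ln_realpow)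
    moreover have "ln (16 * X\<^sup>2) \<le> 15 + 2 * L"
      using X ln_le_minus_one[of 16] by (simp add: L_def ln_mult ln_realpow)
    ultimately have "ln (16 * X\<^sup>2) \<le> ln (\<rho> ^ (t - 1))" using L by linarith
    then have p: "16 * X\<^sup>2 \<le> \<rho> ^ (t - 1)" using X \<rho> by simp
    have "8 * sqrt \<kappa> * (2 * (\<kappa> - 1) + 1 / 64) \<le> 8 * \<kappa> * (2 * \<kappa>)"
      using s \<kappa> by (intro mult_mono) auto
    also have "\<dots> = \<epsilon>\<^sup>2 * (16 * X\<^sup>2)" by (simp add: X(3) power2_eq_square)
    also have "\<dots> \<le> \<epsilon> * \<rho> ^ (t - 1)"
      using p \<epsilon> by (intro mult_mono) (auto simp: power2_eq_square)
    finally show ?thesis using \<rho> by (simp add: divide_le_eq)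
  qed
  then show ?thesis by (simp add: \<rho>_def)
qed

text \<open>This case is separate because for \<open>n = 1\<close> the hypothesis on \<open>\<epsilon>0\<close> does not bound the error of \<open>solve\<close>
  away from one.\<close>

lemma lanczos_exact_one_dim:
  assumes A: "spd 1 A" and b: "b \<in> carrier_vec 1" and s: "\<And>r. r \<in> carrier_vec 1 \<Longrightarrow> solve r \<in> carrier_vec 1"
    and pos: "0 < b \<bullet> solve b" and t: "t \<ge> 1"
  shows "lanczos_out A b solve t = minv A *\<^sub>v b"
proof -
  note D = spdD[OF A]
  define z where "z = lz_z b solve"
  define a where "a = A $$ (0, 0)"
  define \<beta> where "\<beta> = b $ 0"
  define \<sigma> where "\<sigma> = solve b $ 0"
  define \<alpha> where "\<alpha> = lz_alpha A b solve 1"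
  have sb: "solve b \<in> carrier_vec 1" using s b by blast
  have bs: "b \<bullet> solve b = \<beta> * \<sigma>" using sb by (simp add: scalar_prod_def \<beta>_def \<sigma>_def)
  have z: "z > 0" "z * z = \<beta> * \<sigma>" using pos bs by (auto simp: z_def lz_z_def)
  have \<sigma>: "\<sigma> \<noteq> 0" "\<beta> \<noteq> 0" using pos bs by auto
  have Av: "(A *\<^sub>v v) $ 0 = a * v $ 0" if "v \<in> carrier_vec 1" for v
    using that D(1) by (simp add: scalar_prod_def a_def)
  have "unit_vec 1 0 \<noteq> (0\<^sub>v 1 :: real vec)" by (simp add: unit_vec_nonzero)
  from D(3)[OF _ this] have a: "a > 0" using Av[of "unit_vec 1 0"] D(1) by (simp add: scalar_prod_def)
  let ?y = "(1 / z) \<cdot>\<^sub>v solve b" and ?q = "(1 / z) \<cdot>\<^sub>v b"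
  have st0: "lz_state A b solve 0 = (0\<^sub>v 1, ?q, ?y, 0)"
    using b by (simp add: Let_def z_def lz_z_def)
  define u where "u = A *\<^sub>v ?y - 0 \<cdot>\<^sub>v 0\<^sub>v 1"
  have u: "u \<in> carrier_vec 1" "u $ 0 = a * (\<sigma> / z)"
    using Av[of ?y] D(1) sb by (auto simp: u_def \<sigma>_def)
  have \<alpha>: "\<alpha> = u \<bullet> ?y" using st0 by (simp add: \<alpha>_def lz_alpha_def u_def)
  then have \<alpha>_eq: "\<alpha> = a * (\<sigma> / z) * (\<sigma> / z)" using u sb by (simp add: scalar_prod_def \<sigma>_def)
  \<comment> \<open>All vectors are multiples of one another, and z^2 = \<beta>\<sigma> makes the
    subtraction cancel \<open>u\<close> exactly; the loop therefore stops after one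
    iteration.\<close>
  have w0: "u - \<alpha> \<cdot>\<^sub>v ?q = 0\<^sub>v 1"
  proof (rule eq_vecI)
    fix i assume "i < dim_vec (0\<^sub>v 1 :: real vec)"
    then have i: "i = 0" by simp
    have "a * (\<sigma> / z) - a * (\<sigma> / z) * (\<sigma> / z) * (\<beta> / z) = a * (\<sigma> / z) * (1 - \<beta> * \<sigma> / (z * z))"
      by (simp add: algebra_simps)
    also have "\<dots> = 0" using z \<sigma> by (auto simp flip: z(2))
    finally have eq: "a * (\<sigma> / z) - a * (\<sigma> / z) * (\<sigma> / z) * (\<beta> / z) = 0" .
    have "(u - \<alpha> \<cdot>\<^sub>v ?q) $ i = u $ 0 - \<alpha> * (\<beta> / z)" using i u(1) b by (simp add: \<beta>_def)
    then show "(u - \<alpha> \<cdot>\<^sub>v ?q) $ i = 0\<^sub>v 1 $ i" unfolding u(2) \<alpha>_eq eq using i by simp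
  qed (use b in auto)
  have "lz_beta A b solve 2 = 0"
  proof -
    have "lz_state A b solve (Suc 0) = (?q, (1 / sqrt (0\<^sub>v 1 \<bullet> solve (0\<^sub>v 1))) \<cdot>\<^sub>v 0\<^sub>v 1,
        (1 / sqrt (0\<^sub>v 1 \<bullet> solve (0\<^sub>v 1))) \<cdot>\<^sub>v solve (0\<^sub>v 1), sqrt (0\<^sub>v 1 \<bullet> solve (0\<^sub>v 1)))"
      using w0 unfolding lz_state.simps(2) st0 u_def \<alpha> by (simp add: Let_def)
    then show ?thesis using s[of "0\<^sub>v 1"] by (simp add: lz_beta_def)
  qed
  then have "1 \<le> (1::nat) \<and> lz_beta A b solve (1 + 1) = 0" by (simp add: numeral_2_eq_2)
  then have it: "lz_iters A b solve t = 1"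
    using t Least_equality[of "\<lambda>i. 1 \<le> i \<and> lz_beta A b solve (i + 1) = 0" 1] unfolding lz_iters_def by auto
  define T where "T = lz_T A b solve t"
  have T: "T \<in> carrier_mat 1 1" "T $$ (0, 0) = \<alpha>" by (auto simp: T_def lz_T_def it \<alpha>_def)
  have \<alpha>0: "\<alpha> \<noteq> 0" using a \<sigma> z by (simp add: \<alpha>_eq)
  have "x = 0\<^sub>v 1" if "x \<in> carrier_vec 1" "T *\<^sub>v x = 0\<^sub>v 1" for x
  proof -
    have "(T *\<^sub>v x) $ 0 = \<alpha> * x $ 0" using that(1) T by (simp add: scalar_prod_def)
    then have "x $ 0 = 0" using that(2) \<alpha>0 by simp
    then show ?thesis using that(1) by (intro eq_vecI) auto
  qed
  note inv = minv_inverse[OF T(1) this]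
  have mi: "C $$ (0, 0) * E $$ (0, 0) = 1"
    if "C \<in> carrier_mat 1 1" "E \<in> carrier_mat 1 1" "C * E = 1\<^sub>m 1" for C E :: "real mat"
  proof -
    have "(C * E) $$ (0, 0) = C $$ (0, 0) * E $$ (0, 0)" using that(1,2) by (simp add: scalar_prod_def)
    then show ?thesis using that(3) by simp
  qed
  have iT: "minv T $$ (0, 0) = 1 / \<alpha>" using mi[OF T(1) inv(1,2)] T(2) \<alpha>0 by (simp add: field_simps)
  have iA: "minv A $$ (0, 0) = 1 / a" using mi[OF D(1,5,6)] a by (simp add: a_def field_simps)
  have Q: "lz_Q A b solve t $$ (0, 0) = \<sigma> / z" "lz_Q A b solve t \<in> carrier_mat 1 1"
    using st0 b sb by (auto simp: lz_Q_def it lz_qbar_def \<sigma>_def Let_def simp del: lz_state.simps)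
  have "lanczos_out A b solve t $ 0 = z * (\<sigma> / z * (1 / \<alpha>))"
    using Q inv(1) iT unfolding lanczos_out_def it T_def[symmetric] z_def[symmetric]
    by (simp add: scalar_prod_def)
  \<comment> \<open>The inaccurate value \<open>\<sigma>\<close> is about to drop out: \<alpha>
    carries \<sigma>^2/z^2, and z^2 = \<beta>\<sigma>.\<close>
  also have "\<dots> = z * z / (a * \<sigma>)" using z(1) a \<sigma> by (simp add: \<alpha>_eq)
  also have "\<dots> = \<beta> / a" using z(2) \<sigma> a by simp
  also have "\<dots> = (minv A *\<^sub>v b) $ 0" using iA D(5) b by (simp add: scalar_prod_def \<beta>_def)
  finally show ?thesis using Q(2) D(5) b
    by (intro eq_vecI) (auto simp: lanczos_out_def)
qed

theorem theorem6p1: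
  shows "\<exists>c::real. c > 0 \<and> (\<exists>C::real. C > 0 \<and>
    (\<forall>(n::nat) (A::real mat) (b::real vec) (M::real mat) (\<epsilon>::real) (\<epsilon>0::real)
        (solve :: real vec \<Rightarrow> real vec) (t::nat).
       n \<ge> 1 \<longrightarrow> spd n A \<longrightarrow> b \<in> carrier_vec n \<longrightarrow> spd n M \<longrightarrow>
       0 < \<epsilon> \<longrightarrow> \<epsilon> < 1 \<longrightarrow>
       (\<forall>r\<in>carrier_vec n. solve r \<in> carrier_vec n \<and>
          mnorm M (solve r - minv M *\<^sub>v r) \<le> \<epsilon>0 * mnorm M (minv M *\<^sub>v r)) \<longrightarrow>
       (let \<kappa> = cond_number (inv_sqrt_mat n M * A * inv_sqrt_mat n M) in
        \<epsilon>0 \<le> (\<epsilon> / (\<kappa> * real n)) powr c \<longrightarrow>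
        t = nat \<lceil>C * sqrt \<kappa> * ln (\<kappa> / \<epsilon>)\<rceil> \<longrightarrow>
        mnorm A (lanczos_out A b solve t - minv A *\<^sub>v b) \<le> \<epsilon> * mnorm A (minv A *\<^sub>v b))))"
proof (rule exI[of _ 100], intro conjI exI[of _ 8000] allI impI)
  show "(0::real) < 100" "(0::real) < 8000" by simp_all
  fix n :: nat and A :: "real mat" and b :: "real vec" and M :: "real mat" and \<epsilon> \<epsilon>0 :: real
    and solve :: "real vec \<Rightarrow> real vec" and t :: nat
  assume n: "n \<ge> 1" and A: "spd n A" and b: "b \<in> carrier_vec n" and M: "spd n M"
    and \<epsilon>: "0 < \<epsilon>" "\<epsilon> < 1"
    and sol: "\<forall>r\<in>carrier_vec n. solve r \<in> carrier_vec n \<and>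
          mnorm M (solve r - minv M *\<^sub>v r) \<le> \<epsilon>0 * mnorm M (minv M *\<^sub>v r)"
  define \<kappa> where "\<kappa> = cond_number (inv_sqrt_mat n M * A * inv_sqrt_mat n M)"
  have "mnorm A (lanczos_out A b solve t - minv A *\<^sub>v b) \<le> \<epsilon> * mnorm A (minv A *\<^sub>v b)"
    if e0: "\<epsilon>0 \<le> (\<epsilon> / (\<kappa> * real n)) powr 100" and t: "t = nat \<lceil>8000 * sqrt \<kappa> * ln (\<kappa> / \<epsilon>)\<rceil>"
  \<comment> \<open>For b = 0 the algorithm normalizes by zero; the output is still the zero vector
    because the vanishing \<open>lz_z\<close> is a factor of it.\<close>
  proof (cases "b = 0\<^sub>v n")
    case True
    have "lanczos_out A b solve t = 0\<^sub>v n"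
      using True sol by (intro eq_vecI) (auto simp: lanczos_out_def lz_z_def lz_Q_def Let_def)
    moreover have "minv A *\<^sub>v b = 0\<^sub>v n" unfolding True by (rule mult_mat_zero_vec[OF spdD(5)[OF A]])
    ultimately show ?thesis using spdD(1)[OF A] by (simp add: mnorm_def mult_mat_zero_vec)
  next
    case False
    obtain l where l: "l > 0" "\<kappa> \<ge> 1"
      "\<And>x. x \<in> carrier_vec n \<Longrightarrow> l * (x \<bullet> (M *\<^sub>v x)) \<le> x \<bullet> (A *\<^sub>v x)"
      "\<And>x. x \<in> carrier_vec n \<Longrightarrow> x \<bullet> (A *\<^sub>v x) \<le> \<kappa> * l * (x \<bullet> (M *\<^sub>v x))"
      by (rule preconditioned_bounds[OF A M n, folded \<kappa>_def]) (rule that)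
    let ?p = "minv M *\<^sub>v b"
    have c: "?p \<in> carrier_vec n" "solve b \<in> carrier_vec n" using spdD(5)[OF M] b sol by auto
    have Mp: "M *\<^sub>v ?p = b" using assoc_mult_mat_vec[OF spdD(1,5)[OF M] b] spdD(6)[OF M] b by simp
    then have "?p \<noteq> 0\<^sub>v n" using False mult_mat_zero_vec[OF spdD(1)[OF M]] by auto
    then have pp: "0 < ?p \<bullet> (M *\<^sub>v ?p)" "0 < mnorm M ?p" using spdD(3)[OF M c(1)] by (auto simp: mnorm_def)
    have "0 \<le> mnorm M (solve b - ?p)" using c by (intro mnorm_nonneg[OF M]) auto
    also have err: "mnorm M (solve b - ?p) \<le> \<epsilon>0 * mnorm M ?p" using sol b by blast
    \<comment> \<open>The sign of \<open>\<epsilon>0\<close> is read off from the solve at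
      \<open>b\<close>, whose exact solution has positive norm.\<close>
    finally have e00: "0 \<le> \<epsilon>0" using pp(2) by (simp add: zero_le_mult_iff)
    have X: "1 < \<kappa> / \<epsilon>" "\<kappa> \<le> \<kappa> / \<epsilon>" using l(2) \<epsilon> by (auto simp: field_simps)
    have t1: "t \<ge> 1"
    proof -
      have "0 < 8000 * sqrt \<kappa> * ln (\<kappa> / \<epsilon>)" using X l(2) by simp
      then show ?thesis unfolding t by linarith
    qed
    show ?thesis
    proof (cases "n = 1")
      case n1: True
      \<comment> \<open>In dimension one only \<open>\<epsilon>0 < 1\<close> is extracted; it keeps
        the pairing of \<open>b\<close> with its approximate solution positive.\<close>
      have "\<epsilon> / (\<kappa> * real n) < 1" "0 < \<epsilon> / (\<kappa> * real n)" using n1 \<epsilon> l(2) by (auto simp: field_simps)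
      then have "(\<epsilon> / (\<kappa> * real n)) powr 100 < 1" by (simp add: powr_numeral power_less_one_iff)
      then have "\<epsilon>0 < 1" using e0 by simp
      have "\<bar>(solve b - ?p) \<bullet> (M *\<^sub>v ?p)\<bar> \<le> mnorm M (solve b - ?p) * mnorm M ?p"
        using c by (intro mnorm_cauchy_schwarz[OF M]) auto
      also have "\<dots> \<le> (\<epsilon>0 * mnorm M ?p) * mnorm M ?p" using err pp(2) by (intro mult_right_mono) auto
      also have "\<dots> = \<epsilon>0 * (?p \<bullet> (M *\<^sub>v ?p))"
        using mnorm_square[OF M c(1)] by (simp add: power2_eq_square mult.assoc)
      also have "\<dots> < 1 * (?p \<bullet> (M *\<^sub>v ?p))" using \<open>\<epsilon>0 < 1\<close> pp(1) by (intro mult_strict_right_mono)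
      finally have "\<bar>solve b \<bullet> b - ?p \<bullet> b\<bar> < ?p \<bullet> b"
        using c b by (simp add: Mp minus_scalar_prod_distrib[of _ n])
      then have "0 < solve b \<bullet> b" by linarith
      then have "0 < b \<bullet> solve b" using comm_scalar_prod[OF b c(2)] by simp
      then have "lanczos_out A b solve t = minv A *\<^sub>v b"
        using A b sol t1 unfolding n1 by (intro lanczos_exact_one_dim) auto
      moreover have xs: "minv A *\<^sub>v b \<in> carrier_vec n" using spdD(5)[OF A] b by simp
      moreover have "mnorm A (0\<^sub>v n) = 0" using spdD(1)[OF A] by (simp add: mnorm_def mult_mat_zero_vec)
      ultimately show ?thesis using mnorm_nonneg[OF A xs] \<epsilon> by simp
    next
      case False
      then have n2: "n \<ge> 2" using n by simp
      have eq: "\<epsilon> / (\<kappa> * real n) = 1 / (\<kappa> / \<epsilon> * real n)" using \<epsilon> by simp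
      have "\<epsilon>0 \<le> (1 / (\<kappa> / \<epsilon> * real n)) powr 100" using e0 unfolding eq .
      note ps = perturbation_small[OF X(1) l(2) X(2) n2 e00 this, folded t]
      interpret inexact_lanczos n A M l \<kappa> \<epsilon>0 solve b
        using A M l e00 ps(2) sol b \<open>b \<noteq> 0\<^sub>v n\<close> by unfold_locales auto
      have xs: "0 \<le> mnorm A (minv A *\<^sub>v b)" using spdD(5)[OF A] b(1) by (intro mnorm_nonneg[OF A]) simp
      show ?thesis
        using lanczos_convergence[OF t1 ps(1)] mult_right_mono[OF convergence_factor_le[OF l(2) \<epsilon>, folded t] xs]
        by linarith
    qed
  qed
  then show "let \<kappa> = cond_number (inv_sqrt_mat n M * A * inv_sqrt_mat n M) in
        \<epsilon>0 \<le> (\<epsilon> / (\<kappa> * real n)) powr 100 \<longrightarrow>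
        t = nat \<lceil>8000 * sqrt \<kappa> * ln (\<kappa> / \<epsilon>)\<rceil> \<longrightarrow>
        mnorm A (lanczos_out A b solve t - minv A *\<^sub>v b) \<le> \<epsilon> * mnorm A (minv A *\<^sub>v b)"
    unfolding Let_def \<kappa>_def by blast
qed

end
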